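(* Let $T>0$ and let $\mu$ be a centred probability measure on $\mathbb{R}$ without atoms. Let $F:\mathbb{R}\times\mathbb{R}\to\mathbb{R}$, $(w,s)\mapsto F(w,s)$, be a continuous strictly supermodular serrated function with ridge $R_F=\{(w,a_w):w\in\mathbb{R}\}$, $a_w\in\mathbb{R}\cup\{-\infty,+\infty\}$. Define $$g(w)=\min\bigl(\beta_\mu(w),\ \max(a_w,0,w)\bigr),$$ where $\beta_\mu$ is the barycenter function of $\mu$. Then there is a $\mu$-admissible process for which the joint distribution of the terminal value $M_T$ and the running maximum $S_T=\max_{0\le t\le T}M_t$ is $g_\#\mu$, and amongst all $\mu$-admissible processes $M$ the functional $\mathbb{E}[F(M_T,S_T)]$ is maximized by the process with this joint distribution.
   Context: A probability measure $\mu$ on $\mathbb{R}$ is centred if $\int_{\mathbb{R}_{\ge 0}}x\,\mu(dx)<+\infty$ and $\int_{\mathbb{R}}x\,\mu(dx)=0$. A process $(M_t)_{0\le t\le T}$ is $\mu$-admissible if it is a uniformly integrable martingale with $M_0=0$ and $M_T\sim\mu$. Different admissible processes may live on different probability spaces; jumps are allowed. $F$ is supermodular if $w_1<w_2$ and $s_1<s_2$ imply $F(w_1,s_1)+F(w_2,s_2)\ge F(w_1,s_2)+F(w_2,s_1)$; it is strictly supermodular if the latter inequality is always strict. $F$ is serrated if for every $w_0\in\mathbb{R}$ there is $a_{w_0}\in\mathbb{R}\cup\{-\infty,+\infty\}$ such that $s\mapsto F(w_0,s)$ is increasing on $(-\infty,a_{w_0})$ and decreasing on $(a_{w_0},+\infty)$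 (the value $-\infty$ or $+\infty$ means that $F(w_0,\cdot)$ is decreasing, respectively increasing, on all of $\mathbb{R}$). The ridge of $F$ is $R_F=\{(w_0,a_{w_0}):w_0\in\mathbb{R}\}$. The barycenter function of $\mu$ is $\beta_\mu(k)=\mathbb{E}_\mu[x\mid x\ge k]$, defined for $k$ with $\mu([k,+\infty))>0$ (a set of full $\mu$-measure). For a function $g$ defined $\mu$-almost everywhere, $g_\#\mu$ denotes the measure on $\mathbb{R}\times\mathbb{R}$ that is the image of $\mu$ under the map $w\mapsto(w,g(w))$. Convention: "the functional is maximized by a process" means that no $\mu$-admissible process achieves a higher value of the functional; if the value of the functional at the maximizing process is $-\infty$, then all $\mu$-admissible processes are optimal. *)

theory Defs
  imports "HOL-Probability.Probability"
begin

definition centred :: "real measure \<Rightarrow> bool" where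
  "centred \<mu> \<longleftrightarrow> integrable \<mu> (\<lambda>x. x) \<and> (\<integral>x. x \<partial>\<mu>) = 0"

text \<open>The value is meaningful only where \<open>\<mu> {k..}\<close> is positive, hence for \<open>\<mu>\<close>-almost every
  \<open>k\<close>; elsewhere it is \<open>0\<close>.\<close>

definition barycenter :: "real measure \<Rightarrow> real \<Rightarrow> real" where
  "barycenter \<mu> k = (LINT x:{k..}|\<mu>. x) / measure \<mu> {k..}"

definition strictly_supermodular :: "(real \<Rightarrow> real \<Rightarrow> real) \<Rightarrow> bool" where
  "strictly_supermodular F \<longleftrightarrow>
     (\<forall>w1 w2 s1 s2. w1 < w2 \<longrightarrow> s1 < s2 \<longrightarrow> F w1 s1 + F w2 s2 > F w1 s2 + F w2 s1)"

text \<open>Monotonicity is non-strict, so a ridge is not necessarily unique;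
  it is a parameter of the following predicate.\<close>

definition serrated_with_ridge :: "(real \<Rightarrow> real \<Rightarrow> real) \<Rightarrow> (real \<Rightarrow> ereal) \<Rightarrow> bool" where
  "serrated_with_ridge F a \<longleftrightarrow>
     (\<forall>w. mono_on {s. ereal s < a w} (F w) \<and> antimono_on {s. a w < ereal s} (F w))"

text \<open>The minimum below is finite, since the maximum is at least \<open>0\<close> and the barycenter is real.\<close>

definition ridge_map :: "real measure \<Rightarrow> (real \<Rightarrow> ereal) \<Rightarrow> real \<Rightarrow> real" where
  "ridge_map \<mu> a w =
     real_of_ereal (min (ereal (barycenter \<mu> w)) (max (a w) (max 0 (ereal w))))"

definition filtration_upto :: "real \<Rightarrow> 'a measure \<Rightarrow> (real \<Rightarrow> 'a measure) \<Rightarrow> bool" where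
  "filtration_upto T N \<F> \<longleftrightarrow>
     (\<forall>t\<in>{0..T}. subalgebra N (\<F> t)) \<and>
     (\<forall>s\<in>{0..T}. \<forall>t\<in>{0..T}. s \<le> t \<longrightarrow> subalgebra (\<F> t) (\<F> s))"

definition cadlag_on :: "real \<Rightarrow> (real \<Rightarrow> real) \<Rightarrow> bool" where
  "cadlag_on T x \<longleftrightarrow>
     (\<forall>t\<in>{0..<T}. (x \<longlongrightarrow> x t) (at_right t)) \<and>
     (\<forall>t\<in>{0<..T}. \<exists>l. (x \<longlongrightarrow> l) (at_left t))"

definition martingale_upto ::
  "real \<Rightarrow> 'a measure \<Rightarrow> (real \<Rightarrow> 'a measure) \<Rightarrow> (real \<Rightarrow> 'a \<Rightarrow> real) \<Rightarrow> bool" where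
  "martingale_upto T N \<F> X \<longleftrightarrow>
     filtration_upto T N \<F> \<and>
     (\<forall>t\<in>{0..T}. X t \<in> borel_measurable (\<F> t) \<and> integrable N (X t)) \<and>
     (\<forall>s\<in>{0..T}. \<forall>t\<in>{0..T}. s \<le> t \<longrightarrow>
        (AE \<omega> in N. real_cond_exp N (\<F> s) (X t) \<omega> = X s \<omega>))"

definition uniformly_integrable ::
  "'a measure \<Rightarrow> 'i set \<Rightarrow> ('i \<Rightarrow> 'a \<Rightarrow> real) \<Rightarrow> bool" where
  "uniformly_integrable N I X \<longleftrightarrow>
     (\<forall>i\<in>I. integrable N (X i)) \<and>
     (\<forall>\<epsilon>>0. \<exists>K. \<forall>i\<in>I. (LINT \<omega>:{\<omega>\<in>space N. \<bar>X i \<omega>\<bar> > K}|N. \<bar>X i \<omega>\<bar>) \<le> \<epsilon>)"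

text \<open>Paths are assumed cadlag: this is the usual convention for martingales with jumps, and
  without it the running maximum need not be a random variable.\<close>

definition admissible ::
  "real \<Rightarrow> real measure \<Rightarrow> 'a measure \<Rightarrow> (real \<Rightarrow> 'a measure) \<Rightarrow> (real \<Rightarrow> 'a \<Rightarrow> real) \<Rightarrow> bool" where
  "admissible T \<mu> N \<F> X \<longleftrightarrow>
     prob_space N \<and>
     martingale_upto T N \<F> X \<and>
     (\<forall>\<omega>\<in>space N. cadlag_on T (\<lambda>t. X t \<omega>)) \<and>
     uniformly_integrable N {0..T} X \<and>
     (AE \<omega> in N. X 0 \<omega> = 0) \<and>
     distr N borel (X T) = \<mu>"

text \<open>With jumps the maximum of a path need not be attained, so the supremum is used. It is
  finite because cadlag paths are bounded on compact intervals.\<close>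

definition running_max :: "real \<Rightarrow> (real \<Rightarrow> 'a \<Rightarrow> real) \<Rightarrow> 'a \<Rightarrow> real" where
  "running_max T X \<omega> = (SUP t\<in>{0..T}. X t \<omega>)"

definition terminal_max_law ::
  "real \<Rightarrow> 'a measure \<Rightarrow> (real \<Rightarrow> 'a \<Rightarrow> real) \<Rightarrow> (real \<times> real) measure" where
  "terminal_max_law T N X = distr N (borel \<Otimes>\<^sub>M borel) (\<lambda>\<omega>. (X T \<omega>, running_max T X \<omega>))"

definition graph_pushforward :: "real measure \<Rightarrow> (real \<Rightarrow> real) \<Rightarrow> (real \<times> real) measure" where
  "graph_pushforward \<mu> g = distr \<mu> (borel \<Otimes>\<^sub>M borel) (\<lambda>w. (w, g w))"

text \<open>The expectation exists, with value \<open>v\<close> in \<open>[-\<infinity>, \<infinity>]\<close>, unless both the positive and the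
  negative part have infinite integral.\<close>

definition has_expectation :: "'a measure \<Rightarrow> ('a \<Rightarrow> real) \<Rightarrow> ereal \<Rightarrow> bool" where
  "has_expectation N f v \<longleftrightarrow>
     f \<in> borel_measurable N \<and>
     ((\<integral>\<^sup>+ \<omega>. ennreal (f \<omega>) \<partial>N) < \<infinity> \<or> (\<integral>\<^sup>+ \<omega>. ennreal (- f \<omega>) \<partial>N) < \<infinity>) \<and>
     v = enn2ereal (\<integral>\<^sup>+ \<omega>. ennreal (f \<omega>) \<partial>N) - enn2ereal (\<integral>\<^sup>+ \<omega>. ennreal (- f \<omega>) \<partial>N)"

definition functional_value ::
  "(real \<Rightarrow> real \<Rightarrow> real) \<Rightarrow> real \<Rightarrow> 'a measure \<Rightarrow> (real \<Rightarrow> 'a \<Rightarrow> real) \<Rightarrow> ereal \<Rightarrow> bool" where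
  "functional_value F T N X v \<longleftrightarrow> has_expectation N (\<lambda>\<omega>. F (X T \<omega>) (running_max T X \<omega>)) v"

end

theory Submission
  imports Defs
begin

text \<open>
  Optimality. By strict supermodularity the ridge is nondecreasing, so capping the maximum at the
  ridge turns \<open>F\<close> into a payoff that is nondecreasing in the level, with increments nondecreasing in
  the terminal value. For such a payoff the increments along the curve \<open>s = \<beta>(w)\<close> define a function \<open>C\<close> of
  the level alone, and replacing the level \<open>\<beta>(w)\<close> by \<open>s\<close> gains at most \<open>C(s) - C(\<beta>(w))\<close>. Doob's
  inequality shows that the running maximum is stochastically dominated by \<open>\<beta>(M\<^sub>T)\<close>, so the gain is not
  positive in mean. Positive and negative parts are compared separately, because neither payoff needs
  to be integrable.

  Existence. In quantile coordinates, let \<open>b\<close> be the barycenter function and \<open>G \<le> b\<close> the right-continuous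
  version of \<open>g\<close>. Where \<open>G = b\<close>, the Azema-Yor process (wait at \<open>b\<close> until the terminal value is met) has
  the right maximum. Where \<open>G < b\<close>, waiting at \<open>b\<close> would overshoot. There the line is cut into countably
  many cells \<open>[x, y)\<close> on which \<open>G \<le> b(x)\<close>, and each cell independently receives at most one decoy. The
  observer is told the next point, which is either the terminal quantile or a decoy, and the decoy
  intensity is such that the conditional mean of the terminal value is \<open>G\<close> at that point. This mean is
  the position of the martingale; since \<open>G\<close> is nondecreasing, its maximum is \<open>G\<close> at the terminal quantile.
\<close>

subsection \<open>Cells and decoys\<close>

text \<open>For the capped payoff the levels \<open>g w\<close> and \<open>\<beta> w\<close> are
  worth the same, and what the original payoff gains in passing from \<open>g w\<close> to a level
  above 0 and \<open>w\<close> is at most what the capped one gains in passing there from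
  \<open>\<beta> w\<close>. So it is the Azema-Yor level that is proved optimal, although the
  constructed maximum may stay far below it.

  The decoys come from a balance. Seeing \<open>u\<close> in a cell from \<open>x\<close> to
  \<open>y\<close> means \<open>v = u\<close>, with density 1, or \<open>v \<ge> y\<close>, with
  probability \<open>1 - y\<close> times the density \<open>d\<close> of the decoy at
  \<open>u\<close>. Mean \<open>G u\<close> amounts to
  \<open>d (1 - y) (b y - G u) = G u - q u\<close>. If \<open>G\<close> were constantly
  \<open>b x < b y\<close> on the cell, \<open>d\<close> would have mass exactly 1, as
  \<open>q - b x\<close> integrates to 0 over the tail above \<open>x\<close>; a smaller
  \<open>G\<close> needs fewer decoys. Hence the bound \<open>G \<le> b x\<close>.

  Two obstacles: \<open>G\<close> may be unbounded, so the position is known to be integrable only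
  after the martingale identity has been proved below a cutoff; and the statement prescribes the
  plane as sample space, while the decoys live on a countable product.\<close>

locale cell_decomposition =
  fixes L :: "real set" and y :: "real \<Rightarrow> real"
  assumes countable_L: "countable L"
    and L_nonneg: "x \<in> L \<Longrightarrow> 0 \<le> x"
    and cell_nonempty: "x \<in> L \<Longrightarrow> x < y x"
    and cell_below_1: "x \<in> L \<Longrightarrow> y x < 1"
    and cells_disjoint: "x \<in> L \<Longrightarrow> x' \<in> L \<Longrightarrow> x < x' \<Longrightarrow> y x \<le> x'"
begin

definition free :: "real set" where
  "free = {v. 0 \<le> v \<and> v < 1 \<and> (\<forall>x\<in>L. \<not> (x \<le> v \<and> v < y x))}"

text \<open>At such a time every cell has either ended or not yet begun. The recovery of earlier
  information and the computation of conditional means both rest on this dichotomy.\<close>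

definition grid :: "real \<Rightarrow> bool" where
  "grid t \<longleftrightarrow> 0 \<le> t \<and> (\<forall>x\<in>L. \<not> (x < t \<and> t < y x))"

text \<open>The clock of the process: throughout a cell the observer stays with the information
  available at its left end.\<close>

definition cell_start :: "real \<Rightarrow> real" where
  "cell_start t = (if \<exists>x\<in>L. x \<le> t \<and> t < y x then THE x. x \<in> L \<and> x \<le> t \<and> t < y x else t)"

text \<open>Below, \<open>v\<close> is the quantile of the terminal value and \<open>p x\<close> a decoy, present in the cell
  \<open>[x, y x)\<close> iff it lies in that cell. The decoy is shown only if \<open>v\<close> has not been met by the end of its
  cell, and \<open>nxt t v p\<close> is the next point that is shown after time \<open>t\<close>: the observer cannot tell whether
  it is \<open>v\<close> or a decoy.\<close>

definition cand :: "real \<Rightarrow> real \<Rightarrow> (real \<Rightarrow> real) \<Rightarrow> real set" where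
  "cand t v p = insert v ({p x | x. x \<in> L \<and> t \<le> x \<and> y x \<le> v \<and> x \<le> p x \<and> p x < y x}
      \<union> (free \<inter> {t<..v}))"

definition nxt :: "real \<Rightarrow> real \<Rightarrow> (real \<Rightarrow> real) \<Rightarrow> real" where
  "nxt t v p = Inf (cand t v p)"

text \<open>The default \<open>y x\<close> lies outside \<open>[x, y x)\<close>, so it encodes an
  absent decoy: cells that have not ended by time \<open>t\<close> look empty.\<close>

definition past :: "real \<Rightarrow> (real \<Rightarrow> real) \<Rightarrow> real \<Rightarrow> real" where
  "past t p = (\<lambda>x\<in>L. if y x \<le> t then p x else y x)"

lemma cand_ge: "c \<in> cand t v p \<Longrightarrow> min t v \<le> c"
  unfolding cand_def by auto

lemma bdd_below_cand: "bdd_below (cand t v p)"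
  using cand_ge by (rule bdd_belowI)

lemma cand_nonempty: "cand t v p \<noteq> {}"
  by (simp add: cand_def)

text \<open>The infimum need not be attained, since free points can accumulate from the right; a
  strict upper bound is the form in which it can be resolved into single candidates.\<close>

lemma nxt_less_iff:
  "nxt t v p < z \<longleftrightarrow> v < z \<or> (\<exists>x\<in>L. t \<le> x \<and> y x \<le> v \<and> x \<le> p x \<and> p x < y x \<and> p x < z)
     \<or> (\<exists>a\<in>free. t < a \<and> a \<le> v \<and> a < z)"
proof -
  have "nxt t v p < z \<longleftrightarrow> (\<exists>c\<in>cand t v p. c < z)"
    unfolding nxt_def by (rule cInf_less_iff) (simp_all add: bdd_below_cand cand_nonempty)
  then show ?thesis unfolding cand_def bex_Un bex_simps by (auto simp: Bex_def)
qed

lemma nxt_le: "nxt t v p \<le> v"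
  unfolding nxt_def by (rule cInf_lower[OF _ bdd_below_cand]) (simp add: cand_def)

lemma nxt_le_cand: "c \<in> cand t v p \<Longrightarrow> nxt t v p \<le> c"
  unfolding nxt_def by (rule cInf_lower[OF _ bdd_below_cand])

lemma nxt_ge: "t \<le> v \<Longrightarrow> t \<le> nxt t v p"
  unfolding nxt_def by (rule cInf_greatest) (auto simp: cand_def)

lemma cell_unique: "x \<in> L \<Longrightarrow> x' \<in> L \<Longrightarrow> x \<le> v \<Longrightarrow> v < y x \<Longrightarrow> x' \<le> v \<Longrightarrow> v < y x' \<Longrightarrow> x = x'"
  using cells_disjoint[of x x'] cells_disjoint[of x' x] by (cases x x' rule: linorder_cases) auto

lemma cell_start_cell: "x \<in> L \<Longrightarrow> x \<le> t \<Longrightarrow> t < y x \<Longrightarrow> cell_start t = x"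
  unfolding cell_start_def using cell_unique by (auto intro!: the_equality)

lemma cell_start_free: "(\<And>x. x \<in> L \<Longrightarrow> x \<le> t \<Longrightarrow> t < y x \<Longrightarrow> False) \<Longrightarrow> cell_start t = t"
  unfolding cell_start_def by auto

lemma cell_start_le: "cell_start t \<le> t"
  using cell_start_cell cell_start_free[of t] by (cases "\<exists>x\<in>L. x \<le> t \<and> t < y x") force+

lemma cell_start_mono: "s \<le> t \<Longrightarrow> cell_start s \<le> cell_start t"
proof (cases "\<exists>x\<in>L. x \<le> t \<and> t < y x")
  case True
  assume "s \<le> t"
  from True obtain x where x: "x \<in> L" "x \<le> t" "t < y x" by auto
  show ?thesis
  proof (cases "x \<le> s")
    case True then show ?thesis using x \<open>s \<le> t\<close> cell_start_cell[of x s] cell_start_cell[of x t] by auto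
  next
    case False then show ?thesis using x cell_start_cell[of x t] cell_start_le[of s] by auto
  qed
next
  case False
  assume "s \<le> t"
  then show ?thesis using False cell_start_free[of t] cell_start_le[of s] by force
qed

lemma grid_cell_start: "0 \<le> t \<Longrightarrow> grid (cell_start t)"
proof (cases "\<exists>x\<in>L. x \<le> t \<and> t < y x")
  case True
  then obtain x where x: "x \<in> L" "x \<le> t" "t < y x" by auto
  then have "cell_start t = x" by (rule cell_start_cell)
  moreover have "\<not> (x' < x \<and> x < y x')" if "x' \<in> L" for x' using cells_disjoint[OF that x(1)] by linarith
  ultimately show ?thesis unfolding grid_def using L_nonneg[OF x(1)] by auto
next
  case False
  assume "0 \<le> t"
  from False have "cell_start t = t" by (intro cell_start_free) auto
  with False \<open>0 \<le> t\<close> show ?thesis unfolding grid_def by auto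
qed

lemma past_past: "s \<le> t \<Longrightarrow> past s (past t p) = past s p"
  unfolding past_def by (auto simp: fun_eq_iff restrict_def)

text \<open>Later information determines earlier information. Candidates up to time \<open>t\<close>
  are untouched by the replacement, and all candidates after \<open>t\<close> are at least
  \<open>nxt t v p\<close>, which is at the same time the new terminal quantile and hence a
  candidate itself.\<close>

lemma nxt_past:
  assumes "grid t" "s < t" "t < v"
  shows "nxt s (nxt t v p) (past t p) = nxt s v p"
proof -
  define v' where "v' = nxt t v p"
  have v': "t \<le> v'" "v' \<le> v" using assms nxt_ge[of t v p] nxt_le[of t v p] by (auto simp: v'_def)
  have *: "nxt s v' (past t p) < z \<longleftrightarrow> nxt s v p < z" for z
  proof
    assume "nxt s v' (past t p) < z"
    then consider "v' < z" | x where "x \<in> L" "s \<le> x" "y x \<le> v'" "x \<le> past t p x" "past t p x < y x" "past t p x < z"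
      | a where "a \<in> free" "s < a" "a \<le> v'" "a < z" unfolding nxt_less_iff by auto
    then show "nxt s v p < z"
    proof cases
      case 1 then show ?thesis unfolding v'_def nxt_less_iff using assms by fastforce
    next
      case 2
      then have "y x \<le> t" "past t p x = p x" unfolding past_def by (auto split: if_splits)
      with 2 v' show ?thesis unfolding nxt_less_iff by force
    next
      case 3 with v' show ?thesis unfolding nxt_less_iff by force
    qed
  next
    assume "nxt s v p < z"
    then consider "v < z" | x where "x \<in> L" "s \<le> x" "y x \<le> v" "x \<le> p x" "p x < y x" "p x < z"
      | a where "a \<in> free" "s < a" "a \<le> v" "a < z" unfolding nxt_less_iff by auto
    then show "nxt s v' (past t p) < z"
    proof cases
      case 1 then show ?thesis using v' nxt_le[of s v' "past t p"] by linarith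
    next
      case 2
      show ?thesis
      proof (cases "y x \<le> t")
        case True
        then have "past t p x = p x" using 2 by (simp add: past_def)
        with 2 True v' show ?thesis unfolding nxt_less_iff by force
      next
        case False
        then have "t \<le> x" using 2 \<open>grid t\<close> unfolding grid_def by force
        then have "p x \<in> cand t v p" using 2 by (auto simp: cand_def)
        then have "v' \<le> p x" unfolding v'_def by (rule nxt_le_cand)
        then show ?thesis using 2 nxt_le[of s v' "past t p"] by linarith
      qed
    next
      case 3
      show ?thesis
      proof (cases "a \<le> t")
        case True with 3 v' show ?thesis unfolding nxt_less_iff by force
      next
        case False
        then have "a \<in> cand t v p" using 3 by (auto simp: cand_def)
        then have "v' \<le> a" unfolding v'_def by (rule nxt_le_cand)
        then show ?thesis using 3 nxt_le[of s v' "past t p"] by linarith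
      qed
    qed
  qed
  then show ?thesis unfolding v'_def using *[unfolded v'_def] by (meson less_irrefl linorder_neqE)
qed

lemma nxt_mono: "s \<le> t \<Longrightarrow> nxt s v p \<le> nxt t v p"
  unfolding nxt_def by (rule cInf_superset_mono[OF cand_nonempty bdd_below_cand]) (auto simp: cand_def)

text \<open>What remains of \<open>cand\<close> when the terminal quantile is forgotten. For given
  decoys its infimum locates a free next point independently of \<open>v\<close>.\<close>

definition pool :: "real \<Rightarrow> (real \<Rightarrow> real) \<Rightarrow> real set" where
  "pool s p = {p x | x. x \<in> L \<and> s \<le> x \<and> x \<le> p x \<and> p x < y x} \<union> (free \<inter> {s<..<1})"

lemma cand_subset_pool: "v < 1 \<Longrightarrow> cand s v p \<subseteq> insert v (pool s p)"
  unfolding cand_def pool_def by auto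

lemma bdd_below_pool: "bdd_below (pool s p)"
  by (rule bdd_belowI[of _ s]) (auto simp: pool_def)

text \<open>A pool element below the next point that is not a candidate can only be the decoy of the
  cell containing \<open>v\<close>; the next point would then lie in that cell and could not be
  free.\<close>

lemma nxt_free_imp:
  assumes "s < v" "v < 1" "nxt s v p \<in> free" "nxt s v p \<noteq> v"
  shows "pool s p \<noteq> {} \<and> Inf (pool s p) = nxt s v p"
proof -
  define d where "d = nxt s v p"
  have dv: "d < v" using assms(4) nxt_le[of s v p] by (simp add: d_def)
  have lower: "d \<le> c" if c: "c \<in> pool s p" for c
  proof (rule ccontr)
    assume "\<not> d \<le> c"
    then have cd: "c < d" by simp
    have "c \<notin> cand s v p" using cd nxt_le_cand[of c s v p] by (auto simp: d_def)
    with c cd dv obtain x where x: "x \<in> L" "c = p x" "s \<le> x" "x \<le> p x" "p x < y x" "v < y x"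
      unfolding pool_def cand_def by force
    then have "x \<le> d" "d < y x" using cd dv by auto
    with x assms(3) show False unfolding d_def free_def by auto
  qed
  have approx: "\<exists>c\<in>pool s p. c < z" if "d < z" for z
  proof -
    have "d < min z v" using that dv by simp
    then obtain c where "c \<in> cand s v p" "c < min z v" unfolding d_def nxt_def
      using cInf_less_iff[OF cand_nonempty bdd_below_cand] by blast
    then show ?thesis using cand_subset_pool[OF assms(2), of s p] by force
  qed
  have ne: "pool s p \<noteq> {}" using approx[of "d+1"] by auto
  have "Inf (pool s p) = d"
  proof (rule antisym)
    show "Inf (pool s p) \<le> d"
    proof (rule ccontr)
      assume "\<not> Inf (pool s p) \<le> d"
      then obtain c where "c \<in> pool s p" "c < Inf (pool s p)" using approx[of "Inf (pool s p)"] by auto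
      then show False using cInf_lower[OF _ bdd_below_pool] by fastforce
    qed
  qed (rule cInf_greatest[OF ne lower])
  with ne show ?thesis by (simp add: d_def)
qed

text \<open>A pool element close to the infimum may fail to be a candidate, but only as the decoy of
  the cell containing \<open>v\<close>. A free infimum lies before that cell, so there is a smaller
  pool element before the cell, and this one is a candidate.\<close>

lemma nxt_pool:
  assumes "s < v" "v < 1" "pool s p \<noteq> {}" "Inf (pool s p) \<in> free" "Inf (pool s p) < v"
  shows "nxt s v p = Inf (pool s p)"
proof -
  define d where "d = Inf (pool s p)"
  have low: "d \<le> c" if "c \<in> pool s p" for c
    unfolding d_def by (rule cInf_lower[OF that bdd_below_pool])
  have 1: "d \<le> nxt s v p" unfolding nxt_def
    using cand_subset_pool[OF assms(2), of s p] low assms(5)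
    by (intro cInf_greatest[OF cand_nonempty]) (force simp: d_def)
  have "nxt s v p < z" if "d < z" for z
  proof -
    have "d < min z v" using that assms(5) by (simp add: d_def)
    then obtain c where c: "c \<in> pool s p" "c < min z v"
      using cInf_less_iff[OF assms(3) bdd_below_pool] unfolding d_def by blast
    have "\<exists>c'\<in>cand s v p. c' \<le> c"
    proof (cases "c \<in> cand s v p")
      case False
      with c obtain x where x: "x \<in> L" "c = p x" "s \<le> x" "x \<le> p x" "p x < y x" "v < y x"
        unfolding pool_def cand_def by force
      have "d < x"
      proof (rule ccontr)
        assume "\<not> d < x"
        then have "x \<le> d" "d < y x" using x low[OF c(1)] by auto
        with x assms(4) show False unfolding d_def free_def by auto
      qed
      then obtain c' where c': "c' \<in> pool s p" "c' < x"
        using cInf_less_iff[OF assms(3) bdd_below_pool] by (auto simp: d_def)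
      have "c' \<in> cand s v p"
      proof (cases "c' \<in> free \<inter> {s<..<1}")
        case True then show ?thesis using c' c x by (auto simp: cand_def)
      next
        case False
        with c' obtain x' where x': "x' \<in> L" "c' = p x'" "s \<le> x'" "x' \<le> p x'" "p x' < y x'"
          unfolding pool_def by auto
        then have "y x' \<le> x" using c' x cells_disjoint[of x' x] by auto
        then have "y x' \<le> v" using x c by auto
        with x' show ?thesis by (auto simp: cand_def)
      qed
      then show ?thesis using c' x by (intro bexI[of _ c']) auto
    qed auto
    then show ?thesis using c nxt_le_cand by fastforce
  qed
  then have "nxt s v p \<le> d" by (meson less_irrefl not_le)
  with 1 show ?thesis by (simp add: d_def)
qed

text \<open>A pool element before \<open>x\<close> is a free point or the decoy of a cell that ends
  by \<open>x\<close>, hence by \<open>v\<close>. It would be a candidate and would be shown before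
  the cell is reached.\<close>

lemma nxt_in_cell_imp:
  assumes "grid s" "x \<in> L" "s < v" "v < 1" "x \<le> nxt s v p" "nxt s v p < y x"
  shows "s \<le> x \<and> (\<forall>c\<in>pool s p. x \<le> c) \<and> x \<le> v"
proof -
  have xv: "x \<le> v" using assms nxt_le[of s v p] by linarith
  have "s \<le> nxt s v p" using assms nxt_ge[of s v p] by auto
  then have sx: "s \<le> x" using assms unfolding grid_def by force
  have "x \<le> c" if c: "c \<in> pool s p" for c
  proof (rule ccontr)
    assume "\<not> x \<le> c"
    then have cx: "c < x" by simp
    have "c \<in> cand s v p"
    proof (cases "c \<in> free \<inter> {s<..<1}")
      case True then show ?thesis using c cx xv by (auto simp: cand_def)
    next
      case False
      with c obtain x' where x': "x' \<in> L" "c = p x'" "s \<le> x'" "x' \<le> p x'" "p x' < y x'"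
        unfolding pool_def by auto
      then have "y x' \<le> x" using cx assms cells_disjoint[of x' x] by auto
      then have "y x' \<le> v" using xv by auto
      with x' show ?thesis by (auto simp: cand_def)
    qed
    then show False using cx assms nxt_le_cand by fastforce
  qed
  with sx xv show ?thesis by auto
qed

lemma cand_cell:
  assumes "grid s" "x \<in> L" "s \<le> x" "\<And>c. c \<in> pool s p \<Longrightarrow> x \<le> c" "c \<in> cand s v p" "c < y x"
  shows "c = v \<or> (c = p x \<and> y x \<le> v \<and> x \<le> p x)"
proof (rule ccontr)
  assume neg: "\<not> ?thesis"
  consider "c \<in> free" "s < c" "c \<le> v" | x' where "x' \<in> L" "c = p x'" "s \<le> x'" "y x' \<le> v" "x' \<le> p x'" "p x' < y x'"
    using neg assms(5) unfolding cand_def by auto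
  then show False
  proof cases
    case 1
    then have "c \<in> pool s p" using assms cell_below_1[of x] by (auto simp: pool_def)
    then have "x \<le> c" by (rule assms(4))
    with 1 assms show False by (auto simp: free_def)
  next
    case 2
    then have "c \<in> pool s p" by (auto simp: pool_def)
    then have "x \<le> c" by (rule assms(4))
    then have "x' = x" using 2 assms by (intro cell_unique[of x' x c]) auto
    with 2 neg show False by auto
  qed
qed

lemma nxt_in_same_cell:
  assumes "grid s" "x \<in> L" "s \<le> x" "\<And>c. c \<in> pool s p \<Longrightarrow> x \<le> c" "x \<le> v" "v < y x"
  shows "nxt s v p = v"
proof -
  have "v \<le> c" if "c \<in> cand s v p" for c
    using cand_cell[OF assms(1-4) that] assms(5,6) by (cases "c < y x") auto
  then have "v \<le> nxt s v p" unfolding nxt_def by (intro cInf_greatest) (auto simp: cand_def)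
  then show ?thesis using nxt_le[of s v p] by simp
qed

lemma nxt_above_cell:
  assumes "grid s" "x \<in> L" "s \<le> x" "\<And>c. c \<in> pool s p \<Longrightarrow> x \<le> c" "y x \<le> v"
  shows "if x \<le> p x \<and> p x < y x then nxt s v p = p x else y x \<le> nxt s v p"
proof (cases "x \<le> p x \<and> p x < y x")
  case True
  have "p x \<le> c" if "c \<in> cand s v p" for c
    using cand_cell[OF assms(1-4) that] assms(5) True by (cases "c < y x") auto
  then have "p x \<le> nxt s v p" unfolding nxt_def by (intro cInf_greatest) (auto simp: cand_def)
  moreover have "p x \<in> cand s v p" using True assms by (auto simp: cand_def)
  ultimately show ?thesis using True nxt_le_cand by fastforce
next
  case False
  have "y x \<le> c" if "c \<in> cand s v p" for c
    using cand_cell[OF assms(1-4) that] assms(5) False by (cases "c < y x") auto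
  then have "y x \<le> nxt s v p" unfolding nxt_def by (intro cInf_greatest) (auto simp: cand_def)
  then show ?thesis using False by auto
qed

lemma pool_above_iff: "(\<forall>c\<in>pool s p. x \<le> c) \<longleftrightarrow>
    (\<forall>x'\<in>L. s \<le> x' \<longrightarrow> x' \<le> p x' \<longrightarrow> p x' < y x' \<longrightarrow> x \<le> p x') \<and> (\<forall>c\<in>free. s < c \<longrightarrow> c < 1 \<longrightarrow> x \<le> c)"
proof -
  have "(\<forall>c\<in>{p x' | x'. x' \<in> L \<and> s \<le> x' \<and> x' \<le> p x' \<and> p x' < y x'}. x \<le> c) \<longleftrightarrow>
    (\<forall>x'\<in>L. s \<le> x' \<longrightarrow> x' \<le> p x' \<longrightarrow> p x' < y x' \<longrightarrow> x \<le> p x')"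
    by fastforce
  then show ?thesis unfolding pool_def ball_Un by force
qed

text \<open>A decoy of the cell at \<open>x\<close> is absent or at least \<open>x\<close>. Whether
  the cell is reached with nothing shown before is therefore independent of its own decoy, which can
  then be integrated out separately.\<close>

lemma pool_upd: "(\<forall>c\<in>pool s (p(x := u)). x \<le> c) \<longleftrightarrow> (\<forall>c\<in>pool s p. x \<le> c)"
proof -
  have "(s \<le> x' \<longrightarrow> x' \<le> (p(x := u)) x' \<longrightarrow> (p(x := u)) x' < y x' \<longrightarrow> x \<le> (p(x := u)) x') \<longleftrightarrow>
     (s \<le> x' \<longrightarrow> x' \<le> p x' \<longrightarrow> p x' < y x' \<longrightarrow> x \<le> p x')" for x'
    by (cases "x' = x") simp_all
  then show ?thesis unfolding pool_above_iff by simp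
qed

lemma past_upd: "grid s \<Longrightarrow> x \<in> L \<Longrightarrow> s \<le> x \<Longrightarrow> past s (p(x := u)) = past s p"
  unfolding past_def using cell_nonempty[of x] by (auto simp: fun_eq_iff restrict_def)

end

subsection \<open>The decoy measure\<close>

definition unif :: "real measure" where
  "unif = density lborel (indicator {0<..<1})"

lemma sets_unif [simp, measurable_cong]: "sets unif = sets borel"
  by (simp add: unif_def)

lemma space_unif [simp]: "space unif = UNIV"
  by (simp add: unif_def)

lemma prob_space_unif: "prob_space unif"
  by (rule prob_spaceI) (simp add: unif_def emeasure_density)

interpretation unif: prob_space unif by (rule prob_space_unif)

lemma AE_unif: "AE u in unif. 0 < u \<and> u < 1"
  unfolding unif_def by (subst AE_density) (auto simp: indicator_def)

lemma emeasure_unif_singleton: "emeasure unif {c} = 0"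
proof -
  have "emeasure unif {c} = (\<integral>\<^sup>+u\<in>{c}. indicator {0<..<1} u \<partial>lborel)"
    unfolding unif_def by (rule emeasure_density) auto
  also have "\<dots> = 0" by (rule nn_integral_null_set) auto
  finally show ?thesis .
qed

lemma AE_unif_neq: "AE u in unif. u \<noteq> c"
  by (rule AE_I[where N="{c}"]) (auto simp: emeasure_unif_singleton)

lemma emeasure_unif_interval: "0 \<le> v \<Longrightarrow> v \<le> w \<Longrightarrow> w \<le> 1 \<Longrightarrow> emeasure unif {v<..<w} = ennreal (w - v)"
proof -
  assume "0 \<le> v" "v \<le> w" "w \<le> 1"
  have "emeasure unif {v<..<w} = (\<integral>\<^sup>+u\<in>{v<..<w}. indicator {0<..<1} u \<partial>lborel)"
    unfolding unif_def by (rule emeasure_density) auto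
  also have "\<dots> = (\<integral>\<^sup>+u. indicator {v<..<w} u \<partial>lborel)"
    using \<open>0 \<le> v\<close> \<open>w \<le> 1\<close> by (intro nn_integral_cong) (auto simp: indicator_def)
  also have "\<dots> = ennreal (w - v)" using \<open>v \<le> w\<close> by simp
  finally show ?thesis .
qed

lemma measure_unif_tail: "0 \<le> v \<Longrightarrow> v \<le> 1 \<Longrightarrow> measure unif {v<..} = 1 - v"
proof -
  assume v: "0 \<le> v" "v \<le> 1"
  have "emeasure unif {v<..} = emeasure unif {v<..<1}"
    by (rule emeasure_eq_AE) (use AE_unif in \<open>auto elim: eventually_mono\<close>)
  then show ?thesis using emeasure_unif_interval[OF v] v by (simp add: measure_def)
qed

lemma integrable_indicator_unif: "A \<in> sets borel \<Longrightarrow> integrable unif (\<lambda>u. indicator A u * (c::real))"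
  by (intro integrable_mult_left integrable_real_indicator) (auto simp: unif.emeasure_eq_measure)

text \<open>\<open>q\<close> is a quantile function and the quotient below its barycenter function. The upper bound on
  \<open>G\<close> over a cell is what makes the decoys of that cell a subprobability.\<close>

locale tail_bounded = cell_decomposition +
  fixes q G :: "real \<Rightarrow> real"
  assumes q_measurable [measurable]: "q \<in> borel_measurable borel"
    and q_integrable: "integrable unif q"
    and q_mean: "(\<integral>u. q u \<partial>unif) = 0"
    and G_measurable [measurable]: "G \<in> borel_measurable borel"
    and G_mono: "0 \<le> u \<Longrightarrow> u \<le> v \<Longrightarrow> v < 1 \<Longrightarrow> G u \<le> G v"
    and G_right: "0 \<le> v \<Longrightarrow> v < 1 \<Longrightarrow> (G \<longlongrightarrow> G v) (at_right v)"
    and q_le_G: "0 < v \<Longrightarrow> v < 1 \<Longrightarrow> q v \<le> G v"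
    and G_nonneg: "0 \<le> v \<Longrightarrow> v < 1 \<Longrightarrow> 0 \<le> G v"
    and G_cell: "x \<in> L \<Longrightarrow> x \<le> v \<Longrightarrow> v < y x \<Longrightarrow>
        G v \<le> (\<integral>u. indicator {x<..} u * q u \<partial>unif) / (1 - x)"
    and G_free: "v \<in> free \<Longrightarrow> G v = (\<integral>u. indicator {v<..} u * q u \<partial>unif) / (1 - v)"
begin

definition b :: "real \<Rightarrow> real" where
  "b v = (\<integral>u. indicator {v<..} u * q u \<partial>unif) / (1 - v)"

lemma integrable_ind_q: "A \<in> sets borel \<Longrightarrow> integrable unif (\<lambda>u. indicator A u * q u)"
  using integrable_mult_indicator[of A unif q] q_integrable by simp

lemma integral_tail: "v < 1 \<Longrightarrow> (\<integral>u. indicator {v<..} u * q u \<partial>unif) = (1 - v) * b v"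
  by (simp add: b_def)

lemma integral_tail_diff:
  assumes "0 \<le> v" "v < 1"
  shows "(\<integral>u. indicator {v<..} u * (q u - c) \<partial>unif) = (1 - v) * (b v - c)"
proof -
  have "(\<integral>u. indicator {v<..} u * (q u - c) \<partial>unif) = (\<integral>u. indicator {v<..} u * q u - indicator {v<..} u * c \<partial>unif)"
    by (simp add: algebra_simps)
  also have "\<dots> = (1 - v) * b v - (1 - v) * c"
    using assms integrable_ind_q[of "{v<..}"] integrable_indicator_unif[of "{v<..}" c] by (subst Bochner_Integration.integral_diff) (auto simp: integral_tail measure_unif_tail)
  finally show ?thesis by (simp add: algebra_simps)
qed

lemma cell_bounds: "x \<in> L \<Longrightarrow> 0 \<le> x \<and> x < y x \<and> y x < 1 \<and> x < 1"
  using L_nonneg[of x] cell_nonempty[of x] cell_below_1[of x] by auto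

text \<open>The function \<open>q - b x\<close> has integral 0 over the tail above \<open>x\<close>,
  so its integral over the cell is minus that over the tail above \<open>y x\<close>. The resulting
  number is the normalisation of the decoys.\<close>

lemma integral_cell:
  assumes "x \<in> L"
  shows "(\<integral>u. indicator {x..<y x} u * (b x - q u) \<partial>unif) = (1 - y x) * (b (y x) - b x)"
proof -
  note x = cell_bounds[OF assms]
  have 1: "(\<integral>u. indicator {x<..} u * (q u - b x) \<partial>unif) = 0"
    using x by (subst integral_tail_diff) auto
  have 2: "(\<integral>u. indicator {y x<..} u * (q u - b x) \<partial>unif) = (1 - y x) * (b (y x) - b x)"
    using x by (subst integral_tail_diff) auto
  have i: "integrable unif (\<lambda>u. indicator A u * (q u - b x))" if "A \<in> sets borel" for A
    using integrable_mult_indicator[of A unif "\<lambda>u. q u - b x"] q_integrable that by simp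
  have "(\<integral>u. indicator {x..<y x} u * (b x - q u) \<partial>unif)
      = (\<integral>u. indicator {y x<..} u * (q u - b x) - indicator {x<..} u * (q u - b x) \<partial>unif)"
    using AE_unif_neq[of x] AE_unif_neq[of "y x"] x
    by (intro integral_cong_AE) (auto simp: indicator_def elim!: eventually_elim2)
  also have "\<dots> = (1 - y x) * (b (y x) - b x)"
    using 1 2 i by (subst Bochner_Integration.integral_diff) auto
  finally show ?thesis .
qed

lemma G_le_b_cell: "x \<in> L \<Longrightarrow> x \<le> v \<Longrightarrow> v < y x \<Longrightarrow> G v \<le> b x"
  using G_cell by (simp add: b_def)

lemma G_eq_b: "v \<in> free \<Longrightarrow> G v = b v"
  using G_free by (simp add: b_def)

lemma AE_cell_nonneg: "x \<in> L \<Longrightarrow> AE u in unif. 0 \<le> indicator {x..<y x} u * (b x - q u)"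
  using AE_unif
proof (rule eventually_mono)
  fix u :: real assume "x \<in> L" "0 < u \<and> u < 1"
  then show "0 \<le> indicator {x..<y x} u * (b x - q u)"
    using G_le_b_cell[of x u] q_le_G[of u] by (auto simp: indicator_def)
qed

lemma b_cell_mono: "x \<in> L \<Longrightarrow> b x \<le> b (y x)"
proof -
  assume x: "x \<in> L"
  have "0 \<le> (\<integral>u. indicator {x..<y x} u * (b x - q u) \<partial>unif)"
    by (rule integral_nonneg_AE[OF AE_cell_nonneg[OF x]])
  then show ?thesis unfolding integral_cell[OF x] using cell_bounds[OF x] by (simp add: zero_le_mult_iff)
qed

text \<open>Chosen such that, on \<open>[x, y x)\<close>, seeing the point \<open>u\<close> means \<open>v = u\<close> or \<open>v \<ge> y x\<close> with conditional
  mean \<open>G u\<close>. If \<open>b (y x) = b x\<close> the denominator can vanish; then \<open>G = q\<close> almost everywhere on the cell and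
  the quotient is \<open>0\<close>, as it should.\<close>

definition decoy :: "real \<Rightarrow> real \<Rightarrow> real" where
  "decoy x u = indicator {x..<y x} u * ((G u - q u) / ((b (y x) - G u) * (1 - y x)))"

lemma decoy_measurable [measurable]: "decoy x \<in> borel_measurable borel"
  unfolding decoy_def by measurable

text \<open>The middle part is the balance equation. For the last part, the quotient in
  \<open>decoy\<close> increases with \<open>G u\<close>, so \<open>G u\<close> may be replaced by
  its upper bound \<open>b x\<close>; the integral of that bound is known from
  \<open>integral_cell\<close>.\<close>

lemma AE_decoy:
  assumes x: "x \<in> L"
  shows "AE u in unif. 0 \<le> decoy x u \<and> decoy x u * ((1 - y x) * (b (y x) - G u)) = indicator {x..<y x} u * (G u - q u)
     \<and> decoy x u \<le> (indicator {x..<y x} u * (b x - q u)) / ((b (y x) - b x) * (1 - y x))"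
proof -
  note xb = cell_bounds[OF x]
  show ?thesis
  proof (cases "b x = b (y x)")
    case False
    then have lt: "b x < b (y x)" using b_cell_mono[OF x] by simp
    show ?thesis using AE_unif
    proof (rule eventually_mono)
      fix u :: real assume u: "0 < u \<and> u < 1"
      show "0 \<le> decoy x u \<and> decoy x u * ((1 - y x) * (b (y x) - G u)) = indicator {x..<y x} u * (G u - q u)
        \<and> decoy x u \<le> (indicator {x..<y x} u * (b x - q u)) / ((b (y x) - b x) * (1 - y x))"
      proof (cases "u \<in> {x..<y x}")
        case True
        have g: "q u \<le> G u" "G u \<le> b x" using u q_le_G[of u] G_le_b_cell[OF x, of u] True by auto
        have "(G u - q u) / ((b (y x) - G u) * (1 - y x)) \<le> (b x - q u) / ((b (y x) - b x) * (1 - y x))"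
          using g lt xb by (intro frac_le mult_right_mono mult_pos_pos) auto
        moreover have "0 \<le> (G u - q u) / ((b (y x) - G u) * (1 - y x))"
          using g lt xb by (intro divide_nonneg_nonneg mult_nonneg_nonneg) auto
        moreover have "(G u - q u) / ((b (y x) - G u) * (1 - y x)) * ((1 - y x) * (b (y x) - G u)) = G u - q u"
          using g lt xb by simp
        ultimately show ?thesis using True by (simp add: decoy_def)
      qed (auto simp: decoy_def)
    qed
  next
    case True
    have "(\<integral>u. indicator {x..<y x} u * (b x - q u) \<partial>unif) = 0"
      using integral_cell[OF x] True by simp
    moreover have "integrable unif (\<lambda>u. indicator {x..<y x} u * (b x - q u))"
      using integrable_mult_indicator[of "{x..<y x}" unif "\<lambda>u. b x - q u"] q_integrable by simp
    ultimately have "AE u in unif. indicator {x..<y x} u * (b x - q u) = 0"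
      using integral_nonneg_eq_0_iff_AE[OF _ AE_cell_nonneg[OF x]] by simp
    with AE_unif show ?thesis
    proof eventually_elim
      case (elim u)
      show ?case
      proof (cases "u \<in> {x..<y x}")
        case in_cell: True
        then have "q u = b x" using elim by simp
        moreover have "q u \<le> G u" "G u \<le> b x" using elim q_le_G[of u] G_le_b_cell[OF x, of u] in_cell by auto
        ultimately have "G u = b x" "q u = b x" by auto
        then show ?thesis using True by (simp add: decoy_def)
      qed (auto simp: decoy_def)
    qed
  qed
qed

lemma decoy_integrable: "x \<in> L \<Longrightarrow> integrable unif (decoy x)"
proof -
  assume x: "x \<in> L"
  have "integrable unif (\<lambda>u. (indicator {x..<y x} u * (b x - q u)) / ((b (y x) - b x) * (1 - y x)))"
    using integrable_mult_indicator[of "{x..<y x}" unif "\<lambda>u. b x - q u"] q_integrable by simp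
  then show ?thesis
  proof (rule Bochner_Integration.integrable_bound)
    show "AE u in unif. norm (decoy x u) \<le> norm ((indicator {x..<y x} u * (b x - q u)) / ((b (y x) - b x) * (1 - y x)))"
      by (rule eventually_mono[OF AE_decoy[OF x]]) (metis abs_ge_self abs_of_nonneg order_trans real_norm_def)
  qed simp
qed

definition decoy_mass :: "real \<Rightarrow> real" where
  "decoy_mass x = (\<integral>u. decoy x u \<partial>unif)"

lemma decoy_mass_bounds: assumes x: "x \<in> L" shows "0 \<le> decoy_mass x" "decoy_mass x \<le> 1"
proof -
  show "0 \<le> decoy_mass x" unfolding decoy_mass_def
    by (rule integral_nonneg_AE) (use AE_decoy[OF x] in \<open>auto elim!: eventually_mono\<close>)
  have i: "integrable unif (\<lambda>u. (indicator {x..<y x} u * (b x - q u)) / ((b (y x) - b x) * (1 - y x)))"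
    using integrable_mult_indicator[of "{x..<y x}" unif "\<lambda>u. b x - q u"] q_integrable by simp
  have "decoy_mass x \<le> (\<integral>u. (indicator {x..<y x} u * (b x - q u)) / ((b (y x) - b x) * (1 - y x)) \<partial>unif)"
    unfolding decoy_mass_def
    by (rule integral_mono_AE[OF decoy_integrable[OF x] i]) (use AE_decoy[OF x] in \<open>auto elim!: eventually_mono\<close>)
  also have "\<dots> = ((1 - y x) * (b (y x) - b x)) / ((b (y x) - b x) * (1 - y x))"
    by (simp add: integral_cell[OF x])
  \<comment> \<open>The quotient equals 1, or 0 by the convention on division when
    \<open>b (y x) = b x\<close>.\<close>
  also have "\<dots> \<le> 1" by (simp add: field_simps divide_le_eq_1)
  finally show "decoy_mass x \<le> 1" .
qed

text \<open>The missing mass is spread uniformly between \<open>y x\<close> and 1, where a value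
  counts as no decoy at all.\<close>

definition decoy_density :: "real \<Rightarrow> real \<Rightarrow> real" where
  "decoy_density x u = decoy x u + indicator {y x<..} u * ((1 - decoy_mass x) / (1 - y x))"

definition decoy_law :: "real \<Rightarrow> real measure" where
  "decoy_law x = density unif (\<lambda>u. ennreal (decoy_density x u))"

lemma decoy_density_measurable [measurable]: "decoy_density x \<in> borel_measurable borel"
  unfolding decoy_density_def by measurable

lemma sets_decoy_law [simp, measurable_cong]: "sets (decoy_law x) = sets borel"
  by (simp add: decoy_law_def)

lemma space_decoy_law [simp]: "space (decoy_law x) = UNIV"
  by (simp add: decoy_law_def)

lemma AE_decoy_density: "x \<in> L \<Longrightarrow> AE u in unif. 0 \<le> decoy_density x u"
  using AE_decoy[of x] decoy_mass_bounds[of x] cell_bounds[of x]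
  by (auto simp: decoy_density_def elim!: eventually_mono intro!: add_nonneg_nonneg)

lemma prob_space_decoy_law: assumes x: "x \<in> L" shows "prob_space (decoy_law x)"
proof (rule prob_spaceI)
  have i: "integrable unif (\<lambda>u. indicator {y x<..} u * ((1 - decoy_mass x) / (1 - y x)))"
    by (rule integrable_indicator_unif) simp
  have "emeasure (decoy_law x) (space (decoy_law x)) = (\<integral>\<^sup>+u. ennreal (decoy_density x u) \<partial>unif)"
    unfolding decoy_law_def by (simp add: emeasure_density)
  also have "\<dots> = ennreal (\<integral>u. decoy_density x u \<partial>unif)"
    using AE_decoy_density[OF x] decoy_integrable[OF x] i
    by (intro nn_integral_eq_integral) (auto simp: decoy_density_def)
  also have "(\<integral>u. decoy_density x u \<partial>unif) = 1"
    unfolding decoy_density_def using decoy_integrable[OF x] i cell_bounds[OF x]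
    by (subst Bochner_Integration.integral_add) (auto simp: decoy_mass_def measure_unif_tail)
  finally show "emeasure (decoy_law x) (space (decoy_law x)) = 1" by simp
qed

abbreviation decoys :: "(real \<Rightarrow> real) measure" where
  "decoys \<equiv> PiM L decoy_law"

lemma prob_space_decoys: "prob_space decoys"
  by (rule prob_space_PiM) (rule prob_space_decoy_law)

definition base :: "(real \<times> (real \<Rightarrow> real)) measure" where
  "base = unif \<Otimes>\<^sub>M decoys"

lemma pair_prob_base: "pair_prob_space unif decoys"
  unfolding pair_prob_space_def pair_sigma_finite_def
  using prob_space_unif prob_space_decoys by (auto intro: prob_space_imp_sigma_finite)

lemma prob_space_base: "prob_space base"
proof -
  interpret pair_prob_space unif decoys by (rule pair_prob_base)
  show ?thesis unfolding base_def by unfold_locales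
qed

lemma sets_base [measurable_cong]: "sets base = sets (borel \<Otimes>\<^sub>M PiM L (\<lambda>_. borel))"
  unfolding base_def by (intro sets_pair_measure_cong sets_PiM_cong) auto

lemma space_base: "space base = UNIV \<times> (\<Pi>\<^sub>E x\<in>L. UNIV)"
  unfolding base_def by (simp add: space_pair_measure space_PiM)

text \<open>Redrawing one coordinate of a product measure independently preserves the law. This
  allows averaging over the decoy of a single cell with all other decoys fixed.\<close>

lemma resample:
  assumes x: "x \<in> L"
  shows "distr (decoy_law x \<Otimes>\<^sub>M decoys) decoys (\<lambda>(u, p). p(x := u)) = decoys"
  using distr_pair_PiM_eq_PiM[of L decoy_law x] prob_space_decoy_law x by (simp add: insert_absorb)

lemma nxt_measurable [measurable]:
  "(\<lambda>\<omega>. nxt t (fst \<omega>) (snd \<omega>)) \<in> borel_measurable (borel \<Otimes>\<^sub>M PiM L (\<lambda>_. borel))"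
  (is "_ \<in> borel_measurable ?M")
proof (rule borel_measurable_iff_less[THEN iffD2], rule allI)
  fix z
  define S where "S = {v. \<exists>a\<in>free. t < a \<and> a \<le> v \<and> a < z}"
  \<comment> \<open>The union over free points is uncountable, but it is upward closed in
    \<open>v\<close> and hence an interval.\<close>
  have [measurable]: "S \<in> sets borel" unfolding S_def
    by (rule real_interval_borel_measurable) (auto simp: is_interval_1 intro: order_trans)
  have "{\<omega> \<in> space ?M. nxt t (fst \<omega>) (snd \<omega>) < z} = {\<omega> \<in> space ?M. fst \<omega> < z}
    \<union> (\<Union>x\<in>{x\<in>L. t \<le> x}. {\<omega> \<in> space ?M. y x \<le> fst \<omega> \<and> x \<le> snd \<omega> x \<and> snd \<omega> x < y x \<and> snd \<omega> x < z})
    \<union> {\<omega> \<in> space ?M. fst \<omega> \<in> S}"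
    unfolding nxt_less_iff S_def by auto
  also have "\<dots> \<in> sets ?M"
    using countable_L by (intro sets.Un sets.countable_UN'') auto
  finally show "{\<omega> \<in> space ?M. nxt t (fst \<omega>) (snd \<omega>) < z} \<in> sets ?M" .
qed

section \<open>The observer's information and the vanishing mean of the remaining increment\<close>

abbreviation \<Omega>M :: "(real \<times> (real \<Rightarrow> real)) measure" where
  "\<Omega>M \<equiv> borel \<Otimes>\<^sub>M PiM L (\<lambda>_. borel)"

lemma past_measurable [measurable]: "past t \<in> PiM L (\<lambda>_. borel) \<rightarrow>\<^sub>M PiM L (\<lambda>_. borel)"
  unfolding past_def by (rule measurable_restrict) auto

text \<open>The first component separates the revealed outcomes from the others: without it the case
  \<open>v = t\<close> could not be told from \<open>nxt t v p = t\<close>.\<close>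

definition state :: "real \<Rightarrow> real \<times> (real \<Rightarrow> real) \<Rightarrow> real \<times> real \<times> (real \<Rightarrow> real)" where
  "state t = (\<lambda>(v, p). if v \<le> t \<or> 1 \<le> v then (0, v, p) else (1, nxt t v p, past t p))"

definition val :: "real \<times> real \<times> (real \<Rightarrow> real) \<Rightarrow> real" where
  "val = (\<lambda>(d, v, p). if d = 0 then q v else G v)"

lemma state_measurable [measurable]: "state t \<in> \<Omega>M \<rightarrow>\<^sub>M borel \<Otimes>\<^sub>M \<Omega>M"
  unfolding state_def split_beta' by measurable

lemma val_measurable [measurable]: "val \<in> borel_measurable (borel \<Otimes>\<^sub>M \<Omega>M)"
  unfolding val_def split_beta' by measurable

text \<open>Terminal value minus current position, on a test event \<open>B\<close> of the history
  of a still undecided outcome. The cutoff \<open>r < 1\<close> bounds \<open>G\<close> on this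
  event, which makes the increment integrable before anything is known about the position
  itself.\<close>

definition incr :: "real \<Rightarrow> real \<Rightarrow> (real \<times> (real \<Rightarrow> real)) set \<Rightarrow> real \<Rightarrow> (real \<Rightarrow> real) \<Rightarrow> real" where
  "incr s r B v p = (if s < v \<and> v < 1 \<and> nxt s v p \<le> r \<and> (nxt s v p, past s p) \<in> B
     then q v - G (nxt s v p) else 0)"

lemma free_measurable [measurable]: "free \<in> sets borel"
proof -
  have "free = {0..<1} - (\<Union>x\<in>L. {x..<y x})" by (auto simp: free_def)
  moreover have "(\<Union>x\<in>L. {x..<y x}) \<in> sets borel"
    using countable_L by (intro sets.countable_UN'') auto
  ultimately show ?thesis by auto
qed

context
  fixes s r :: real and B :: "(real \<times> (real \<Rightarrow> real)) set"
  assumes s: "grid s" and r: "r < 1" and B [measurable]: "B \<in> sets \<Omega>M"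
begin

lemma grid_time_nonneg: "0 \<le> s" using s by (simp add: grid_def)

lemma incr_measurable [measurable]: "case_prod (incr s r B) \<in> borel_measurable \<Omega>M"
  unfolding incr_def split_beta' by measurable

lemma incr_bound: "\<bar>incr s r B v p\<bar> \<le> \<bar>q v\<bar> + \<bar>G r\<bar>"
proof (cases "s < v \<and> v < 1 \<and> nxt s v p \<le> r")
  case True
  then have "s \<le> nxt s v p" by (intro nxt_ge) auto
  then have "0 \<le> G (nxt s v p)" "G (nxt s v p) \<le> G r"
    using True grid_time_nonneg r by (auto intro!: G_nonneg G_mono)
  then show ?thesis by (auto simp: incr_def)
qed (auto simp: incr_def)

lemma integrable_bound_base: "integrable base (\<lambda>(v, p). \<bar>q v\<bar> + \<bar>G r\<bar>)"
proof -
  interpret pair_prob_space unif decoys by (rule pair_prob_base)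
  have "integrable (distr (unif \<Otimes>\<^sub>M decoys) unif fst) (\<lambda>v. \<bar>q v\<bar> + \<bar>G r\<bar>)"
    using q_integrable by (simp add: M2.distr_pair_fst)
  then have "integrable (unif \<Otimes>\<^sub>M decoys) (\<lambda>x. \<bar>q (fst x)\<bar> + \<bar>G r\<bar>)"
    by (subst (asm) integrable_distr_eq) auto
  then show ?thesis by (simp add: base_def split_beta')
qed

lemma integrable_incr:
  assumes [measurable]: "A \<in> sets \<Omega>M"
  shows "integrable base (\<lambda>(v, p). indicator A (v, p) * incr s r B v p)"
proof (rule Bochner_Integration.integrable_bound[OF integrable_bound_base])
  show "(\<lambda>(v, p). indicator A (v, p) * incr s r B v p) \<in> borel_measurable base"
    unfolding split_beta' using incr_measurable unfolding split_beta' by measurable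
  show "AE x in base. norm (case x of (v, p) \<Rightarrow> indicator A (v, p) * incr s r B v p)
      \<le> norm (case x of (v, p) \<Rightarrow> \<bar>q v\<bar> + \<bar>G r\<bar>)"
    using incr_bound by (auto simp: indicator_def abs_mult intro!: AE_I2)
qed

lemma section_measurable:
  assumes "A \<in> sets \<Omega>M" "p \<in> space decoys"
  shows "(\<lambda>v. indicator A (v, p) * incr s r B v p) \<in> borel_measurable borel"
proof -
  have 1: "(\<lambda>v. (v, p)) \<in> borel \<rightarrow>\<^sub>M \<Omega>M"
    using assms(2) by (intro measurable_Pair) (auto simp: space_PiM)
  have 2: "(\<lambda>\<omega>. indicator A \<omega> * case_prod (incr s r B) \<omega>) \<in> borel_measurable \<Omega>M"
    using assms(1) by measurable
  from measurable_compose[OF 1 2] show ?thesis by simp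
qed

lemma nxt_in_measurable [measurable]: "S \<in> sets borel \<Longrightarrow> {(v, p). nxt s v p \<in> S} \<inter> space \<Omega>M \<in> sets \<Omega>M"
proof -
  assume [measurable]: "S \<in> sets borel"
  have "{(v, p). nxt s v p \<in> S} \<inter> space \<Omega>M = {\<omega> \<in> space \<Omega>M. nxt s (fst \<omega>) (snd \<omega>) \<in> S}" by auto
  also have "\<dots> \<in> sets \<Omega>M" by measurable
  finally show ?thesis .
qed

definition next_in :: "real set \<Rightarrow> (real \<times> (real \<Rightarrow> real)) set" where
  "next_in S = {(v, p). nxt s v p \<in> S} \<inter> space \<Omega>M"

lemma next_in_iff: "p \<in> space decoys \<Longrightarrow> (v, p) \<in> next_in S \<longleftrightarrow> nxt s v p \<in> S"
  by (auto simp: next_in_def space_pair_measure space_PiM)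

lemma next_in_sets [measurable]: "S \<in> sets borel \<Longrightarrow> next_in S \<in> sets \<Omega>M"
  unfolding next_in_def by (rule nxt_in_measurable)

text \<open>For fixed decoys the point \<open>nxt s v p\<close>, when it lies outside of the cells, does not depend on \<open>v\<close>
  up to a null set; this reduces the following integral to the definition of the barycenter.\<close>

lemma nxt_free_unique:
  assumes "s < v" "nxt s v p = v" "v \<in> free" "s < w" "nxt s w p = w" "w \<in> free"
  shows "v = w"
proof -
  have "\<not> v < w" if "s < v" "nxt s v p = v" "v \<in> free" "s < w" "nxt s w p = w" "w \<in> free" for v w
  proof
    assume "v < w"
    then have "v \<in> cand s w p" using that by (auto simp: cand_def)
    then show False using nxt_le_cand[of v s w p] that \<open>v < w\<close> by simp
  qed
  from this[of v w] this[of w v] assms show ?thesis by (meson linorder_neqE)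
qed

lemma integral_incr_free_section:
  assumes p: "p \<in> space decoys"
  shows "(\<integral>v. indicator (next_in free) (v, p) * incr s r B v p \<partial>unif) = 0" (is "integral\<^sup>L unif ?h = 0")
proof -
  \<comment> \<open>The single quantile that may be free and its own next point. Apart from it, a
    free next point is the infimum of the pool.\<close>
  define w where "w = (THE v. s < v \<and> nxt s v p = v \<and> v \<in> free)"
  have w: "v = w" if "s < v" "nxt s v p = v" "v \<in> free" for v
    unfolding w_def using that nxt_free_unique by (intro the_equality[symmetric]) blast+
  define d where "d = Inf (pool s p)"
  show ?thesis
  proof (cases "pool s p \<noteq> {} \<and> d \<in> free")
    case True
    then have d: "d \<in> free" "pool s p \<noteq> {}" "0 \<le> d" "d < 1" by (auto simp: free_def)
    have sd: "s \<le> d" unfolding d_def by (rule cInf_greatest[OF d(2)]) (auto simp: pool_def)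
    define c :: real where "c = (if d \<le> r \<and> (d, past s p) \<in> B then 1 else 0)"
    have "integral\<^sup>L unif ?h = (\<integral>v. c * (indicator {d<..} v * (q v - b d)) \<partial>unif)"
    proof (rule integral_cong_AE)
      show "?h \<in> borel_measurable unif" using section_measurable[OF next_in_sets[OF free_measurable] p] by simp
      show "AE v in unif. ?h v = c * (indicator {d<..} v * (q v - b d))"
        using AE_unif AE_unif_neq[of w] AE_unif_neq[of d]
      proof eventually_elim
        case (elim v)
        have eq: "nxt s v p = d" if "d < v"
          using nxt_pool[of s v p] d elim that sd unfolding d_def by auto
        have imp: "nxt s v p = d" if "s < v" "nxt s v p \<in> free"
          using nxt_free_imp[of s v p] elim w[of v] that unfolding d_def by metis
        show ?case
        proof (cases "d < v")
          case True
          then show ?thesis using eq sd elim d G_eq_b[OF d(1)] by (auto simp: incr_def c_def next_in_iff[OF p])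
        next
          case False
          then have "\<not> (s < v \<and> nxt s v p \<in> free)"
            using imp elim nxt_le[of s v p] by auto
          then show ?thesis using False by (auto simp: incr_def indicator_def next_in_iff[OF p])
        qed
      qed
    qed simp
    also have "\<dots> = 0" using d by (simp add: integral_tail_diff)
    finally show ?thesis .
  next
    case False
    have "AE v in unif. ?h v = 0"
      using AE_unif AE_unif_neq[of w]
    proof eventually_elim
      case (elim v)
      then have "\<not> (s < v \<and> nxt s v p \<in> free)"
        using nxt_free_imp[of s v p] elim w[of v] False unfolding d_def by metis
      then show ?case by (auto simp: incr_def indicator_def next_in_iff[OF p])
    qed
    then show ?thesis by (rule integral_eq_zero_AE)
  qed
qed

lemma integral_incr_free: "(\<integral>\<omega>. indicator (next_in free) \<omega> * case_prod (incr s r B) \<omega> \<partial>base) = 0"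
proof -
  interpret pair_prob_space unif decoys by (rule pair_prob_base)
  have "integrable (unif \<Otimes>\<^sub>M decoys) (\<lambda>(v, p). indicator (next_in free) (v, p) * incr s r B v p)"
    using integrable_incr[OF next_in_sets[OF free_measurable]] by (simp add: base_def)
  from integral_snd[OF this]
  have "(\<integral>\<omega>. indicator (next_in free) \<omega> * case_prod (incr s r B) \<omega> \<partial>base)
     = (\<integral>p. (\<integral>v. indicator (next_in free) (v, p) * incr s r B v p \<partial>unif) \<partial>decoys)"
    by (simp add: base_def split_beta')
  also have "\<dots> = 0"
    by (rule integral_eq_zero_AE) (auto intro!: AE_I2 integral_incr_free_section)
  finally show ?thesis .
qed

lemma history_test_measurable:
  assumes p: "p \<in> space decoys"
  shows "(\<lambda>d. if d \<le> r \<and> (d, past s p) \<in> B then 1 else 0 :: real) \<in> borel_measurable borel"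
proof -
  have "past s p \<in> space (PiM L (\<lambda>_. borel))" using p by (auto simp: past_def space_PiM)
  then have 1: "(\<lambda>v. (v, past s p)) \<in> borel \<rightarrow>\<^sub>M \<Omega>M"
    by (intro measurable_Pair) auto
  have "(\<lambda>v. indicator {v. v \<le> r} v * indicator B (v, past s p) :: real) \<in> borel_measurable borel"
    using measurable_compose[OF 1 borel_measurable_indicator[OF B]] by measurable
  moreover have "(\<lambda>v. indicator {v. v \<le> r} v * indicator B (v, past s p) :: real)
      = (\<lambda>d. if d \<le> r \<and> (d, past s p) \<in> B then 1 else 0)"
    by (auto simp: fun_eq_iff)
  ultimately show ?thesis by simp
qed

text \<open>The next point falls into the cell in two ways, which give the two summands:
  \<open>v\<close> itself lies there, or \<open>v\<close> lies beyond and the decoy \<open>u\<close>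
  is shown in its place. The factor \<open>e\<close> records that the cell is reached undisturbed,
  \<open>\<psi>\<close> that the history passes the test; neither depends on \<open>v\<close>, and
  \<open>e\<close> not on \<open>u\<close> either.\<close>

lemma incr_cell_section:
  assumes x: "x \<in> L" and p: "p \<in> space decoys"
  defines "e \<equiv> (if s \<le> x \<and> (\<forall>c\<in>pool s p. x \<le> c) then 1 else 0 :: real)"
  defines "\<psi> \<equiv> \<lambda>d. (if d \<le> r \<and> (d, past s p) \<in> B then 1 else 0 :: real)"
  shows "(\<integral>v. indicator (next_in {x..<y x}) (v, p(x := u)) * incr s r B v (p(x := u)) \<partial>unif)
    = e * (\<integral>v. \<psi> v * (indicator {x..<y x} v * (q v - G v)) \<partial>unif)
      + e * (indicator {x..<y x} u * \<psi> u * ((1 - y x) * (b (y x) - G u)))"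
    (is "integral\<^sup>L unif ?h = _")
proof -
  note xb = cell_bounds[OF x]
  have pu: "p(x := u) \<in> space decoys" using p x by (auto simp: space_PiM PiE_def extensional_def)
  have [measurable]: "\<psi> \<in> borel_measurable borel" unfolding \<psi>_def by (rule history_test_measurable[OF p])
  have \<psi>01: "\<psi> v = 0 \<or> \<psi> v = 1" for v by (simp add: \<psi>_def)
  define c where "c = e * (indicator {x..<y x} u * \<psi> u)"
  have e01: "e = 0 \<or> e = 1" by (simp add: e_def)
  have e1: "e = 1 \<longleftrightarrow> s \<le> x \<and> (\<forall>c\<in>pool s (p(x := u)). x \<le> c)"
    unfolding e_def pool_upd by simp
  have outside: "?h v = 0" if "\<not> (s < v \<and> v < 1 \<and> x \<le> nxt s v (p(x := u)) \<and> nxt s v (p(x := u)) < y x)" for v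
    using that by (auto simp: incr_def indicator_def next_in_iff[OF pu])
  have G_int: "integrable unif (\<lambda>v. \<psi> v * (indicator {x..<y x} v * (q v - G v)))"
  proof (rule Bochner_Integration.integrable_bound)
    show "integrable unif (\<lambda>v. \<bar>q v\<bar> + \<bar>b x\<bar>)" using q_integrable by simp
    show "AE v in unif. norm (\<psi> v * (indicator {x..<y x} v * (q v - G v))) \<le> norm (\<bar>q v\<bar> + \<bar>b x\<bar>)"
      using AE_unif
    proof eventually_elim
      case (elim v)
      then show ?case using \<psi>01[of v] G_nonneg[of v] G_le_b_cell[OF x, of v] by (auto simp: indicator_def)
    qed
  qed simp
  have tail_int: "integrable unif (\<lambda>v. indicator {y x<..} v * (q v - G u))"
    using integrable_mult_indicator[of "{y x<..}" unif "\<lambda>v. q v - G u"] q_integrable by simp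
  have "integral\<^sup>L unif ?h = (\<integral>v. e * (\<psi> v * (indicator {x..<y x} v * (q v - G v)))
      + c * (indicator {y x<..} v * (q v - G u)) \<partial>unif)"
  proof (rule integral_cong_AE)
    show "?h \<in> borel_measurable unif"
      using section_measurable[OF next_in_sets pu, of "{x..<y x}"] by simp
    show "AE v in unif. ?h v = e * (\<psi> v * (indicator {x..<y x} v * (q v - G v)))
      + c * (indicator {y x<..} v * (q v - G u))"
      using AE_unif AE_unif_neq[of s] AE_unif_neq[of "y x"]
    proof eventually_elim
      case (elim v)
      show ?case
      proof (cases "e = 1 \<and> s < v")
        case False
        then have "\<not> (s < v \<and> x \<le> nxt s v (p(x := u)) \<and> nxt s v (p(x := u)) < y x)"
          using nxt_in_cell_imp[OF s x, of v "p(x := u)"] elim e1 by blast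
        then have h: "?h v = 0" by (intro outside) blast
        have "e = 0 \<or> v < x" using False elim e01 e1 by force
        then show ?thesis unfolding h c_def using xb by (auto simp: indicator_def)
      next
        case True
        then have sx: "s \<le> x" and above: "\<forall>c\<in>pool s (p(x := u)). x \<le> c"
          using e1 by blast+
        then have above': "\<And>c. c \<in> pool s (p(x := u)) \<Longrightarrow> x \<le> c" by blast
        have pst: "past s (p(x := u)) = past s p" using past_upd[OF s x sx] .
        consider "v < x" | "x \<le> v" "v < y x" | "y x < v" using elim by linarith
        then show ?thesis
        proof cases
          case 1
          then have "nxt s v (p(x := u)) < x" using nxt_le[of s v "p(x := u)"] by linarith
          then have "?h v = 0" by (intro outside) linarith
          then show ?thesis using 1 xb by simp
        next
          case 2
          then have "nxt s v (p(x := u)) = v" using nxt_in_same_cell[OF s x sx above'] by blast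
          then show ?thesis using 2 True elim pst by (simp add: incr_def next_in_iff[OF pu] \<psi>_def)
        next
          case 3
          then have nx: "if x \<le> u \<and> u < y x then nxt s v (p(x := u)) = u else y x \<le> nxt s v (p(x := u))"
            using nxt_above_cell[OF s x sx above', where v = v] by simp
          show ?thesis
          proof (cases "x \<le> u \<and> u < y x")
            case True
            with nx have "nxt s v (p(x := u)) = u" by simp
            then show ?thesis using 3 True \<open>e = 1 \<and> s < v\<close> elim pst xb
              by (simp add: incr_def next_in_iff[OF pu] \<psi>_def c_def)
          next
            case False
            with nx have "\<not> nxt s v (p(x := u)) < y x" by simp
            then have "?h v = 0" by (intro outside) blast
            then show ?thesis using 3 False xb by (simp add: c_def)
          qed
        qed
      qed
    qed
  qed simp
  also have "\<dots> = e * (\<integral>v. \<psi> v * (indicator {x..<y x} v * (q v - G v)) \<partial>unif) + c * ((1 - y x) * (b (y x) - G u))"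
    using G_int tail_int xb by (subst Bochner_Integration.integral_add) (auto simp: integral_tail_diff)
  finally show ?thesis by (simp add: c_def)
qed

text \<open>Averaging the second summand of \<open>incr_cell_section\<close> over the law of the
  decoy gives the negative of the first: this is the balance equation from which
  \<open>decoy\<close> was obtained.\<close>

lemma integral_incr_cell:
  assumes x: "x \<in> L"
  shows "(\<integral>\<omega>. indicator (next_in {x..<y x}) \<omega> * case_prod (incr s r B) \<omega> \<partial>base) = 0"
proof -
  interpret pair_prob_space unif decoys by (rule pair_prob_base)
  interpret K: prob_space "decoy_law x" by (rule prob_space_decoy_law[OF x])
  interpret KP: pair_sigma_finite "decoy_law x" decoys
    unfolding pair_sigma_finite_def using prob_space_decoys K.prob_space_axioms by (auto intro: prob_space_imp_sigma_finite)
  define J where "J p = (\<integral>v. indicator (next_in {x..<y x}) (v, p) * incr s r B v p \<partial>unif)" for p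
  have i: "integrable (unif \<Otimes>\<^sub>M decoys) (\<lambda>(v, p). indicator (next_in {x..<y x}) (v, p) * incr s r B v p)"
    using integrable_incr[OF next_in_sets, of "{x..<y x}"] by (simp add: base_def)
  have J: "integrable decoys J" unfolding J_def by (rule integrable_snd[OF i])
  have [measurable]: "(\<lambda>(u, p). p(x := u)) \<in> decoy_law x \<Otimes>\<^sub>M decoys \<rightarrow>\<^sub>M decoys"
  proof -
    have "(\<lambda>\<omega>. (snd \<omega>)(x := fst \<omega>)) \<in> decoy_law x \<Otimes>\<^sub>M decoys \<rightarrow>\<^sub>M PiM (insert x L) decoy_law"
      using measurable_compose[OF measurable_pair_swap' measurable_add_dim[of x L decoy_law]] by (simp add: split_beta')
    then show ?thesis using x by (simp add: insert_absorb split_beta')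
  qed
  have J': "integrable (decoy_law x \<Otimes>\<^sub>M decoys) (\<lambda>(u, p). J (p(x := u)))"
  proof -
    have "integrable (distr (decoy_law x \<Otimes>\<^sub>M decoys) decoys (\<lambda>(u, p). p(x := u))) J"
      unfolding resample[OF x] by (rule J)
    then show ?thesis by (subst (asm) integrable_distr_eq) (auto simp: split_beta' J[THEN borel_measurable_integrable])
  qed
  have sect: "(\<integral>u. J (p(x := u)) \<partial>decoy_law x) = 0" if p: "p \<in> space decoys" for p
  proof -
    define e where "e = (if s \<le> x \<and> (\<forall>c\<in>pool s p. x \<le> c) then 1 else 0 :: real)"
    define \<psi> where "\<psi> d = (if d \<le> r \<and> (d, past s p) \<in> B then 1 else 0 :: real)" for d
    have Jf: "J (p(x := u)) = e * (\<integral>v. \<psi> v * (indicator {x..<y x} v * (q v - G v)) \<partial>unif)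
      + e * (indicator {x..<y x} u * \<psi> u * ((1 - y x) * (b (y x) - G u)))" for u
      unfolding J_def e_def \<psi>_def by (rule incr_cell_section[OF x p])
    have [measurable]: "\<psi> \<in> borel_measurable borel"
      unfolding \<psi>_def[abs_def] by (rule history_test_measurable[OF p])
    define f where "f u = indicator {x..<y x} u * \<psi> u * ((1 - y x) * (b (y x) - G u))" for u
    have f_meas [measurable]: "f \<in> borel_measurable borel" unfolding f_def by measurable
    have f_AE: "AE u in unif. decoy_density x u * f u = - (\<psi> u * (indicator {x..<y x} u * (q u - G u)))"
      using AE_decoy[OF x]
    proof eventually_elim
      case (elim u)
      show ?case
      proof (cases "u \<in> {x..<y x}")
        case True
        then have "decoy_density x u * f u = \<psi> u * (decoy x u * ((1 - y x) * (b (y x) - G u)))"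
          by (simp add: f_def decoy_density_def)
        also have "\<dots> = \<psi> u * (G u - q u)" using elim True by simp
        finally show ?thesis using True by (simp add: algebra_simps)
      qed (simp add: f_def)
    qed
    have f_bound: "\<bar>f u\<bar> \<le> (\<bar>b (y x)\<bar> + \<bar>b x\<bar>)" for u
    proof (cases "u \<in> {x..<y x}")
      case True
      have "\<bar>b (y x) - G u\<bar> \<le> \<bar>b (y x)\<bar> + \<bar>b x\<bar>"
        using True cell_bounds[OF x] G_nonneg[of u] G_le_b_cell[OF x, of u] by auto
      moreover have "\<bar>\<psi> u * (1 - y x)\<bar> \<le> 1" using cell_bounds[OF x] by (auto simp: \<psi>_def)
      ultimately have "\<bar>\<psi> u * (1 - y x)\<bar> * \<bar>b (y x) - G u\<bar> \<le> 1 * (\<bar>b (y x)\<bar> + \<bar>b x\<bar>)"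
        by (intro mult_mono) auto
      then show ?thesis using True by (simp add: f_def abs_mult mult.assoc)
    qed (simp add: f_def)
    have f_int: "integrable (decoy_law x) f"
      by (rule K.integrable_const_bound[of _ "\<bar>b (y x)\<bar> + \<bar>b x\<bar>"]) (auto simp: f_bound)
    have "(\<integral>u. f u \<partial>decoy_law x) = (\<integral>u. decoy_density x u * f u \<partial>unif)"
      unfolding decoy_law_def using AE_decoy_density[OF x] by (subst integral_density) auto
    also have "\<dots> = (\<integral>u. - (\<psi> u * (indicator {x..<y x} u * (q u - G u))) \<partial>unif)"
    proof (rule integral_cong_AE[OF _ _ f_AE])
      have "(\<lambda>u. - ((indicator {x..<y x} u * \<psi> u) * (q u - G u))) \<in> borel_measurable unif" by measurable
      then show "(\<lambda>u. - (\<psi> u * (indicator {x..<y x} u * (q u - G u)))) \<in> borel_measurable unif"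
        by (simp add: mult_ac)
    qed simp
    finally have "(\<integral>u. f u \<partial>decoy_law x) = - (\<integral>v. \<psi> v * (indicator {x..<y x} v * (q v - G v)) \<partial>unif)" by simp
    moreover have "(\<integral>u. J (p(x := u)) \<partial>decoy_law x)
      = (\<integral>u. e * (\<integral>v. \<psi> v * (indicator {x..<y x} v * (q v - G v)) \<partial>unif) + e * f u \<partial>decoy_law x)"
      by (simp add: Jf f_def)
    ultimately show ?thesis
      using f_int by (subst (asm) Bochner_Integration.integral_add) (auto simp: K.prob_space[unfolded space_decoy_law])
  qed
  have "(\<integral>\<omega>. indicator (next_in {x..<y x}) \<omega> * case_prod (incr s r B) \<omega> \<partial>base) = (\<integral>p. J p \<partial>decoys)"
    unfolding J_def using integral_snd[OF i] by (simp add: base_def split_beta')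
  also have "\<dots> = (\<integral>p. J p \<partial>distr (decoy_law x \<Otimes>\<^sub>M decoys) decoys (\<lambda>(u, p). p(x := u)))"
    by (simp add: resample[OF x])
  also have "\<dots> = (\<integral>(u, p). J (p(x := u)) \<partial>(decoy_law x \<Otimes>\<^sub>M decoys))"
    by (subst integral_distr) (auto simp: split_beta' J[THEN borel_measurable_integrable])
  also have "\<dots> = (\<integral>p. (\<integral>u. J (p(x := u)) \<partial>decoy_law x) \<partial>decoys)"
    using KP.integral_snd[OF J'] by simp
  also have "\<dots> = 0"
    by (rule integral_eq_zero_AE) (auto intro!: AE_I2 sect)
  finally show ?thesis .
qed

end

lemma integral_incr:
  assumes s: "grid s" and r: "r < 1" and B: "B \<in> sets \<Omega>M"
  shows "(\<integral>\<omega>. case_prod (incr s r B) \<omega> \<partial>base) = 0"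
proof -
  \<comment> \<open>A countable partition of the possible next points, with the free ones at index 0
    and the cells, enumerated along \<open>L\<close>, shifted by one.\<close>
  define S where "S n = (case n of 0 \<Rightarrow> free | Suc m \<Rightarrow> \<Union>x\<in>{x\<in>L. to_nat_on L x = m}. {x..<y x})" for n
  have S_cases: "S (Suc m) = {} \<or> (\<exists>x\<in>L. to_nat_on L x = m \<and> S (Suc m) = {x..<y x})" for m
  proof (cases "\<exists>x\<in>L. to_nat_on L x = m")
    case True
    then obtain x where x: "x \<in> L" "to_nat_on L x = m" by auto
    then have "{x\<in>L. to_nat_on L x = m} = {x}"
      using to_nat_on_inj[OF countable_L] by auto
    then show ?thesis using x by (auto simp: S_def)
  qed (auto simp: S_def)
  have [measurable]: "S n \<in> sets borel" for n
  proof (cases n)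
    case (Suc m) then show ?thesis using S_cases[of m] by auto
  qed (simp add: S_def)
  have disj: "S i \<inter> S j = {}" if "i < j" for i j
  proof (cases i)
    case 0
    then obtain m where "j = Suc m" using \<open>i < j\<close> by (cases j) auto
    with 0 show ?thesis by (auto simp: S_def free_def)
  next
    case (Suc k)
    then obtain m where m: "j = Suc m" "m \<noteq> k" using \<open>i < j\<close> by (cases j) auto
    show ?thesis
    proof (rule ccontr)
      assume "S i \<inter> S j \<noteq> {}"
      then obtain x x' w where x: "x \<in> L" "x' \<in> L" "to_nat_on L x = k" "to_nat_on L x' = m"
        "w \<in> {x..<y x}" "w \<in> {x'..<y x'}"
        using S_cases[of m] S_cases[of k] unfolding Suc m(1) by blast
      then have "x = x'" by (intro cell_unique[of x x' w]) auto
      then show False using x m by simp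
    qed
  qed
  have disj': "S i \<inter> S j = {}" if "i \<noteq> j" for i j
    using that disj[of i j] disj[of j i] by (cases i j rule: linorder_cases) auto
  define A where "A n = next_in s (S n)" for n
  have A [measurable]: "A n \<in> sets base" for n unfolding A_def sets_base by (rule next_in_sets[OF s r B]) simp
  have i: "integrable base (\<lambda>\<omega>. indicator (\<Union>n. A n) \<omega> *\<^sub>R case_prod (incr s r B) \<omega>)"
    using integrable_incr[OF s r B, of "\<Union>n. A n"] A unfolding sets_base by (simp add: split_beta')
  have zero: "(LINT \<omega>:A n|base. case_prod (incr s r B) \<omega>) = 0" for n
  proof (cases n)
    case 0
    then show ?thesis using integral_incr_free[OF s r B] by (simp add: A_def S_def set_lebesgue_integral_def)
  next
    case (Suc m)
    have "A n = {} \<or> (\<exists>x\<in>L. A n = next_in s {x..<y x})"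
      using S_cases[of m] Suc by (auto simp: A_def next_in_def[OF s r B])
    then show ?thesis using integral_incr_cell[OF s r B] by (auto simp: set_lebesgue_integral_def)
  qed
  have "(\<integral>\<omega>. case_prod (incr s r B) \<omega> \<partial>base) = (LINT \<omega>:(\<Union>n. A n)|base. case_prod (incr s r B) \<omega>)"
    unfolding set_lebesgue_integral_def
  proof (rule Bochner_Integration.integral_cong[OF refl])
    fix \<omega> assume w: "\<omega> \<in> space base"
    obtain v p where vp: "\<omega> = (v, p)" by (cases \<omega>)
    have "\<omega> \<in> (\<Union>n. A n)" if "incr s r B v p \<noteq> 0"
    proof -
      from that have v: "s < v" "v < 1" by (auto simp: incr_def split: if_splits)
      have d: "0 \<le> nxt s v p" "nxt s v p < 1"
        using v nxt_ge[of s v p] nxt_le[of s v p] grid_time_nonneg[OF s r B] by auto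
      have "\<exists>n. nxt s v p \<in> S n"
      proof (cases "nxt s v p \<in> free")
        case True then show ?thesis by (intro exI[of _ 0]) (simp add: S_def)
      next
        case False
        with d obtain x where "x \<in> L" "x \<le> nxt s v p" "nxt s v p < y x" by (auto simp: free_def)
        then show ?thesis by (intro exI[of _ "Suc (to_nat_on L x)"]) (auto simp: S_def)
      qed
      then show ?thesis using w vp by (auto simp: A_def next_in_def[OF s r B] space_base space_pair_measure space_PiM)
    qed
    then show "case_prod (incr s r B) \<omega> = indicator (\<Union>n. A n) \<omega> *\<^sub>R case_prod (incr s r B) \<omega>"
      unfolding vp by (auto simp: indicator_def)
  qed
  also have "\<dots> = (\<Sum>n. (LINT \<omega>:A n|base. case_prod (incr s r B) \<omega>))"
  proof (rule lebesgue_integral_countable_add[OF A])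
    show "A i \<inter> A j = {}" if "i \<noteq> j" for i j
      using disj'[OF that] by (auto simp: A_def next_in_def[OF s r B])
    show "set_integrable base (\<Union>n. A n) (case_prod (incr s r B))"
      using i by (simp add: set_integrable_def)
  qed
  also have "\<dots> = 0" by (simp add: zero)
  finally show ?thesis .
qed

section \<open>The position of the observer: integrability and conditional means\<close>

definition proc :: "real \<Rightarrow> real \<times> (real \<Rightarrow> real) \<Rightarrow> real" where
  "proc s \<omega> = val (state s \<omega>)"

lemma proc_eq: "proc s (v, p) = (if v \<le> s \<or> 1 \<le> v then q v else G (nxt s v p))"
  by (simp add: proc_def val_def state_def)

lemma proc_measurable [measurable]: "proc s \<in> borel_measurable \<Omega>M"
  unfolding proc_def[abs_def] by measurable

definition hist :: "real \<Rightarrow> (real \<times> (real \<Rightarrow> real)) measure" where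
  "hist s = vimage_algebra (space base) (state s) (borel \<Otimes>\<^sub>M \<Omega>M)"

lemma state_in_space: "state s \<in> space base \<rightarrow> space (borel \<Otimes>\<^sub>M \<Omega>M)"
  using measurable_space[OF state_measurable] by (auto simp: space_base space_pair_measure space_PiM)

lemma sets_hist: "sets (hist s) = {state s -` A \<inter> space base | A. A \<in> sets (borel \<Otimes>\<^sub>M \<Omega>M)}"
  unfolding hist_def by (rule sets_vimage_algebra2[OF state_in_space])

lemma space_hist: "space (hist s) = space base"
  unfolding hist_def by simp

lemma state_measurable_hist: "state s \<in> hist s \<rightarrow>\<^sub>M borel \<Otimes>\<^sub>M \<Omega>M"
  unfolding hist_def by (rule measurable_vimage_algebra1[OF state_in_space])

lemma proc_measurable_hist: "proc s \<in> borel_measurable (hist s)"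
  unfolding proc_def[abs_def] using measurable_compose[OF state_measurable_hist val_measurable] .

lemma subalgebra_base_hist: "subalgebra base (hist s)"
  unfolding subalgebra_def space_hist
proof (intro conjI refl subsetI)
  fix A assume "A \<in> sets (hist s)"
  then obtain A' where "A = state s -` A' \<inter> space base" "A' \<in> sets (borel \<Otimes>\<^sub>M \<Omega>M)" unfolding sets_hist by auto
  moreover have "state s \<in> base \<rightarrow>\<^sub>M borel \<Otimes>\<^sub>M \<Omega>M" using state_measurable by (simp cong: measurable_cong_sets add: measurable_cong_sets[OF sets_base refl])
  ultimately show "A \<in> sets base" by (auto intro: measurable_sets)
qed

text \<open>Without its flag a state is again a point of the sample space, from which the earlier
  state can be recomputed; for undecided outcomes this is \<open>nxt_past\<close>. It makes the
  sigma-algebras \<open>hist\<close> increase along grid times.\<close>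

lemma state_state:
  assumes "grid t" "s < t"
  shows "state s \<omega> = state s (snd (state t \<omega>))"
proof -
  obtain v p where vp: "\<omega> = (v, p)" by (cases \<omega>)
  show ?thesis
  proof (cases "v \<le> t \<or> 1 \<le> v")
    case False
    then have "t \<le> nxt t v p" "nxt t v p < 1" using nxt_ge[of t v p] nxt_le[of t v p] by auto
    with False assms show ?thesis
      by (simp add: vp state_def nxt_past past_past)
  qed (simp add: vp state_def)
qed

lemma subalgebra_hist:
  assumes "grid t" "s \<le> t" shows "subalgebra (hist t) (hist s)"
proof (cases "s = t")
  case False
  then have st: "s < t" using assms by simp
  have "state s \<in> hist t \<rightarrow>\<^sub>M borel \<Otimes>\<^sub>M \<Omega>M"
  proof -
    have "(\<lambda>\<omega>. state s (snd (state t \<omega>))) \<in> hist t \<rightarrow>\<^sub>M borel \<Otimes>\<^sub>M \<Omega>M"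
      using measurable_compose[OF measurable_compose[OF state_measurable_hist measurable_snd] state_measurable] .
    then show ?thesis using state_state[OF assms(1) st] by simp
  qed
  then show ?thesis unfolding subalgebra_def space_hist sets_hist[of s]
    using space_hist[of t] by (auto dest: measurable_sets)
qed (simp add: subalgebra_def)

lemma integrable_q_base: "integrable base (\<lambda>\<omega>. q (fst \<omega>))"
proof -
  interpret pair_prob_space unif decoys by (rule pair_prob_base)
  have "integrable (distr base unif fst) q"
    using q_integrable by (simp add: M2.distr_pair_fst base_def)
  then show ?thesis
    by (subst (asm) integrable_distr_eq) (auto simp: base_def)
qed

lemma AE_base_fst: "AE u in unif. P u \<Longrightarrow> AE \<omega> in base. P (fst \<omega>)"
proof -
  interpret pair_prob_space unif decoys by (rule pair_prob_base)
  assume "AE u in unif. P u"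
  then have "AE u in distr base unif fst. P u" unfolding base_def M2.distr_pair_fst .
  then show ?thesis by (rule AE_distrD[rotated]) (simp add: base_def)
qed

lemma integral_q_base: "(\<integral>\<omega>. q (fst \<omega>) \<partial>base) = 0"
proof -
  interpret pair_prob_space unif decoys by (rule pair_prob_base)
  have "(\<integral>u. q u \<partial>distr base unif fst) = 0"
    using q_mean by (simp add: M2.distr_pair_fst base_def)
  then show ?thesis by (subst (asm) integral_distr) (auto simp: base_def)
qed

context
  fixes s assumes s: "grid s"
begin

lemma borel_measurable_base: "f \<in> borel_measurable \<Omega>M \<Longrightarrow> f \<in> borel_measurable base"
  by (simp add: measurable_cong_sets[OF sets_base refl])

lemma s_nonneg: "0 \<le> s" using s by (simp add: grid_def)

definition alive :: "(real \<times> (real \<Rightarrow> real)) \<Rightarrow> bool" where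
  "alive \<omega> \<longleftrightarrow> s < fst \<omega> \<and> fst \<omega> < 1"

lemma alive_measurable [measurable]: "Measurable.pred \<Omega>M alive"
  unfolding alive_def[abs_def] by measurable

lemma nxt_bounds: "alive \<omega> \<Longrightarrow> 0 \<le> nxt s (fst \<omega>) (snd \<omega>) \<and> nxt s (fst \<omega>) (snd \<omega>) < 1"
  using s_nonneg nxt_ge[of s "fst \<omega>" "snd \<omega>"] nxt_le[of s "fst \<omega>" "snd \<omega>"] by (auto simp: alive_def)

definition lev :: "nat \<Rightarrow> real" where "lev n = 1 - 1 / real (Suc n)"

lemma lev_less: "lev n < 1" by (simp add: lev_def)

lemma lev_eventually: "d < 1 \<Longrightarrow> \<forall>\<^sub>F n in sequentially. d \<le> lev n"
proof -
  assume "d < 1"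
  have "(\<lambda>n. 1 - 1 / real (Suc n)) \<longlonglongrightarrow> 1 - 0"
    by (intro tendsto_intros LIMSEQ_Suc lim_inverse_n')
  then have "lev \<longlonglongrightarrow> 1" by (simp add: lev_def[abs_def])
  from order_tendstoD(1)[OF this \<open>d < 1\<close>] show ?thesis by (auto elim: eventually_mono)
qed

lemma lev_mono: "m \<le> n \<Longrightarrow> lev m \<le> lev n"
  by (simp add: lev_def frac_le)

text \<open>Below each cutoff the integral of \<open>G\<close> at the next point equals that of
  \<open>q\<close> over the same event, by \<open>integral_incr\<close>. The latter integrals
  converge by domination, and as \<open>G \<ge> 0\<close> monotone convergence gives
  integrability.\<close>

lemma integrable_G_nxt: "integrable base (\<lambda>\<omega>. if alive \<omega> then G (nxt s (fst \<omega>) (snd \<omega>)) else 0)"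
proof (rule integrable_monotone_convergence)
  define D where "D \<omega> = nxt s (fst \<omega>) (snd \<omega>)" for \<omega>
  have [measurable]: "D \<in> borel_measurable \<Omega>M" unfolding D_def[abs_def] by measurable
  have D: "alive \<omega> \<Longrightarrow> 0 \<le> D \<omega> \<and> D \<omega> < 1" for \<omega> unfolding D_def by (rule nxt_bounds)
  let ?f = "\<lambda>n \<omega>. if alive \<omega> \<and> D \<omega> \<le> lev n then G (D \<omega>) else 0"
  let ?g = "\<lambda>n \<omega>. if alive \<omega> \<and> D \<omega> \<le> lev n then q (fst \<omega>) else 0"
  show fi: "integrable base (?f n)" for n
  proof -
    interpret prob_space base by (rule prob_space_base)
    show ?thesis
    proof (rule integrable_const_bound[of _ "G (lev n)"])
      show "?f n \<in> borel_measurable base" by (rule borel_measurable_base) measurable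
      have "norm (?f n \<omega>) \<le> G (lev n)" for \<omega>
      proof (cases "alive \<omega> \<and> D \<omega> \<le> lev n")
        case True
        then show ?thesis using D[of \<omega>] G_nonneg[of "D \<omega>"] G_mono[of "D \<omega>" "lev n"] lev_less[of n] by auto
      next
        case False
        have "0 \<le> lev n" by (simp add: lev_def)
        then show ?thesis using False G_nonneg[of "lev n"] lev_less[of n] by auto
      qed
      then show "AE \<omega> in base. norm (?f n \<omega>) \<le> G (lev n)" by simp
    qed
  qed
  have gi: "integrable base (?g n)" for n
    by (rule Bochner_Integration.integrable_bound[OF integrable_q_base])
       (auto intro!: borel_measurable_base)
  have eq: "(\<integral>\<omega>. ?f n \<omega> \<partial>base) = (\<integral>\<omega>. ?g n \<omega> \<partial>base)" for n
  proof -
    have "(\<integral>\<omega>. ?g n \<omega> \<partial>base) - (\<integral>\<omega>. ?f n \<omega> \<partial>base) = (\<integral>\<omega>. ?g n \<omega> - ?f n \<omega> \<partial>base)"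
      using gi[of n] fi[of n] by simp
    also have "\<dots> = (\<integral>\<omega>. case_prod (incr s (lev n) (space \<Omega>M)) \<omega> \<partial>base)"
      by (intro Bochner_Integration.integral_cong refl)
         (auto simp: incr_def alive_def D_def space_base space_pair_measure space_PiM past_def split_beta')
    also have "\<dots> = 0" by (rule integral_incr[OF s lev_less sets.top])
    finally show ?thesis by simp
  qed
  have "(\<lambda>n. \<integral>\<omega>. ?g n \<omega> \<partial>base) \<longlonglongrightarrow> (\<integral>\<omega>. (if alive \<omega> then q (fst \<omega>) else 0) \<partial>base)"
  proof (rule integral_dominated_convergence[where w = "\<lambda>\<omega>. \<bar>q (fst \<omega>)\<bar>"])
    show "AE \<omega> in base. (\<lambda>n. ?g n \<omega>) \<longlonglongrightarrow> (if alive \<omega> then q (fst \<omega>) else 0)"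
    proof (rule AE_I2)
      fix \<omega>
      show "(\<lambda>n. ?g n \<omega>) \<longlonglongrightarrow> (if alive \<omega> then q (fst \<omega>) else 0)"
      proof (cases "alive \<omega>")
        case True
        have "\<forall>\<^sub>F n in sequentially. D \<omega> \<le> lev n" using lev_eventually D[OF True] by blast
        then have "\<forall>\<^sub>F n in sequentially. ?g n \<omega> = (if alive \<omega> then q (fst \<omega>) else 0)"
          by eventually_elim (simp add: True)
        then show ?thesis by (rule tendsto_eventually)
      qed simp
    qed
  qed (auto intro!: borel_measurable_base integrable_q_base)
  then show "(\<lambda>n. \<integral>\<omega>. ?f n \<omega> \<partial>base) \<longlonglongrightarrow> (\<integral>\<omega>. (if alive \<omega> then q (fst \<omega>) else 0) \<partial>base)"
    unfolding eq .
  show "AE \<omega> in base. mono (\<lambda>n. ?f n \<omega>)"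
  proof (rule AE_I2, rule monoI)
    fix \<omega> and m n :: nat assume "m \<le> n"
    then show "?f m \<omega> \<le> ?f n \<omega>" using lev_mono[of m n] D[of \<omega>] G_nonneg[of "D \<omega>"] by auto
  qed
  show "AE \<omega> in base. (\<lambda>n. ?f n \<omega>) \<longlonglongrightarrow> (if alive \<omega> then G (nxt s (fst \<omega>) (snd \<omega>)) else 0)"
  proof (rule AE_I2)
    fix \<omega>
    show "(\<lambda>n. ?f n \<omega>) \<longlonglongrightarrow> (if alive \<omega> then G (nxt s (fst \<omega>) (snd \<omega>)) else 0)"
    proof (cases "alive \<omega>")
      case True
      have "\<forall>\<^sub>F n in sequentially. D \<omega> \<le> lev n" using lev_eventually D[OF True] by blast
      then have "\<forall>\<^sub>F n in sequentially. ?f n \<omega> = (if alive \<omega> then G (nxt s (fst \<omega>) (snd \<omega>)) else 0)"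
        by eventually_elim (simp add: True D_def)
      then show ?thesis by (rule tendsto_eventually)
    qed simp
  qed
  show "(\<lambda>\<omega>. if alive \<omega> then G (nxt s (fst \<omega>) (snd \<omega>)) else 0) \<in> borel_measurable base"
    by (rule borel_measurable_base) measurable
qed

lemma integrable_proc: "integrable base (proc s)"
proof -
  have "integrable base (\<lambda>\<omega>. (if alive \<omega> then 0 else 1) * q (fst \<omega>))"
    by (rule Bochner_Integration.integrable_bound[OF integrable_q_base])
       (auto intro!: borel_measurable_base)
  then have "integrable base (\<lambda>\<omega>. (if alive \<omega> then G (nxt s (fst \<omega>) (snd \<omega>)) else 0) + (if alive \<omega> then 0 else 1) * q (fst \<omega>))"
    by (rule Bochner_Integration.integrable_add[OF integrable_G_nxt])
  moreover have "(\<lambda>\<omega>. (if alive \<omega> then G (nxt s (fst \<omega>) (snd \<omega>)) else 0) + (if alive \<omega> then 0 else 1) * q (fst \<omega>)) = proc s"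
    by (auto simp: fun_eq_iff proc_eq alive_def)
  ultimately show ?thesis by simp
qed

lemma integral_incr_all:
  assumes [measurable]: "B \<in> sets \<Omega>M"
  shows "(\<integral>\<omega>. (if alive \<omega> \<and> (nxt s (fst \<omega>) (snd \<omega>), past s (snd \<omega>)) \<in> B then q (fst \<omega>) - proc s \<omega> else 0) \<partial>base) = 0"
    (is "integral\<^sup>L base ?h = 0")
proof (rule LIMSEQ_unique)
  have [measurable]: "(\<lambda>\<omega>. (nxt s (fst \<omega>) (snd \<omega>), past s (snd \<omega>))) \<in> \<Omega>M \<rightarrow>\<^sub>M \<Omega>M" by measurable
  have [measurable]: "case_prod (incr s r B) \<in> borel_measurable \<Omega>M" if "r < 1" for r
    by (rule incr_measurable[OF s that assms])
  show "(\<lambda>n. \<integral>\<omega>. case_prod (incr s (lev n) B) \<omega> \<partial>base) \<longlonglongrightarrow> integral\<^sup>L base ?h"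
  proof (rule integral_dominated_convergence[where w = "\<lambda>\<omega>. \<bar>q (fst \<omega>)\<bar> + \<bar>proc s \<omega>\<bar>"])
    show "?h \<in> borel_measurable base" by (rule borel_measurable_base) measurable
    show "case_prod (incr s (lev n) B) \<in> borel_measurable base" for n
      by (rule borel_measurable_base) (use lev_less in measurable)
    show "integrable base (\<lambda>\<omega>. \<bar>q (fst \<omega>)\<bar> + \<bar>proc s \<omega>\<bar>)"
      using integrable_q_base integrable_proc by simp
    show "AE \<omega> in base. norm (case_prod (incr s (lev n) B) \<omega>) \<le> \<bar>q (fst \<omega>)\<bar> + \<bar>proc s \<omega>\<bar>" for n
      by (rule AE_I2) (auto simp: incr_def proc_eq)
    show "AE \<omega> in base. (\<lambda>n. case_prod (incr s (lev n) B) \<omega>) \<longlonglongrightarrow> ?h \<omega>"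
    proof (rule AE_I2)
      fix \<omega>
      show "(\<lambda>n. case_prod (incr s (lev n) B) \<omega>) \<longlonglongrightarrow> ?h \<omega>"
      proof (cases "alive \<omega>")
        case True
        have "\<forall>\<^sub>F n in sequentially. nxt s (fst \<omega>) (snd \<omega>) \<le> lev n"
          using lev_eventually nxt_bounds[OF True] by blast
        then have "\<forall>\<^sub>F n in sequentially. case_prod (incr s (lev n) B) \<omega> = ?h \<omega>"
        proof eventually_elim
          case (elim n)
          then show ?case using True
            by (simp add: incr_def proc_def val_def state_def alive_def split_beta')
        qed
        then show ?thesis by (rule tendsto_eventually)
      next
        case False
        then show ?thesis by (auto simp: incr_def alive_def split_beta')
      qed
    qed
  qed
  show "(\<lambda>n. \<integral>\<omega>. case_prod (incr s (lev n) B) \<omega> \<partial>base) \<longlonglongrightarrow> 0"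
    by (simp add: integral_incr[OF s lev_less assms])
qed

text \<open>Revealed outcomes contribute equally to both sides, since their position is already the
  terminal value. What is left is the slice \<open>B\<close> of the event at flag 1, covered by
  \<open>integral_incr_all\<close>.\<close>

lemma proc_cond:
  assumes A: "A \<in> sets (hist s)"
  shows "(\<integral>\<omega>\<in>A. q (fst \<omega>) \<partial>base) = (\<integral>\<omega>\<in>A. proc s \<omega> \<partial>base)"
proof -
  obtain A' where A': "A = state s -` A' \<inter> space base" "A' \<in> sets (borel \<Otimes>\<^sub>M \<Omega>M)" using A unfolding sets_hist by auto
  define B where "B = Pair 1 -` A'"
  have B: "B \<in> sets \<Omega>M" unfolding B_def using sets_Pair1[OF A'(2)] .
  have Ab: "A \<in> sets base" using subalgebra_base_hist[of s] A by (auto simp: subalgebra_def)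
  have i: "set_integrable base A (\<lambda>\<omega>. q (fst \<omega>))" "set_integrable base A (proc s)"
    unfolding set_integrable_def
    by (rule integrable_mult_indicator[OF Ab], fact integrable_q_base integrable_proc)+
  have "(\<integral>\<omega>\<in>A. q (fst \<omega>) \<partial>base) - (\<integral>\<omega>\<in>A. proc s \<omega> \<partial>base) = (\<integral>\<omega>\<in>A. (q (fst \<omega>) - proc s \<omega>) \<partial>base)"
    using i by (rule set_integral_diff(2)[symmetric])
  also have "\<dots> = (\<integral>\<omega>. (if alive \<omega> \<and> (nxt s (fst \<omega>) (snd \<omega>), past s (snd \<omega>)) \<in> B then q (fst \<omega>) - proc s \<omega> else 0) \<partial>base)"
    unfolding set_lebesgue_integral_def
    by (intro Bochner_Integration.integral_cong refl)
       (auto simp: A' B_def alive_def state_def proc_eq indicator_def)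
  also have "\<dots> = 0" by (rule integral_incr_all[OF B])
  finally show ?thesis by simp
qed

end

end

section \<open>Path regularity and the running maximum\<close>

lemma eventually_at_right_Ioo: "t < x \<Longrightarrow> \<forall>\<^sub>F u in at_right t. t < u \<and> u < (x::real)"
  by (auto simp: eventually_at_right_field)

lemma eventually_at_left_Ioo: "x < t \<Longrightarrow> \<forall>\<^sub>F u in at_left t. x < u \<and> u < (t::real)"
  by (auto simp: eventually_at_left_field)

context tail_bounded begin

text \<open>The path is constant on each cell: the point shown there is announced at the left end,
  and whether it was the terminal quantile or a decoy is disclosed at the right end.\<close>

definition path :: "real \<Rightarrow> real \<times> (real \<Rightarrow> real) \<Rightarrow> real" where
  "path t \<omega> = proc (cell_start t) \<omega>"

lemma path_eq: "path t (v, p) = (if v \<le> cell_start t \<or> 1 \<le> v then q v else G (nxt (cell_start t) v p))"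
  by (simp add: path_def proc_eq)

lemma cell_start_nonneg: "0 \<le> t \<Longrightarrow> 0 \<le> cell_start t"
  using grid_cell_start[of t] by (simp add: grid_def)

text \<open>Since \<open>nxt\<close> increases with time, an upper bound is all that right
  continuity requires. A candidate below \<open>z\<close> other than \<open>v\<close> belongs to a
  cell or free point strictly after \<open>t\<close> and so survives a small increase of the
  time.\<close>

lemma nxt_right:
  assumes "\<And>x. x \<in> L \<Longrightarrow> x \<le> t \<Longrightarrow> t < y x \<Longrightarrow> False" "nxt t v p < z"
  shows "\<forall>\<^sub>F t' in at_right t. nxt (cell_start t') v p < z"
proof -
  consider "v < z" | x where "x \<in> L" "t \<le> x" "y x \<le> v" "x \<le> p x" "p x < y x" "p x < z"
    | a where "a \<in> free" "t < a" "a \<le> v" "a < z" using assms(2) unfolding nxt_less_iff by auto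
  then show ?thesis
  proof cases
    case 1
    then show ?thesis using nxt_le by (auto intro!: always_eventually intro: le_less_trans)
  next
    case 2
    have "t < x" using 2 assms(1)[of x] by (cases "t = x") auto
    have "\<forall>\<^sub>F t' in at_right t. t' < x"
      using eventually_at_right_Ioo[OF \<open>t < x\<close>] by (auto elim: eventually_mono)
    then show ?thesis
    proof eventually_elim
      case (elim t')
      then have "cell_start t' \<le> x" using cell_start_le[of t'] by simp
      with 2 show ?case unfolding nxt_less_iff by blast
    qed
  next
    case 3
    have "\<forall>\<^sub>F t' in at_right t. t' < a"
      using eventually_at_right_Ioo[OF \<open>t < a\<close>] by (auto elim: eventually_mono)
    then show ?thesis
    proof eventually_elim
      case (elim t')
      then have "cell_start t' < a" using cell_start_le[of t'] by simp
      with 3 show ?case unfolding nxt_less_iff by blast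
    qed
  qed
qed

lemma path_right_cont:
  assumes t: "0 \<le> t" "t < 1"
  shows "((\<lambda>t. path t \<omega>) \<longlongrightarrow> path t \<omega>) (at_right t)"
proof -
  obtain v p where vp: "\<omega> = (v, p)" by (cases \<omega>)
  show ?thesis
  proof (cases "v \<le> cell_start t \<or> 1 \<le> v")
    case True
    have "\<forall>\<^sub>F t' in at_right t. path t' \<omega> = path t \<omega>"
      using eventually_at_right_less[of t]
    proof eventually_elim
      case (elim t')
      then show ?case using True cell_start_mono[of t t'] by (auto simp: vp path_eq)
    qed
    then show ?thesis by (rule tendsto_eventually)
  next
    case alive: False
    show ?thesis
    proof (cases "\<exists>x\<in>L. x \<le> t \<and> t < y x")
      case True
      then obtain x where x: "x \<in> L" "x \<le> t" "t < y x" by auto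
      have "\<forall>\<^sub>F t' in at_right t. t' < y x" "\<forall>\<^sub>F t' in at_right t. t < t'"
        using eventually_at_right_Ioo[OF x(3)] by (auto elim: eventually_mono)
      then have "\<forall>\<^sub>F t' in at_right t. path t' \<omega> = path t \<omega>"
      proof eventually_elim
        case (elim t')
        then show ?case using x cell_start_cell[of x t] cell_start_cell[of x t'] by (simp add: path_def)
      qed
      then show ?thesis by (rule tendsto_eventually)
    next
      case False
      then have ct: "cell_start t = t" by (intro cell_start_free) auto
      with alive have tv: "t < v" "v < 1" by auto
      define d where "d = nxt t v p"
      have d: "0 \<le> d" "d < 1" using tv t nxt_ge[of t v p] nxt_le[of t v p] by (auto simp: d_def)
      have ev: "\<forall>\<^sub>F t' in at_right t. t < t' \<and> t' < v"
        using eventually_at_right_Ioo[OF tv(1)] by auto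
      have pt: "path t \<omega> = G d" using alive by (simp add: vp path_eq ct d_def)
      have ptG: "path t' \<omega> = G (nxt (cell_start t') v p) \<and> d \<le> nxt (cell_start t') v p \<and> nxt (cell_start t') v p < 1"
        if "t < t' \<and> t' < v" for t'
        using that cell_start_le[of t'] tv cell_start_mono[of t t'] ct nxt_mono[of t "cell_start t'" v p]
          nxt_le[of "cell_start t'" v p] by (auto simp: vp path_eq d_def)
      show ?thesis
      proof (rule order_tendstoI)
        fix e assume "e < path t \<omega>"
        from ev show "\<forall>\<^sub>F t' in at_right t. e < path t' \<omega>"
        proof eventually_elim
          case (elim t')
          then show ?case using ptG[OF elim] \<open>e < path t \<omega>\<close> G_mono[of d "nxt (cell_start t') v p"] d pt by auto
        qed
      next
        fix e assume e: "path t \<omega> < e"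
        then have "\<forall>\<^sub>F u in at_right d. G u < e"
          using order_tendstoD(2)[OF G_right[OF d]] pt by simp
        then obtain z where z: "d < z" "\<And>u. d < u \<Longrightarrow> u < z \<Longrightarrow> G u < e"
          unfolding eventually_at_right_field by auto
        have "\<forall>\<^sub>F t' in at_right t. nxt (cell_start t') v p < z"
          using False z(1) by (intro nxt_right) (auto simp: d_def)
        with ev show "\<forall>\<^sub>F t' in at_right t. path t' \<omega> < e"
        proof eventually_elim
          case (elim t')
          show ?case using ptG[OF elim(1)] elim z e pt
            by (cases "nxt (cell_start t') v p = d") auto
        qed
      qed
    qed
  qed
qed

lemma path_le:
  assumes "0 \<le> t" "0 < v" "v < 1"
  shows "path t (v, p) \<le> G v"
  using assms nxt_le[of "cell_start t" v p] nxt_ge[of "cell_start t" v p] cell_start_nonneg[of t]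
  by (auto simp: path_eq intro!: q_le_G G_mono)

text \<open>Before the terminal quantile is revealed the path is nondecreasing and bounded by
  \<open>G v\<close>, so the left limit is a supremum; afterwards the path is constant.\<close>

lemma path_left_limit:
  assumes t: "0 < t" "t \<le> 1"
  shows "\<exists>l. ((\<lambda>t. path t \<omega>) \<longlongrightarrow> l) (at_left t)"
proof -
  obtain v p where vp: "\<omega> = (v, p)" by (cases \<omega>)
  show ?thesis
  proof (cases "\<exists>t0. 0 \<le> t0 \<and> t0 < t \<and> (v \<le> cell_start t0 \<or> 1 \<le> v)")
    case True
    then obtain t0 where t0: "0 \<le> t0" "t0 < t" "v \<le> cell_start t0 \<or> 1 \<le> v" by auto
    have "\<forall>\<^sub>F t' in at_left t. t0 < t' \<and> t' < t"
      using eventually_at_left_Ioo[OF t0(2)] by auto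
    then have "\<forall>\<^sub>F t' in at_left t. path t' \<omega> = q v"
    proof eventually_elim
      case (elim t')
      then show ?case using t0 cell_start_mono[of t0 t'] by (auto simp: vp path_eq)
    qed
    then show ?thesis by (intro exI[of _ "q v"]) (rule tendsto_eventually)
  next
    case False
    then have al: "cell_start t' < v \<and> v < 1" if "0 \<le> t'" "t' < t" for t' using that by force
    have "cell_start 0 < v" "v < 1" using al[of 0] t by auto
    then have v: "0 < v" "v < 1" using cell_start_nonneg[of 0] by auto
    have mono: "path r \<omega> \<le> path u \<omega>" if "0 \<le> r" "r \<le> u" "u < t" for r u
    proof -
      have "path r \<omega> = G (nxt (cell_start r) v p)" "path u \<omega> = G (nxt (cell_start u) v p)"
        using al[of r] al[of u] that by (auto simp: vp path_eq)
      moreover have "nxt (cell_start r) v p \<le> nxt (cell_start u) v p"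
        by (rule nxt_mono[OF cell_start_mono[OF that(2)]])
      moreover have "0 \<le> nxt (cell_start r) v p"
        using nxt_ge[of "cell_start r" v p] al[of r] that cell_start_nonneg[of r] by auto
      moreover have "nxt (cell_start u) v p < 1" using nxt_le[of "cell_start u" v p] v by simp
      ultimately show ?thesis by (auto intro!: G_mono)
    qed
    have bdd: "bdd_above ((\<lambda>t. path t \<omega>) ` {0..<t})"
      using path_le v by (intro bdd_aboveI[of _ "G v"]) (auto simp: vp)
    have "((\<lambda>t. path t \<omega>) \<longlongrightarrow> (SUP u\<in>{0..<t}. path u \<omega>)) (at_left t)"
    proof (rule order_tendstoI)
      fix e assume "e < (SUP u\<in>{0..<t}. path u \<omega>)"
      then obtain u where u: "0 \<le> u" "u < t" "e < path u \<omega>"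
        using less_cSUP_iff[OF _ bdd] t by auto
      have "\<forall>\<^sub>F t' in at_left t. u < t' \<and> t' < t"
        using eventually_at_left_Ioo[OF u(2)] by auto
      then show "\<forall>\<^sub>F t' in at_left t. e < path t' \<omega>"
      proof eventually_elim
        case (elim t') then show ?case using mono[of u t'] u by auto
      qed
    next
      fix e assume e: "(SUP u\<in>{0..<t}. path u \<omega>) < e"
      have "\<forall>\<^sub>F t' in at_left t. 0 < t' \<and> t' < t"
        using eventually_at_left_Ioo[OF t(1)] by auto
      then show "\<forall>\<^sub>F t' in at_left t. path t' \<omega> < e"
      proof eventually_elim
        case (elim t')
        then have "path t' \<omega> \<le> (SUP u\<in>{0..<t}. path u \<omega>)" by (intro cSUP_upper bdd) auto
        then show ?case using e by simp
      qed
    qed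
    then show ?thesis by blast
  qed
qed

lemma cadlag_path: "cadlag_on 1 (\<lambda>t. path t \<omega>)"
  unfolding cadlag_on_def using path_right_cont path_left_limit by auto

lemma path_one: "path 1 \<omega> = q (fst \<omega>)"
proof -
  have "cell_start 1 = 1" using cell_below_1 by (intro cell_start_free) force
  then show ?thesis by (cases \<omega>) (auto simp: path_eq)
qed

text \<open>A time before the revelation at which the next point is at least \<open>z\<close>: the
  left end of the cell of \<open>v\<close>, if there is one; otherwise the right end of the cell of
  \<open>z\<close>, or \<open>z\<close> itself. At a cell boundary \<open>v\<close> this time could
  coincide with the revelation, hence the exclusion.\<close>

lemma path_sup_ge:
  assumes v: "0 < v" "v < 1" "\<And>x. x \<in> L \<Longrightarrow> v \<noteq> x \<and> v \<noteq> y x" and z: "0 \<le> z" "z < v"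
  shows "\<exists>t\<in>{0..1}. G z \<le> path t (v, p)"
proof -
  have main: "\<exists>t\<in>{0..<v}. z \<le> nxt (cell_start t) v p"
  proof (cases "\<exists>x\<in>L. x \<le> v \<and> v < y x")
    case True
    then obtain x where x: "x \<in> L" "x < v" "v < y x" using v(3) by force
    have "cell_start x = x" using x cell_nonempty[OF x(1)] by (intro cell_start_cell) auto
    moreover have "v \<le> c" if "c \<in> cand x v p" for c
    proof (rule ccontr)
      assume "\<not> v \<le> c"
      with that consider "c \<in> free" "x < c" "c < v" | x' where "x' \<in> L" "x \<le> x'" "y x' \<le> v"
        unfolding cand_def by auto
      then show False
      proof cases
        case 1 then show ?thesis using x by (auto simp: free_def)
      next
        case 2 then show ?thesis using x cells_disjoint[of x x'] cell_nonempty[of x'] by (cases "x = x'") auto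
      qed
    qed
    then have "v \<le> nxt x v p" unfolding nxt_def by (intro cInf_greatest cand_nonempty)
    ultimately show ?thesis using x L_nonneg[of x] z by (intro bexI[of _ x]) auto
  next
    case v_free: False
    show ?thesis
    proof (cases "\<exists>x\<in>L. x \<le> z \<and> z < y x")
      case True
      then obtain x where x: "x \<in> L" "x \<le> z" "z < y x" by auto
      then have yv: "y x < v" using v_free z v(3)[of x] by force
      have "cell_start (y x) \<ge> y x"
      proof (cases "\<exists>x'\<in>L. x' \<le> y x \<and> y x < y x'")
        case True
        then obtain x' where x': "x' \<in> L" "x' \<le> y x" "y x < y x'" by auto
        then have "y x \<le> x'" using x cells_disjoint[of x x'] cells_disjoint[of x' x] cell_nonempty[of x] by (cases x x' rule: linorder_cases) auto
        then show ?thesis using cell_start_cell[OF x'] by simp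
      next
        case False
        then have "cell_start (y x) = y x" by (intro cell_start_free) auto
        then show ?thesis by simp
      qed
      moreover have "cell_start (y x) \<le> nxt (cell_start (y x)) v p"
        using cell_start_le[of "y x"] yv by (intro nxt_ge) simp
      ultimately show ?thesis using yv x z by (intro bexI[of _ "y x"]) auto
    next
      case False
      then have "cell_start z = z" by (intro cell_start_free) auto
      then show ?thesis using z nxt_ge[of z v p] by (intro bexI[of _ z]) auto
    qed
  qed
  then obtain t where t: "0 \<le> t" "t < v" "z \<le> nxt (cell_start t) v p" by auto
  have "path t (v, p) = G (nxt (cell_start t) v p)"
    using t v cell_start_le[of t] by (auto simp: path_eq)
  moreover have "G z \<le> G (nxt (cell_start t) v p)"
    using t z v nxt_le[of "cell_start t" v p] by (intro G_mono) auto
  ultimately show ?thesis using t v by (intro bexI[of _ t]) auto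
qed

text \<open>\<open>G v\<close> is an upper bound because the next point never exceeds
  \<open>v\<close> and \<open>q \<le> G\<close>. The values \<open>G z\<close> for
  \<open>z < v\<close> are reached by \<open>path_sup_ge\<close>, and left continuity closes the
  gap.\<close>

lemma path_sup:
  assumes v: "0 < v" "v < 1" "\<And>x. x \<in> L \<Longrightarrow> v \<noteq> x \<and> v \<noteq> y x" and cont: "(G \<longlongrightarrow> G v) (at_left v)"
  shows "(SUP t\<in>{0..1}. path t (v, p)) = G v"
proof (rule antisym)
  have bdd: "bdd_above ((\<lambda>t. path t (v, p)) ` {0..1})"
    using path_le v by (intro bdd_aboveI[of _ "G v"]) auto
  show "(SUP t\<in>{0..1}. path t (v, p)) \<le> G v"
    using path_le v by (intro cSUP_least) auto
  have "\<forall>\<^sub>F z in at_left v. 0 < z \<and> z < v" using eventually_at_left_Ioo[OF v(1)] by auto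
  then have "\<forall>\<^sub>F z in at_left v. G z \<le> (SUP t\<in>{0..1}. path t (v, p))"
  proof eventually_elim
    case (elim z)
    then obtain t where t: "t \<in> {0..1}" "G z \<le> path t (v, p)" using path_sup_ge[OF v, of z p] by auto
    then show ?case using cSUP_upper[OF t(1) bdd] by simp
  qed
  then show "G v \<le> (SUP t\<in>{0..1}. path t (v, p))"
    by (rule tendsto_upperbound[OF cont]) simp
qed

text \<open>The initial position is almost surely nonnegative and has the same mean as the terminal
  value, which is 0.\<close>

lemma AE_path_zero: "AE \<omega> in base. path 0 \<omega> = 0"
proof -
  have g: "grid (cell_start 0)" by (rule grid_cell_start) simp
  have c0: "cell_start 0 = 0" using cell_start_le[of 0] cell_start_nonneg[of 0] by simp
  have "(\<integral>\<omega>. path 0 \<omega> \<partial>base) = (\<integral>\<omega>\<in>space base. proc 0 \<omega> \<partial>base)"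
    unfolding set_lebesgue_integral_def path_def c0 by (intro Bochner_Integration.integral_cong) auto
  also have "\<dots> = (\<integral>\<omega>\<in>space base. q (fst \<omega>) \<partial>base)"
    using proc_cond[of 0 "space base"] g sets.top[of "hist 0"] unfolding c0 space_hist by simp
  also have "\<dots> = (\<integral>\<omega>. q (fst \<omega>) \<partial>base)"
    unfolding set_lebesgue_integral_def by (intro Bochner_Integration.integral_cong) auto
  finally have i: "(\<integral>\<omega>. path 0 \<omega> \<partial>base) = 0" by (simp add: integral_q_base)
  have nn: "AE \<omega> in base. 0 \<le> path 0 \<omega>"
    using AE_base_fst[OF AE_unif]
  proof eventually_elim
    case (elim \<omega>)
    then show ?case using nxt_ge[of 0 "fst \<omega>" "snd \<omega>"] nxt_le[of 0 "fst \<omega>" "snd \<omega>"]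
      by (cases \<omega>) (auto simp: path_eq c0 intro!: G_nonneg)
  qed
  have "integrable base (path 0)" unfolding path_def[abs_def] using integrable_proc[of 0] g unfolding c0 by simp
  from integral_nonneg_eq_0_iff_AE[OF this nn] i show ?thesis by simp
qed

end

subsection \<open>Martingales closed by their terminal value\<close>

text \<open>On the event that the martingale exceeds \<open>K\<close>, its absolute value is controlled in mean by that
  of its terminal value; a terminal value bounded up to a small error then suffices.\<close>

lemma uniformly_integrable_closed:
  fixes X :: "'i \<Rightarrow> 'a \<Rightarrow> real"
  assumes "prob_space N" and sub: "\<And>i. i \<in> I \<Longrightarrow> subalgebra N (F i)"
    and meas: "\<And>i. i \<in> I \<Longrightarrow> X i \<in> borel_measurable (F i)"
    and int: "\<And>i. i \<in> I \<Longrightarrow> integrable N (X i)" and W: "integrable N W"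
    and closed: "\<And>i A. i \<in> I \<Longrightarrow> A \<in> sets (F i) \<Longrightarrow> (\<integral>\<omega>\<in>A. W \<omega> \<partial>N) = (\<integral>\<omega>\<in>A. X i \<omega> \<partial>N)"
  shows "uniformly_integrable N I X"
  unfolding uniformly_integrable_def
proof (intro conjI ballI allI impI int)
  fix \<epsilon> :: real assume "\<epsilon> > 0"
  interpret prob_space N by fact
  note W_meas [measurable] = borel_measurable_integrable[OF W]
  let ?trunc = "\<lambda>n \<omega>. indicator {\<omega> \<in> space N. real n < \<bar>W \<omega>\<bar>} \<omega> * \<bar>W \<omega>\<bar>"
  have "(\<lambda>n. \<integral>\<omega>. ?trunc n \<omega> \<partial>N) \<longlonglongrightarrow> (\<integral>\<omega>. 0 \<partial>N)"
  proof (rule integral_dominated_convergence[where w = "\<lambda>\<omega>. \<bar>W \<omega>\<bar>"])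
    show "AE \<omega> in N. (\<lambda>n. ?trunc n \<omega>) \<longlonglongrightarrow> 0"
    proof (rule AE_I2)
      fix \<omega>
      obtain m :: nat where "\<bar>W \<omega>\<bar> \<le> real m" using real_arch_simple by blast
      then have "\<forall>\<^sub>F n in sequentially. ?trunc n \<omega> = 0"
        by (intro eventually_sequentiallyI[of m]) (auto simp: indicator_def)
      then show "(\<lambda>n. ?trunc n \<omega>) \<longlonglongrightarrow> 0" by (rule tendsto_eventually)
    qed
    show "AE \<omega> in N. norm (?trunc n \<omega>) \<le> \<bar>W \<omega>\<bar>" for n by (auto simp: indicator_def)
  qed (use W in auto)
  then have "\<forall>\<^sub>F n in sequentially. (\<integral>\<omega>. ?trunc n \<omega> \<partial>N) < \<epsilon> / 2"
    using \<open>\<epsilon> > 0\<close> by (intro order_tendstoD) auto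
  then obtain m :: nat where m: "(\<integral>\<omega>. ?trunc m \<omega> \<partial>N) < \<epsilon> / 2"
    by (auto simp: eventually_sequentially)
  define a where "a = (\<integral>\<omega>. \<bar>W \<omega>\<bar> \<partial>N)"
  have a: "0 \<le> a" by (simp add: a_def)
  define K where "K = 2 * (real m * a) / \<epsilon> + 1"
  have K: "0 < K" using \<open>\<epsilon> > 0\<close> a by (auto simp: K_def intro!: add_nonneg_pos divide_nonneg_pos)
  show "\<exists>K. \<forall>i\<in>I. (\<integral>\<omega>\<in>{\<omega> \<in> space N. \<bar>X i \<omega>\<bar> > K}. \<bar>X i \<omega>\<bar> \<partial>N) \<le> \<epsilon>"
  proof (intro exI ballI)
    fix i assume i: "i \<in> I"
    note [measurable] = borel_measurable_integrable[OF int[OF i]]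
    have sp: "space (F i) = space N" using sub[OF i] by (simp add: subalgebra_def)
    define P where "P = {\<omega> \<in> space N. X i \<omega> > K}"
    define Q where "Q = {\<omega> \<in> space N. X i \<omega> < - K}"
    define E where "E = {\<omega> \<in> space N. \<bar>X i \<omega>\<bar> > K}"
    have PQF: "P \<in> sets (F i)" "Q \<in> sets (F i)"
      using meas[OF i] unfolding P_def Q_def sp[symmetric] by measurable
    have [measurable]: "P \<in> sets N" "Q \<in> sets N" "E \<in> sets N" unfolding P_def Q_def E_def by measurable
    have ind: "indicator E \<omega> = (indicator P \<omega> + indicator Q \<omega> :: real)" for \<omega>
      using K by (auto simp: E_def P_def Q_def indicator_def)
    have intA: "integrable N (\<lambda>\<omega>. indicator A \<omega> * f \<omega>)" if "A \<in> sets N" "integrable N f" for A and f :: "'a \<Rightarrow> real"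
      using integrable_mult_indicator[OF that] by simp
    have "(\<integral>\<omega>\<in>E. \<bar>X i \<omega>\<bar> \<partial>N) = (\<integral>\<omega>. indicator P \<omega> * X i \<omega> - indicator Q \<omega> * X i \<omega> \<partial>N)"
      unfolding set_lebesgue_integral_def using K
      by (intro Bochner_Integration.integral_cong refl) (auto simp: E_def P_def Q_def indicator_def)
    also have "\<dots> = (\<integral>\<omega>\<in>P. X i \<omega> \<partial>N) - (\<integral>\<omega>\<in>Q. X i \<omega> \<partial>N)"
      unfolding set_lebesgue_integral_def using int[OF i] by (simp add: intA)
    also have "\<dots> = (\<integral>\<omega>\<in>P. W \<omega> \<partial>N) - (\<integral>\<omega>\<in>Q. W \<omega> \<partial>N)"
      using closed[OF i] PQF by simp
    also have "\<dots> = (\<integral>\<omega>. indicator P \<omega> * W \<omega> - indicator Q \<omega> * W \<omega> \<partial>N)"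
      unfolding set_lebesgue_integral_def using W by (simp add: intA)
    also have "\<dots> \<le> (\<integral>\<omega>. indicator E \<omega> * \<bar>W \<omega>\<bar> \<partial>N)"
      using W K by (intro integral_mono Bochner_Integration.integrable_diff intA)
        (auto simp: E_def P_def Q_def indicator_def)
    finally have le: "(\<integral>\<omega>\<in>E. \<bar>X i \<omega>\<bar> \<partial>N) \<le> (\<integral>\<omega>. indicator E \<omega> * \<bar>W \<omega>\<bar> \<partial>N)" .
    have "K * prob E = (\<integral>\<omega>. indicator E \<omega> * K \<partial>N)" by (simp add: mult.commute)
    also have "\<dots> \<le> (\<integral>\<omega>. indicator E \<omega> * \<bar>X i \<omega>\<bar> \<partial>N)"
      using int[OF i] by (intro integral_mono intA) (auto simp: E_def indicator_def)
    also have "\<dots> \<le> (\<integral>\<omega>. indicator E \<omega> * \<bar>W \<omega>\<bar> \<partial>N)"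
      using le by (simp add: set_lebesgue_integral_def)
    also have "\<dots> \<le> a" unfolding a_def
      using W by (intro integral_mono intA) (auto simp: indicator_def)
    finally have "prob E \<le> a / K" using K by (simp add: field_simps)
    have i1: "integrable N (?trunc m)" by (rule intA) (use W in auto)
    have i2: "integrable N (\<lambda>\<omega>. indicator E \<omega> * real m)" by (rule intA) auto
    have "(\<integral>\<omega>. indicator E \<omega> * \<bar>W \<omega>\<bar> \<partial>N) \<le> (\<integral>\<omega>. ?trunc m \<omega> + indicator E \<omega> * real m \<partial>N)"
      using W i1 i2 by (intro integral_mono Bochner_Integration.integrable_add intA) (auto simp: E_def indicator_def)
    also have "\<dots> = (\<integral>\<omega>. ?trunc m \<omega> \<partial>N) + real m * prob E"
      by (subst Bochner_Integration.integral_add[OF i1 i2]) (simp add: mult.commute)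
    also have "\<dots> \<le> \<epsilon> / 2 + real m * (a / K)"
      using m \<open>prob E \<le> a / K\<close> by (intro add_mono mult_left_mono) auto
    also have "real m * (a / K) \<le> \<epsilon> / 2"
    proof -
      have "2 * (real m * a) \<le> \<epsilon> * K" using \<open>\<epsilon> > 0\<close> by (simp add: K_def field_simps)
      then show ?thesis using K by (simp add: field_simps)
    qed
    finally have "(\<integral>\<omega>. indicator E \<omega> * \<bar>W \<omega>\<bar> \<partial>N) \<le> \<epsilon>" by simp
    with le show "(\<integral>\<omega>\<in>{\<omega> \<in> space N. \<bar>X i \<omega>\<bar> > K}. \<bar>X i \<omega>\<bar> \<partial>N) \<le> \<epsilon>" by (simp add: E_def)
  qed
qed

text \<open>Equality of set integrals with the terminal value yields both the martingale property
  and uniform integrability: a set known at time \<open>s\<close> is also known at time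
  \<open>t\<close>, so the integrals of \<open>X s\<close> and \<open>X t\<close> over it both equal
  that of \<open>X T\<close>.\<close>

lemma admissible_closed:
  assumes "prob_space N" and T: "0 \<le> T" and filt: "filtration_upto T N \<F>"
    and meas: "\<And>t. t \<in> {0..T} \<Longrightarrow> X t \<in> borel_measurable (\<F> t)"
    and int: "\<And>t. t \<in> {0..T} \<Longrightarrow> integrable N (X t)"
    and closed: "\<And>t A. t \<in> {0..T} \<Longrightarrow> A \<in> sets (\<F> t) \<Longrightarrow> (\<integral>\<omega>\<in>A. X T \<omega> \<partial>N) = (\<integral>\<omega>\<in>A. X t \<omega> \<partial>N)"
    and "\<And>\<omega>. \<omega> \<in> space N \<Longrightarrow> cadlag_on T (\<lambda>t. X t \<omega>)"
    and "AE \<omega> in N. X 0 \<omega> = 0" and "distr N borel (X T) = \<mu>"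
  shows "admissible T \<mu> N \<F> X"
proof -
  interpret prob_space N by fact
  have sub: "subalgebra N (\<F> t)" if "t \<in> {0..T}" for t
    using filt that unfolding filtration_upto_def by blast
  have "AE \<omega> in N. real_cond_exp N (\<F> s) (X t) \<omega> = X s \<omega>"
    if st: "s \<in> {0..T}" "t \<in> {0..T}" "s \<le> t" for s t
  proof -
    interpret finite_measure_subalgebra N "\<F> s" by unfold_locales (rule sub[OF st(1)])
    show ?thesis
    proof (rule real_cond_exp_charact)
      fix A assume A: "A \<in> sets (\<F> s)"
      have "subalgebra (\<F> t) (\<F> s)" using filt st unfolding filtration_upto_def by blast
      then have "A \<in> sets (\<F> t)" using A unfolding subalgebra_def by blast
      then show "(\<integral>\<omega>\<in>A. X t \<omega> \<partial>N) = (\<integral>\<omega>\<in>A. X s \<omega> \<partial>N)"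
        using closed[OF st(1) A] closed[OF st(2)] by simp
    qed (fact int[OF st(2)] int[OF st(1)] meas[OF st(1)])+
  qed
  moreover have "uniformly_integrable N {0..T} X"
    by (rule uniformly_integrable_closed[OF prob_space_axioms sub meas int int[of T] closed]) (use T in simp_all)
  ultimately show ?thesis using assms unfolding admissible_def martingale_upto_def by blast
qed

section \<open>Transport of the construction to a prescribed sample space\<close>

lemma inj_sequence_to_real: "\<exists>e :: (nat \<Rightarrow> real) \<Rightarrow> real. inj e"
proof -
  obtain f :: "nat set \<Rightarrow> real" where f: "bij f"
    using nat_sets_eqpoll_reals unfolding eqpoll_def by blast
  \<comment> \<open>Each term of the sequence becomes a set of naturals; pairing merges the sequence
    of sets into one set.\<close>
  define e where "e u = f {prod_encode (n, m) | n m. m \<in> inv f (u n)}" for u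
  have "u = u'" if "e u = e u'" for u u'
  proof
    fix n
    have "{prod_encode (n, m) | n m. m \<in> inv f (u n)} = {prod_encode (n, m) | n m. m \<in> inv f (u' n)}"
      using that f by (auto simp: e_def bij_def inj_eq)
    then have "m \<in> inv f (u n) \<longleftrightarrow> m \<in> inv f (u' n)" for m
      by (auto simp: set_eq_iff dest!: spec[of _ "prod_encode (n, m)"])
    then have "inv f (u n) = inv f (u' n)" by auto
    then show "u n = u' n" using f by (metis bij_inv_eq_iff)
  qed
  then show ?thesis by (auto simp: inj_def)
qed

lemma subalgebra_embed:
  assumes "subalgebra N F" "inj_on f (space N)"
  shows "subalgebra (embed_measure N f) (embed_measure F f)"
proof -
  have "space F = space N" "sets F \<subseteq> sets N" using assms(1) by (simp_all add: subalgebra_def)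
  moreover have "inj_on f (space F)" using assms(2) \<open>space F = space N\<close> by simp
  ultimately show ?thesis unfolding subalgebra_def space_embed_measure
    using sets_embed_measure'[OF assms(2)] sets_embed_measure'[of f F] by auto
qed

text \<open>\<open>embed_measure\<close> takes the images of the measurable sets as its
  sigma-algebra, so any injection transports the filtration, the integrals and the paths
  together.\<close>

lemma admissible_embed:
  assumes inj: "inj_on f (space N)" and "prob_space N" and T: "0 \<le> T" and filt: "filtration_upto T N \<F>"
    and meas: "\<And>t. t \<in> {0..T} \<Longrightarrow> X t \<in> borel_measurable (\<F> t)"
    and int: "\<And>t. t \<in> {0..T} \<Longrightarrow> integrable N (X t)"
    and closed: "\<And>t A. t \<in> {0..T} \<Longrightarrow> A \<in> sets (\<F> t) \<Longrightarrow> (\<integral>\<omega>\<in>A. X T \<omega> \<partial>N) = (\<integral>\<omega>\<in>A. X t \<omega> \<partial>N)"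
    and cadlag: "\<And>\<omega>. \<omega> \<in> space N \<Longrightarrow> cadlag_on T (\<lambda>t. X t \<omega>)"
    and zero: "AE \<omega> in N. X 0 \<omega> = 0" and law: "distr N borel (X T) = \<mu>"
  defines "N' \<equiv> embed_measure N f" and "Y \<equiv> \<lambda>t w. X t (the_inv_into (space N) f w)"
  shows "admissible T \<mu> N' (\<lambda>t. embed_measure (\<F> t) f) Y"
proof (rule admissible_closed[OF _ T])
  have sub: "subalgebra N (\<F> t)" if "t \<in> {0..T}" for t
    using filt that unfolding filtration_upto_def by blast
  have sp: "space (\<F> t) = space N" if "t \<in> {0..T}" for t
    using sub[OF that] by (simp add: subalgebra_def)
  have f_meas: "f \<in> N \<rightarrow>\<^sub>M N'" unfolding N'_def by (rule measurable_embed_measure2'[OF inj])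
  have N'_distr: "N' = distr N N' f" unfolding N'_def by (rule embed_measure_eq_distr'[OF inj])
  have Yf: "Y t (f \<omega>) = X t \<omega>" if "\<omega> \<in> space N" for t \<omega>
    using that by (simp add: Y_def the_inv_into_f_f[OF inj])
  show "prob_space N'"
    using prob_space.prob_space_distr[OF \<open>prob_space N\<close> f_meas] unfolding N'_distr[symmetric] .
  show "filtration_upto T N' (\<lambda>t. embed_measure (\<F> t) f)"
    unfolding filtration_upto_def N'_def
  proof (intro conjI ballI impI)
    fix t assume "t \<in> {0..T}"
    then show "subalgebra (embed_measure N f) (embed_measure (\<F> t) f)"
      by (intro subalgebra_embed sub inj)
  next
    fix s t assume st: "s \<in> {0..T}" "t \<in> {0..T}" "s \<le> t"
    then show "subalgebra (embed_measure (\<F> t) f) (embed_measure (\<F> s) f)"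
      using filt inj unfolding filtration_upto_def by (intro subalgebra_embed) (simp_all add: sp)
  qed
  show Y_meas: "Y t \<in> borel_measurable (embed_measure (\<F> t) f)" if t: "t \<in> {0..T}" for t
  proof (rule measurable_embed_measure1)
    show "(\<lambda>\<omega>. Y t (f \<omega>)) \<in> borel_measurable (\<F> t)"
      using meas[OF t] by (rule measurable_cong[THEN iffD1, rotated]) (simp add: Yf sp[OF t])
  qed
  have Y_meas': "Y t \<in> borel_measurable N'" if t: "t \<in> {0..T}" for t
    using Y_meas[OF t] subalgebra_embed[OF sub[OF t] inj] unfolding N'_def by (rule measurable_from_subalg[rotated])
  show "integrable N' (Y t)" if t: "t \<in> {0..T}" for t
  proof -
    have "integrable (distr N N' f) (Y t) \<longleftrightarrow> integrable N (\<lambda>\<omega>. Y t (f \<omega>))"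
      by (rule integrable_distr_eq[OF f_meas Y_meas'[OF t]])
    also have "\<dots> \<longleftrightarrow> integrable N (X t)"
      by (rule Bochner_Integration.integrable_cong) (auto simp: Yf)
    finally show ?thesis using int[OF t] unfolding N'_distr[symmetric] by simp
  qed
  show "(\<integral>w\<in>A. Y T w \<partial>N') = (\<integral>w\<in>A. Y t w \<partial>N')"
    if t: "t \<in> {0..T}" and A: "A \<in> sets (embed_measure (\<F> t) f)" for t A
  proof -
    obtain B where B: "A = f ` B" "B \<in> sets (\<F> t)"
      using A sets_embed_measure'[of f "\<F> t"] inj by (auto simp: sp[OF t])
    have BN: "B \<subseteq> space N" using sets.sets_into_space[OF B(2)] sp[OF t] by simp
    have A': "A \<in> sets N'" using A subalgebra_embed[OF sub[OF t] inj] by (auto simp: N'_def subalgebra_def)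
    have *: "(\<integral>w\<in>A. Y r w \<partial>N') = (\<integral>\<omega>\<in>B. X r \<omega> \<partial>N)" if r: "r \<in> {0..T}" for r
    proof -
      have [measurable]: "Y r \<in> borel_measurable N'" "A \<in> sets N'" by (fact Y_meas'[OF r] A')+
      have "(\<integral>w\<in>A. Y r w \<partial>N') = (\<integral>w. indicator A w *\<^sub>R Y r w \<partial>distr N N' f)"
        unfolding set_lebesgue_integral_def N'_distr[symmetric] ..
      also have "\<dots> = (\<integral>\<omega>. indicator A (f \<omega>) *\<^sub>R Y r (f \<omega>) \<partial>N)"
        by (rule integral_distr[OF f_meas]) measurable
      also have "\<dots> = (\<integral>\<omega>\<in>B. X r \<omega> \<partial>N)"
        unfolding set_lebesgue_integral_def
      proof (rule Bochner_Integration.integral_cong[OF refl])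
        fix \<omega> assume \<omega>: "\<omega> \<in> space N"
        have "f \<omega> \<in> A \<longleftrightarrow> \<omega> \<in> B" using \<omega> BN inj B(1) by (auto simp: inj_on_def)
        then show "indicator A (f \<omega>) *\<^sub>R Y r (f \<omega>) = indicator B \<omega> *\<^sub>R X r \<omega>"
          using Yf[OF \<omega>] by (simp add: indicator_def)
      qed
      finally show ?thesis .
    qed
    show ?thesis using *[OF t] *[of T] T closed[OF t B(2)] by simp
  qed
  show "cadlag_on T (\<lambda>t. Y t w)" if "w \<in> space N'" for w
    using that cadlag Yf by (auto simp: N'_def space_embed_measure)
  show "AE w in N'. Y 0 w = 0"
    unfolding N'_def AE_embed_measure'[OF inj] using zero Yf
    by (auto elim!: AE_mp intro!: AE_I2)
  have "distr N' borel (Y T) = distr N borel (Y T \<circ> f)"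
    using distr_distr[OF Y_meas' f_meas, of T] T unfolding N'_distr[symmetric] by simp
  also have "\<dots> = distr N borel (X T)"
    by (rule distr_cong) (auto simp: Yf)
  finally show "distr N' borel (Y T) = \<mu>" using law by simp
qed

section \<open>Cadlag paths: change of time scale, boundedness, measurability of the maximum\<close>

lemma cadlag_on_scale:
  assumes T: "0 < T" and c: "cadlag_on 1 x"
  shows "cadlag_on T (\<lambda>t. x (t / T))"
proof -
  have right: "filterlim (\<lambda>u. u / T) (at_right (t / T)) (at_right t)" for t
    unfolding filterlim_at
  proof
    show "\<forall>\<^sub>F u in at_right t. u / T \<in> {t / T<..} \<and> u / T \<noteq> t / T"
      using eventually_at_right_less[of t] by eventually_elim (use T in \<open>auto simp: divide_strict_right_mono\<close>)
    show "((\<lambda>u. u / T) \<longlongrightarrow> t / T) (at_right t)" by (intro tendsto_intros) (use T in auto)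
  qed
  have left: "filterlim (\<lambda>u. u / T) (at_left (t / T)) (at_left t)" for t
    unfolding filterlim_at
  proof
    have "\<forall>\<^sub>F u in at_left t. u < t" by (simp add: eventually_at_filter)
    then show "\<forall>\<^sub>F u in at_left t. u / T \<in> {..<t / T} \<and> u / T \<noteq> t / T"
      by eventually_elim (use T in \<open>auto simp: divide_strict_right_mono\<close>)
    show "((\<lambda>u. u / T) \<longlongrightarrow> t / T) (at_left t)" by (intro tendsto_intros) (use T in auto)
  qed
  show ?thesis unfolding cadlag_on_def
  proof (intro conjI ballI)
    fix t assume "t \<in> {0..<T}"
    then have "t / T \<in> {0..<1}" using T by auto
    then have "(x \<longlongrightarrow> x (t / T)) (at_right (t / T))" using c by (simp add: cadlag_on_def)
    then show "((\<lambda>t. x (t / T)) \<longlongrightarrow> x (t / T)) (at_right t)"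
      by (rule filterlim_compose[OF _ right])
  next
    fix t assume "t \<in> {0<..T}"
    then have "t / T \<in> {0<..1}" using T by auto
    then obtain l where "(x \<longlongrightarrow> l) (at_left (t / T))" using c unfolding cadlag_on_def by blast
    from filterlim_compose[OF this left] show "\<exists>l. ((\<lambda>t. x (t / T)) \<longlongrightarrow> l) (at_left t)" by (rule exI)
  qed
qed

text \<open>The one-sided limits bound the path near every time, and compactness of the time
  interval makes the bound global.\<close>

lemma cadlag_on_bdd_above:
  assumes "cadlag_on T x"
  shows "bdd_above (x ` {0..T})"
proof -
  have loc: "\<exists>U B. open U \<and> t \<in> U \<and> (\<forall>u\<in>U \<inter> {0..T}. x u \<le> B)" if t: "t \<in> {0..T}" for t
  proof -
    have r: "\<exists>c>t. \<exists>B. \<forall>u. t < u \<longrightarrow> u < c \<longrightarrow> u \<in> {0..T} \<longrightarrow> x u \<le> B"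
    proof (cases "t < T")
      case True
      then have "(x \<longlongrightarrow> x t) (at_right t)" using assms t by (simp add: cadlag_on_def)
      then have "\<forall>\<^sub>F u in at_right t. x u < x t + 1" by (rule order_tendstoD) simp
      then show ?thesis unfolding eventually_at_right_field by (meson less_imp_le)
    next
      case False
      then show ?thesis using t by (intro exI[of _ "t + 1"]) auto
    qed
    have l: "\<exists>c<t. \<exists>B. \<forall>u. c < u \<longrightarrow> u < t \<longrightarrow> u \<in> {0..T} \<longrightarrow> x u \<le> B"
    proof (cases "0 < t")
      case True
      then obtain l where "(x \<longlongrightarrow> l) (at_left t)" using assms t unfolding cadlag_on_def by fastforce
      then have "\<forall>\<^sub>F u in at_left t. x u < l + 1" by (rule order_tendstoD) simp
      then show ?thesis unfolding eventually_at_left_field by (meson less_imp_le)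
    next
      case False
      then show ?thesis using t by (intro exI[of _ "t - 1"]) auto
    qed
    from r obtain c B where cB: "t < c" "\<And>u. t < u \<Longrightarrow> u < c \<Longrightarrow> u \<in> {0..T} \<Longrightarrow> x u \<le> B" by blast
    from l obtain c' B' where cB': "c' < t" "\<And>u. c' < u \<Longrightarrow> u < t \<Longrightarrow> u \<in> {0..T} \<Longrightarrow> x u \<le> B'" by blast
    have "x u \<le> max (x t) (max B B')" if "u \<in> {c'<..<c} \<inter> {0..T}" for u
      using that cB(2)[of u] cB'(2)[of u] by (cases u t rule: linorder_cases) (auto simp: le_max_iff_disj)
    then show ?thesis using cB(1) cB'(1) by (intro exI[of _ "{c'<..<c}"] exI[of _ "max (x t) (max B B')"]) auto
  qed
  then obtain U B where U: "\<And>t. t \<in> {0..T} \<Longrightarrow> open (U t) \<and> t \<in> U t \<and> (\<forall>u\<in>U t \<inter> {0..T}. x u \<le> B t)"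
    by metis
  obtain D where D: "D \<subseteq> {0..T}" "finite D" "{0..T} \<subseteq> (\<Union>t\<in>D. U t)"
    by (rule compactE_image[of "{0..T}" "{0..T}" U]) (use U in auto)
  show ?thesis
  proof (rule bdd_aboveI)
    fix z assume "z \<in> x ` {0..T}"
    then obtain u where u: "u \<in> {0..T}" "z = x u" by auto
    then obtain t where t: "t \<in> D" "u \<in> U t" using D(3) by auto
    then have "z \<le> B t" using U[of t] D(1) u by auto
    also have "\<dots> \<le> Max (B ` D)" using t D(2) by auto
    finally show "z \<le> Max (B ` D)" .
  qed
qed

text \<open>The last time is adjoined because right continuity recovers the value at every time but
  this one; a jump at \<open>T\<close> would otherwise be missed when \<open>T\<close> is
  irrational.\<close>

definition dense_times :: "real \<Rightarrow> real set" where
  "dense_times T = insert T ({0..T} \<inter> \<rat>)"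

lemma countable_dense_times: "countable (dense_times T)"
  unfolding dense_times_def by (intro countable_insert countable_Int2 countable_rat)

lemma running_max_dense:
  assumes T: "0 < T" and c: "cadlag_on T (\<lambda>t. X t \<omega>)"
  shows "running_max T X \<omega> = (SUP t\<in>dense_times T. X t \<omega>)"
proof -
  have sub: "dense_times T \<subseteq> {0..T}" using T by (auto simp: dense_times_def)
  have bdd: "bdd_above ((\<lambda>t. X t \<omega>) ` {0..T})" by (rule cadlag_on_bdd_above[OF c])
  have bdd': "bdd_above ((\<lambda>t. X t \<omega>) ` dense_times T)" using bdd image_mono[OF sub] by (rule bdd_above_mono)
  have "X t \<omega> \<le> (SUP t\<in>dense_times T. X t \<omega>)" if t: "t \<in> {0..T}" for t
  proof (cases "t = T")
    case True
    then show ?thesis by (intro cSUP_upper bdd') (simp add: dense_times_def)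
  next
    case False
    show ?thesis
    proof (rule ccontr)
      assume "\<not> ?thesis"
      moreover have "((\<lambda>t. X t \<omega>) \<longlongrightarrow> X t \<omega>) (at_right t)" using c t False by (simp add: cadlag_on_def)
      ultimately have "\<forall>\<^sub>F u in at_right t. (SUP t\<in>dense_times T. X t \<omega>) < X u \<omega>"
        by (intro order_tendstoD) auto
      then obtain z where z: "t < z" "\<And>u. t < u \<Longrightarrow> u < z \<Longrightarrow> (SUP t\<in>dense_times T. X t \<omega>) < X u \<omega>"
        unfolding eventually_at_right_field by blast
      obtain r where r: "r \<in> \<rat>" "t < r" "r < min z T"
        using Rats_dense_in_real[of t "min z T"] z t False by auto
      then have "r \<in> dense_times T" using t by (auto simp: dense_times_def)
      then have "X r \<omega> \<le> (SUP t\<in>dense_times T. X t \<omega>)" by (rule cSUP_upper[OF _ bdd'])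
      with z(2)[of r] r show False by auto
    qed
  qed
  then have "running_max T X \<omega> \<le> (SUP t\<in>dense_times T. X t \<omega>)"
    unfolding running_max_def using T by (intro cSUP_least) auto
  moreover have "(SUP t\<in>dense_times T. X t \<omega>) \<le> running_max T X \<omega>"
    unfolding running_max_def by (rule cSUP_subset_mono[OF _ bdd sub]) (auto simp: dense_times_def)
  ultimately show ?thesis by simp
qed

lemma running_max_measurable:
  assumes T: "0 < T" and c: "\<And>\<omega>. \<omega> \<in> space N \<Longrightarrow> cadlag_on T (\<lambda>t. X t \<omega>)"
    and X: "\<And>t. t \<in> {0..T} \<Longrightarrow> X t \<in> borel_measurable N"
  shows "running_max T X \<in> borel_measurable N"
proof -
  have sub: "dense_times T \<subseteq> {0..T}" using T by (auto simp: dense_times_def)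
  have "(\<lambda>\<omega>. SUP t\<in>dense_times T. X t \<omega>) \<in> borel_measurable N"
  proof (rule borel_measurable_cSUP[OF countable_dense_times])
    fix \<omega> assume "\<omega> \<in> space N"
    then show "bdd_above ((\<lambda>t. X t \<omega>) ` dense_times T)"
      using bdd_above_mono[OF cadlag_on_bdd_above[OF c] image_mono[OF sub]] by simp
  qed (use X sub in blast)
  then show ?thesis
    by (rule measurable_cong[THEN iffD1, rotated]) (simp add: running_max_dense[OF T c])
qed

section \<open>The process in quantile coordinates, carried to the plane\<close>

context tail_bounded begin

text \<open>The enumeration of \<open>L\<close> may repeat elements when \<open>L\<close> is finite;
  injectivity needs only that it reaches all of \<open>L\<close>, because off \<open>L\<close> the
  functions in the sample space all take the same value.\<close>

definition to_plane :: "real \<times> (real \<Rightarrow> real) \<Rightarrow> real \<times> real" where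
  "to_plane = (\<lambda>(v, p). (v, (SOME e :: (nat \<Rightarrow> real) \<Rightarrow> real. inj e) (\<lambda>n. p (from_nat_into L n))))"

lemma inj_to_plane: "inj_on to_plane (space base)"
proof (rule inj_onI)
  fix \<omega> \<omega>' assume sp: "\<omega> \<in> space base" "\<omega>' \<in> space base" and eq: "to_plane \<omega> = to_plane \<omega>'"
  obtain v p v' p' where vp: "\<omega> = (v, p)" "\<omega>' = (v', p')" by (cases \<omega>, cases \<omega>')
  have "inj (SOME e :: (nat \<Rightarrow> real) \<Rightarrow> real. inj e)" by (rule someI_ex[OF inj_sequence_to_real])
  then have v: "v = v'" and p: "(\<lambda>n. p (from_nat_into L n)) = (\<lambda>n. p' (from_nat_into L n))"
    using eq by (auto simp: to_plane_def vp inj_eq)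
  have "p x = p' x" for x
  proof (cases "x \<in> L")
    case True
    then obtain n where "x = from_nat_into L n" using from_nat_into_surj[OF countable_L True] by metis
    then show ?thesis using fun_cong[OF p, of n] by simp
  next
    case False
    then show ?thesis using sp by (auto simp: vp space_base PiE_def extensional_def)
  qed
  then show "\<omega> = \<omega>'" using v by (auto simp: vp)
qed

theorem ex_admissible:
  assumes T: "0 < T" and law: "distr unif borel q = \<mu>"
    and left: "AE v in unif. (G \<longlongrightarrow> G v) (at_left v)"
  shows "\<exists>(N :: (real \<times> real) measure) \<F> M. admissible T \<mu> N \<F> M \<and>
    terminal_max_law T N M = distr unif (borel \<Otimes>\<^sub>M borel) (\<lambda>v. (q v, G v))"
proof -
  interpret pair_prob_space unif decoys by (rule pair_prob_base)
  define X where "X t \<omega> = path (t / T) \<omega>" for t \<omega>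
  define \<F> where "\<F> t = hist (cell_start (t / T))" for t
  have g: "grid (cell_start (t / T))" if "t \<in> {0..T}" for t
    using that T by (intro grid_cell_start) auto
  have XT: "X T \<omega> = q (fst \<omega>)" for \<omega> using T by (simp add: X_def path_one)
  have X_eq: "X t = proc (cell_start (t / T))" for t by (simp add: X_def path_def fun_eq_iff)
  have base_fst: "distr base unif fst = unif" by (simp add: base_def M2.distr_pair_fst)
  have fst_meas: "fst \<in> base \<rightarrow>\<^sub>M unif" by (simp add: base_def)
  have filt: "filtration_upto T base \<F>"
    unfolding filtration_upto_def \<F>_def
    using subalgebra_base_hist subalgebra_hist g cell_start_mono T by (simp add: divide_right_mono)
  have meas: "X t \<in> borel_measurable (\<F> t)" for t
    unfolding X_eq \<F>_def by (rule proc_measurable_hist)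
  have int: "integrable base (X t)" if "t \<in> {0..T}" for t
    unfolding X_eq by (rule integrable_proc[OF g[OF that]])
  have closed: "(\<integral>\<omega>\<in>A. X T \<omega> \<partial>base) = (\<integral>\<omega>\<in>A. X t \<omega> \<partial>base)"
    if "t \<in> {0..T}" "A \<in> sets (\<F> t)" for t A
    using proc_cond[OF g[OF that(1)]] that(2) by (simp add: XT X_eq[of t] \<F>_def)
  have cadlag: "cadlag_on T (\<lambda>t. X t \<omega>)" for \<omega>
    unfolding X_def by (rule cadlag_on_scale[OF T cadlag_path])
  have zero: "AE \<omega> in base. X 0 \<omega> = 0" using AE_path_zero by (simp add: X_def)
  have "distr base borel (X T) = distr (distr base unif fst) borel q"
    by (subst distr_distr) (auto simp: XT[abs_def] comp_def base_def)
  then have law': "distr base borel (X T) = \<mu>" unfolding base_fst law .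
  let ?N = "embed_measure base to_plane"
  define Y where "Y = (\<lambda>t w. X t (the_inv_into (space base) to_plane w))"
  have adm: "admissible T \<mu> ?N (\<lambda>t. embed_measure (\<F> t) to_plane) Y"
    unfolding Y_def
    by (rule admissible_embed[OF inj_to_plane prob_space_base _ filt meas int closed cadlag zero law']) (use T in auto)
  have Yf: "Y t (to_plane \<omega>) = X t \<omega>" if "\<omega> \<in> space base" for t \<omega>
    using that by (simp add: Y_def the_inv_into_f_f[OF inj_to_plane])
  have max: "AE \<omega> in base. running_max T X \<omega> = G (fst \<omega>)"
  proof -
    have "AE v in unif. \<forall>x\<in>L. v \<noteq> x \<and> v \<noteq> y x"
      using countable_L AE_unif_neq by (subst AE_ball_countable) (auto intro: AE_conjI)
    with left AE_unif have "AE v in unif. 0 < v \<and> v < 1 \<and> (\<forall>x\<in>L. v \<noteq> x \<and> v \<noteq> y x) \<and> (G \<longlongrightarrow> G v) (at_left v)"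
      by eventually_elim auto
    from AE_base_fst[OF this] show ?thesis
    proof eventually_elim
      case (elim \<omega>)
      obtain v p where vp: "\<omega> = (v, p)" by (cases \<omega>)
      have unit: "(\<lambda>t. t / T) ` {0..T} = {0..1}"
      proof (intro equalityI subsetI)
        fix u :: real assume "u \<in> {0..1}"
        then show "u \<in> (\<lambda>t. t / T) ` {0..T}" using T by (intro image_eqI[of _ _ "u * T"]) (auto simp: mult_left_le_one_le)
      qed (use T in auto)
      have "(\<lambda>t. path (t / T) \<omega>) ` {0..T} = (\<lambda>t. path t \<omega>) ` {0..1}"
        unfolding unit[symmetric] image_image ..
      then have "running_max T X \<omega> = (SUP t\<in>{0..1}. path t \<omega>)" by (simp add: running_max_def X_def)
      also have "\<dots> = G v" unfolding vp using elim by (intro path_sup) (auto simp: vp)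
      finally show ?case by (simp add: vp)
    qed
  qed
  have fm: "to_plane \<in> base \<rightarrow>\<^sub>M ?N" by (rule measurable_embed_measure2'[OF inj_to_plane])
  have Y_meas: "Y t \<in> borel_measurable ?N" if "t \<in> {0..T}" for t
    using adm that by (auto simp: admissible_def martingale_upto_def)
  have Y_max: "running_max T Y \<in> borel_measurable ?N"
    by (rule running_max_measurable[OF T _ Y_meas]) (use adm in \<open>auto simp: admissible_def\<close>)
  have X_max: "running_max T X \<in> borel_measurable base"
    by (rule running_max_measurable[OF T cadlag]) (use int in auto)
  have "terminal_max_law T ?N Y = distr (distr base ?N to_plane) (borel \<Otimes>\<^sub>M borel) (\<lambda>w. (Y T w, running_max T Y w))"
    unfolding terminal_max_law_def using embed_measure_eq_distr'[OF inj_to_plane] by simp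
  also have "\<dots> = distr base (borel \<Otimes>\<^sub>M borel) ((\<lambda>w. (Y T w, running_max T Y w)) \<circ> to_plane)"
    using Y_meas[of T] Y_max T fm by (intro distr_distr) auto
  also have "\<dots> = distr base (borel \<Otimes>\<^sub>M borel) (\<lambda>\<omega>. (X T \<omega>, running_max T X \<omega>))"
    by (intro distr_cong) (auto simp: Yf running_max_def)
  also have "\<dots> = distr base (borel \<Otimes>\<^sub>M borel) (\<lambda>\<omega>. (q (fst \<omega>), G (fst \<omega>)))"
  proof (rule distr_cong_AE)
    show "AE \<omega> in base. (X T \<omega>, running_max T X \<omega>) = (q (fst \<omega>), G (fst \<omega>))"
      using max by eventually_elim (simp add: XT)
    show "(\<lambda>\<omega>. (X T \<omega>, running_max T X \<omega>)) \<in> base \<rightarrow>\<^sub>M borel \<Otimes>\<^sub>M borel"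
      using int[of T] X_max T by (intro measurable_Pair) auto
    show "(\<lambda>\<omega>. (q (fst \<omega>), G (fst \<omega>))) \<in> base \<rightarrow>\<^sub>M borel \<Otimes>\<^sub>M borel"
      unfolding base_def by measurable
  qed auto
  also have "\<dots> = distr (distr base unif fst) (borel \<Otimes>\<^sub>M borel) (\<lambda>v. (q v, G v))"
    by (subst distr_distr) (auto simp: comp_def base_def)
  finally show ?thesis unfolding base_fst using adm by blast
qed

end

subsection \<open>Dyadic cells\<close>

definition dyad :: "nat \<Rightarrow> real \<Rightarrow> real" where
  "dyad n v = real_of_int \<lfloor>2 ^ n * v\<rfloor> / 2 ^ n"

lemma dyad_le: "dyad n v \<le> v" "v < dyad n v + 1 / 2 ^ n"
proof -
  have "real_of_int \<lfloor>2 ^ n * v\<rfloor> \<le> 2 ^ n * v" "2 ^ n * v < real_of_int \<lfloor>2 ^ n * v\<rfloor> + 1" by linarith+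
  then show "dyad n v \<le> v" "v < dyad n v + 1 / 2 ^ n" by (simp_all add: dyad_def field_simps)
qed

lemma dyad_same:
  assumes "dyad n v \<le> w" "w < dyad n v + 1 / 2 ^ n"
  shows "dyad n w = dyad n v"
proof -
  have "real_of_int \<lfloor>2 ^ n * v\<rfloor> \<le> 2 ^ n * w" "2 ^ n * w < real_of_int \<lfloor>2 ^ n * v\<rfloor> + 1"
    using assms by (simp_all add: dyad_def field_simps)
  then have "\<lfloor>2 ^ n * w\<rfloor> = \<lfloor>2 ^ n * v\<rfloor>" by linarith
  then show ?thesis by (simp add: dyad_def)
qed

text \<open>Integer division recovers the coarser floor from the finer one, so dyadic intervals are
  nested or disjoint.\<close>

lemma dyad_coarser:
  assumes "dyad m v = dyad m w" "n \<le> m"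
  shows "dyad n v = dyad n w"
proof -
  have "\<lfloor>2 ^ n * u\<rfloor> = \<lfloor>2 ^ m * u\<rfloor> div 2 ^ (m - n)" for u :: real
  proof -
    obtain k where m: "m = n + k" using \<open>n \<le> m\<close> le_Suc_ex by blast
    have "2 ^ n * u = 2 ^ m * u / real_of_int (2 ^ k)"
      by (simp add: m power_add)
    moreover have "\<lfloor>2 ^ m * u / real_of_int (2 ^ k)\<rfloor> = \<lfloor>2 ^ m * u\<rfloor> div 2 ^ k"
      by (rule floor_divide_real_eq_div) simp
    ultimately show ?thesis by (simp add: m)
  qed
  moreover have "\<lfloor>2 ^ m * v\<rfloor> = \<lfloor>2 ^ m * w\<rfloor>" using assms(1) by (simp add: dyad_def)
  ultimately show ?thesis by (simp add: dyad_def)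
qed

text \<open>The cells are the maximal dyadic intervals that end before 1 and on which
  \<open>G\<close> stays below \<open>b\<close> at the left end; maximality makes them disjoint.
  Where \<open>G v < b v\<close>, right continuity of \<open>G\<close>, its monotonicity to the left
  of \<open>v\<close> and continuity of \<open>b\<close> make every short dyadic interval around
  \<open>v\<close> qualify, so outside the cells \<open>G = b\<close>.\<close>

lemma ex_cell_decomposition:
  fixes G b :: "real \<Rightarrow> real"
  assumes mono: "\<And>u v. 0 \<le> u \<Longrightarrow> u \<le> v \<Longrightarrow> v < 1 \<Longrightarrow> G u \<le> G v"
    and right: "\<And>v. 0 \<le> v \<Longrightarrow> v < 1 \<Longrightarrow> (G \<longlongrightarrow> G v) (at_right v)"
    and cont: "continuous_on {0..<1} b"
    and le: "\<And>v. 0 \<le> v \<Longrightarrow> v < 1 \<Longrightarrow> G v \<le> b v"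
  shows "\<exists>L y. cell_decomposition L y
    \<and> (\<forall>x\<in>L. \<forall>v. x \<le> v \<longrightarrow> v < y x \<longrightarrow> G v \<le> b x)
    \<and> (\<forall>v. 0 \<le> v \<longrightarrow> v < 1 \<longrightarrow> (\<forall>x\<in>L. \<not> (x \<le> v \<and> v < y x)) \<longrightarrow> G v = b v)"
proof -
  define good where "good n v \<longleftrightarrow> dyad n v + 1 / 2 ^ n < 1
    \<and> (\<forall>w. dyad n v \<le> w \<longrightarrow> w < dyad n v + 1 / 2 ^ n \<longrightarrow> G w \<le> b (dyad n v))" for n v
  define D where "D = {v. 0 \<le> v \<and> v < 1 \<and> (\<exists>n. good n v)}"
  define r where "r v = (LEAST n. good n v)" for v
  define X where "X v = dyad (r v) v" for v
  define Y where "Y v = dyad (r v) v + 1 / 2 ^ r v" for v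
  have r: "good (r v) v" if "v \<in> D" for v
    unfolding r_def using that by (auto simp: D_def intro: LeastI_ex)
  have r_le: "r v \<le> n" if "good n v" for n v
    using that unfolding r_def by (rule Least_le)
  have cong: "good n v \<longleftrightarrow> good n w" if "dyad n v = dyad n w" for n v w
    by (simp add: good_def that)
  have XY: "X v \<le> v" "v < Y v" for v by (simp_all add: X_def Y_def dyad_le)
  have overlap_aux: "r v = r w \<and> X v = X w"
    if "v \<in> D" "w \<in> D" "X v \<le> z" "z < Y v" "X w \<le> z" "z < Y w" "r v \<le> r w" for v w z
  proof -
    have "dyad (r v) z = dyad (r v) v" "dyad (r w) z = dyad (r w) w"
      using that by (auto simp: X_def Y_def intro: dyad_same)
    moreover have "dyad (r v) z = dyad (r v) w"
      using dyad_coarser[OF \<open>dyad (r w) z = dyad (r w) w\<close> \<open>r v \<le> r w\<close>] .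
    ultimately have "good (r v) w" using r[OF \<open>v \<in> D\<close>] cong by metis
    then have "r v = r w" using r_le that(7) by (simp add: le_antisym)
    then show ?thesis using \<open>dyad (r v) z = dyad (r v) v\<close> \<open>dyad (r w) z = dyad (r w) w\<close> by (simp add: X_def)
  qed
  have overlap: "r v = r w \<and> X v = X w"
    if "v \<in> D" "w \<in> D" "X v \<le> z" "z < Y v" "X w \<le> z" "z < Y w" for v w z
    using overlap_aux[OF that] overlap_aux[OF that(2,1,5,6,3,4)] by (cases "r v \<le> r w") auto
  have X_nonneg: "0 \<le> X v" if "v \<in> D" for v
    using that by (auto simp: X_def dyad_def D_def)
  have X: "X v \<in> D \<and> X (X v) = X v \<and> Y (X v) = Y v" if v: "v \<in> D" for v
  proof -
    have d: "dyad (r v) (X v) = dyad (r v) v" by (rule dyad_same) (auto simp: X_def)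
    have D: "X v \<in> D" using X_nonneg[OF v] XY[of v] v r[OF v] cong[OF d] by (auto simp: D_def)
    have "r (X v) = r v \<and> X (X v) = X v"
      by (rule overlap[OF D v, of "X v"]) (use XY[of "X v"] XY[of v] in auto)
    then show ?thesis using D by (auto simp: Y_def X_def)
  qed
  define L where "L = X ` D"
  have LX: "x \<in> D \<and> X x = x" if "x \<in> L" for x using that X by (auto simp: L_def)
  have "cell_decomposition L Y"
  proof
    have "L \<subseteq> (\<lambda>(k, n). real_of_int k / 2 ^ n) ` (UNIV :: (int \<times> nat) set)"
      by (auto simp: L_def X_def dyad_def image_iff)
    then show "countable L" by (rule countable_subset) simp
  next
    fix x assume x: "x \<in> L"
    then show "0 \<le> x" using LX X_nonneg by metis
    show "x < Y x" by (rule XY)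
    show "Y x < 1" using r[of x] LX[OF x] by (auto simp: good_def Y_def)
  next
    fix x x' assume x: "x \<in> L" "x' \<in> L" "x < x'"
    show "Y x \<le> x'"
    proof (rule ccontr)
      assume "\<not> Y x \<le> x'"
      then have "X x = X x'"
        using overlap[of x x' x'] x LX[OF x(1)] LX[OF x(2)] XY[of x'] by auto
      then show False using x LX[OF x(1)] LX[OF x(2)] by simp
    qed
  qed
  moreover have "G v \<le> b x" if "x \<in> L" "x \<le> v" "v < Y x" for x v
    using that r[of x] LX[of x] by (auto simp: good_def Y_def X_def)
  moreover have "G v = b v" if v: "0 \<le> v" "v < 1" and out: "\<forall>x\<in>L. \<not> (x \<le> v \<and> v < Y x)" for v
  proof (rule ccontr)
    assume "G v \<noteq> b v"
    then have "G v < b v" using le[OF v] by simp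
    \<comment> \<open>A number that separates \<open>G\<close> on the whole short interval from
      \<open>b\<close> at its left end, which may differ from \<open>v\<close>.\<close>
    then obtain c where c: "G v < c" "c < b v" using dense by blast
    have "\<forall>\<^sub>F u in at_right v. G u < c" by (rule order_tendstoD(2)[OF right[OF v] c(1)])
    then obtain z where z: "v < z" "\<And>u. v < u \<Longrightarrow> u < z \<Longrightarrow> G u < c"
      unfolding eventually_at_right_field by blast
    have "(b \<longlongrightarrow> b v) (at v within {0..<1})" using cont v by (simp add: continuous_on_def)
    then have "\<forall>\<^sub>F u in at v within {0..<1}. c < b u" by (rule order_tendstoD(1)[OF _ c(2)])
    then obtain d where d: "0 < d" "\<And>u. u \<in> {0..<1} \<Longrightarrow> u \<noteq> v \<Longrightarrow> dist u v < d \<Longrightarrow> c < b u"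
      unfolding eventually_at by blast
    define e where "e = min d (min (z - v) (1 - v))"
    have "0 < e" using d z v by (simp add: e_def)
    then obtain n where n: "1 / 2 ^ n < e"
      using real_arch_pow_inv[of e "1/2"] by (auto simp: power_one_over)
    define x where "x = dyad n v"
    have x: "x \<le> v" "v < x + 1 / 2 ^ n" using dyad_le[where n = n and v = v] by (simp_all add: x_def)
    have x0: "0 \<le> x" using v by (simp add: x_def dyad_def)
    have "c < b x"
      using d(2)[of x] c x x0 v n by (cases "x = v") (auto simp: e_def dist_real_def)
    moreover have "G w < c" if "x \<le> w" "w < x + 1 / 2 ^ n" for w
      using that mono[of w v] z(2)[of w] c x x0 v n
      by (cases w v rule: linorder_cases) (auto simp: e_def)
    moreover have "x + 1 / 2 ^ n < 1" using x n by (auto simp: e_def)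
    ultimately have "good n v" unfolding good_def x_def[symmetric] by fastforce
    then have "v \<in> D" using v by (auto simp: D_def)
    then have "X v \<in> L" "X v \<le> v \<and> v < Y (X v)" using X[of v] XY[of v] by (auto simp: L_def)
    with out show False by blast
  qed
  ultimately show ?thesis by blast
qed

subsection \<open>Barycenters and quantiles\<close>

locale centred_law = real_distribution \<mu> for \<mu> +
  assumes centred: "centred \<mu>"
    and no_atom: "measure \<mu> {x} = 0"
begin

lemma integrable_id: "integrable \<mu> (\<lambda>x. x)" and mean_zero: "(\<integral>x. x \<partial>\<mu>) = 0"
  using centred by (auto simp: centred_def)

lemma AE_neq: "AE x in \<mu>. x \<noteq> c"
  by (rule AE_I[where N="{c}"]) (auto simp: emeasure_eq_measure no_atom)

lemma integrable_restrict: "A \<in> sets borel \<Longrightarrow> integrable \<mu> (\<lambda>x. indicator A x * (x - c))"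
  using integrable_mult_indicator[of A \<mu> "\<lambda>x. x - c"] integrable_id by simp

lemma integral_restrict:
  assumes "A \<in> sets borel"
  shows "(\<integral>x. indicator A x * (x - c) \<partial>\<mu>) = (\<integral>x. indicator A x * x \<partial>\<mu>) - c * measure \<mu> A"
proof -
  have i: "integrable \<mu> (\<lambda>x. indicator A x * x)" using integrable_restrict[OF assms, of 0] by simp
  have "(\<integral>x. indicator A x * (x - c) \<partial>\<mu>) = (\<integral>x. indicator A x * x - c * indicator A x \<partial>\<mu>)"
    by (simp add: algebra_simps)
  also have "\<dots> = (\<integral>x. indicator A x * x \<partial>\<mu>) - (\<integral>x. c * indicator A x \<partial>\<mu>)"
    using assms by (intro Bochner_Integration.integral_diff i) (auto simp: emeasure_eq_measure)
  finally show ?thesis using assms by simp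
qed

definition tail_pos :: "real set" where "tail_pos = {k. 0 < measure \<mu> {k..}}"

lemma tail_pos_down: "k \<le> k' \<Longrightarrow> k' \<in> tail_pos \<Longrightarrow> k \<in> tail_pos"
  unfolding tail_pos_def using finite_measure_mono[of "{k'..}" "{k..}"] by auto

lemma barycenter_tail:
  "k \<in> tail_pos \<Longrightarrow> (\<integral>x. indicator {k..} x * x \<partial>\<mu>) = barycenter \<mu> k * measure \<mu> {k..}"
  by (simp add: barycenter_def set_lebesgue_integral_def tail_pos_def)

lemma barycenter_shift:
  "k \<in> tail_pos \<Longrightarrow> (\<integral>x. indicator {k..} x * (x - c) \<partial>\<mu>) = (barycenter \<mu> k - c) * measure \<mu> {k..}"
  using integral_restrict[of "{k..}" c] barycenter_tail[of k] by (simp add: left_diff_distrib)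

text \<open>Strictness comes from the absence of atoms: equality would concentrate the tail at
  \<open>k\<close>.\<close>

lemma less_barycenter: assumes k: "k \<in> tail_pos" shows "k < barycenter \<mu> k"
proof -
  have nn: "AE x in \<mu>. 0 \<le> indicator {k..} x * (x - k)" by (auto simp: indicator_def)
  have "0 \<le> (\<integral>x. indicator {k..} x * (x - k) \<partial>\<mu>)" by (rule integral_nonneg_AE[OF nn])
  moreover have "(\<integral>x. indicator {k..} x * (x - k) \<partial>\<mu>) \<noteq> 0"
  proof
    assume "(\<integral>x. indicator {k..} x * (x - k) \<partial>\<mu>) = 0"
    then have "AE x in \<mu>. indicator {k..} x * (x - k) = 0"
      using integral_nonneg_eq_0_iff_AE[OF integrable_restrict nn] by simp
    with AE_neq[of k] have "AE x in \<mu>. x \<in> {k..} \<longleftrightarrow> x \<in> {}" by eventually_elim (auto simp: indicator_def)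
    then have "measure \<mu> {k..} = measure \<mu> {}" by (rule finite_measure_eq_AE) auto
    with k show False by (simp add: tail_pos_def)
  qed
  ultimately have "0 < (barycenter \<mu> k - k) * measure \<mu> {k..}"
    unfolding barycenter_shift[OF k] by (simp only: order_less_le) simp
  then show ?thesis using k by (simp add: tail_pos_def zero_less_mult_iff)
qed

text \<open>Extending the tail downwards adds values below \<open>k'\<close>, and these lie below
  its mean.\<close>

lemma barycenter_mono: assumes "k \<le> k'" "k' \<in> tail_pos" shows "barycenter \<mu> k \<le> barycenter \<mu> k'"
proof -
  let ?c = "barycenter \<mu> k'"
  have k: "k \<in> tail_pos" by (rule tail_pos_down[OF assms])
  have i: "integrable \<mu> (\<lambda>x. indicator A x * (x - ?c))" if "A \<in> sets borel" for A by (rule integrable_restrict[OF that])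
  have "(barycenter \<mu> k - ?c) * measure \<mu> {k..} = (\<integral>x. indicator {k..} x * (x - ?c) \<partial>\<mu>)"
    by (rule barycenter_shift[OF k, symmetric])
  also have "\<dots> = (\<integral>x. indicator {k..<k'} x * (x - ?c) + indicator {k'..} x * (x - ?c) \<partial>\<mu>)"
    using assms by (intro Bochner_Integration.integral_cong) (auto simp: indicator_def)
  also have "\<dots> = (\<integral>x. indicator {k..<k'} x * (x - ?c) \<partial>\<mu>) + (\<integral>x. indicator {k'..} x * (x - ?c) \<partial>\<mu>)"
    by (intro Bochner_Integration.integral_add i) auto
  also have "\<dots> = (\<integral>x. indicator {k..<k'} x * (x - ?c) \<partial>\<mu>)"
    by (simp add: barycenter_shift[OF assms(2)])
  also have "\<dots> \<le> (\<integral>x. 0 \<partial>\<mu>)"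
    using less_barycenter[OF assms(2)] by (intro integral_mono i) (auto simp: indicator_def)
  finally show ?thesis using k by (simp add: tail_pos_def mult_le_0_iff)
qed

text \<open>For negative \<open>k\<close> the part cut away has nonpositive integral, while the
  total mean is 0.\<close>

lemma barycenter_nonneg: assumes k: "k \<in> tail_pos" shows "0 \<le> barycenter \<mu> k"
proof (cases "0 \<le> k")
  case True then show ?thesis using less_barycenter[OF k] by simp
next
  case False
  have "0 = (\<integral>x. indicator {k..} x * x + indicator {..<k} x * x \<partial>\<mu>)"
    unfolding mean_zero[symmetric] by (intro Bochner_Integration.integral_cong) (auto simp: indicator_def)
  also have "\<dots> = (\<integral>x. indicator {k..} x * x \<partial>\<mu>) + (\<integral>x. indicator {..<k} x * x \<partial>\<mu>)"
    using integrable_restrict[of "{k..}" 0] integrable_restrict[of "{..<k}" 0]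
    by (intro Bochner_Integration.integral_add) auto
  also have "(\<integral>x. indicator {..<k} x * x \<partial>\<mu>) \<le> (\<integral>x. 0 \<partial>\<mu>)"
    using False integrable_restrict[of "{..<k}" 0] by (intro integral_mono) (auto simp: indicator_def)
  finally have "0 \<le> barycenter \<mu> k * measure \<mu> {k..}" by (simp add: barycenter_tail[OF k])
  then show ?thesis using k by (simp add: tail_pos_def zero_le_mult_iff)
qed

lemma barycenter_measurable [measurable]: "barycenter \<mu> \<in> borel_measurable borel"
proof -
  have [measurable]: "(\<lambda>k. \<integral>x. (if k \<le> x then x else 0) \<partial>\<mu>) \<in> borel_measurable borel"
    by (rule borel_measurable_lebesgue_integral) measurable
  have [measurable]: "(\<lambda>k. \<integral>x. (if k \<le> x then 1 else 0 :: real) \<partial>\<mu>) \<in> borel_measurable borel"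
    by (rule borel_measurable_lebesgue_integral) measurable
  have "barycenter \<mu> = (\<lambda>k. (\<integral>x. (if k \<le> x then x else 0) \<partial>\<mu>) / (\<integral>x. (if k \<le> x then 1 else 0 :: real) \<partial>\<mu>))"
  proof
    fix k
    have "(\<integral>x. (if k \<le> x then 1 else 0 :: real) \<partial>\<mu>) = (\<integral>x. indicator {k..} x \<partial>\<mu>)"
      by (intro Bochner_Integration.integral_cong) (auto simp: indicator_def)
    moreover have "(\<integral>x. (if k \<le> x then x else 0) \<partial>\<mu>) = (LINT x:{k..}|\<mu>. x)"
      unfolding set_lebesgue_integral_def by (intro Bochner_Integration.integral_cong) (auto simp: indicator_def)
    ultimately show "barycenter \<mu> k = (\<integral>x. (if k \<le> x then x else 0) \<partial>\<mu>) / (\<integral>x. (if k \<le> x then 1 else 0 :: real) \<partial>\<mu>)"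
      by (simp add: barycenter_def)
  qed
  then show ?thesis by simp
qed

section \<open>Quantile coordinates\<close>

definition quant :: "real \<Rightarrow> real" where
  "quant v = (if 0 < v \<and> v < 1 then Inf {x. v \<le> cdf \<mu> x} else 0)"

lemma quant_mono: "0 < u \<Longrightarrow> u \<le> v \<Longrightarrow> v < 1 \<Longrightarrow> quant u \<le> quant v"
proof -
  interpret cdf_distribution \<mu> by (simp add: cdf_distribution_def real_distribution_axioms)
  show "0 < u \<Longrightarrow> u \<le> v \<Longrightarrow> v < 1 \<Longrightarrow> quant u \<le> quant v"
    using mono_I by (auto simp: quant_def mono_on_def)
qed

lemma quant_measurable [measurable]: "quant \<in> borel_measurable borel"
proof -
  interpret cdf_distribution \<mu> by (simp add: cdf_distribution_def real_distribution_axioms)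
  have "(\<lambda>v. indicator {0<..<1} v *\<^sub>R I v) \<in> borel_measurable borel"
    using measurable_CI by (subst borel_measurable_restrict_space_iff[symmetric]) auto
  also have "(\<lambda>v. indicator {0<..<1} v *\<^sub>R I v) = quant" by (auto simp: quant_def fun_eq_iff)
  finally show ?thesis .
qed

lemma distr_quant: "distr unif borel quant = \<mu>"
proof -
  interpret cdf_distribution \<mu> by (simp add: cdf_distribution_def real_distribution_axioms)
  have "distr unif borel quant = distr (restrict_space lborel {0<..<1}) borel I"
  proof (rule measure_eqI)
    fix A :: "real set" assume "A \<in> sets (distr unif borel quant)"
    then have A: "A \<in> sets borel" by simp
    have m: "quant -` A \<in> sets borel" using measurable_sets[OF quant_measurable A] by simp
    have "emeasure (distr unif borel quant) A = emeasure unif (quant -` A)"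
      using A by (subst emeasure_distr) auto
    also have "\<dots> = (\<integral>\<^sup>+u\<in>quant -` A. indicator {0<..<1} u \<partial>lborel)"
      unfolding unif_def by (rule emeasure_density) (use m in auto)
    also have "\<dots> = (\<integral>\<^sup>+u. indicator (I -` A \<inter> {0<..<1}) u \<partial>lborel)"
      by (intro nn_integral_cong) (auto simp: indicator_def quant_def)
    also have "\<dots> = emeasure lborel (I -` A \<inter> {0<..<1})"
    proof (rule nn_integral_indicator)
      have "I -` A \<inter> {0<..<1} = quant -` A \<inter> {0<..<1}" by (auto simp: quant_def)
      then show "I -` A \<inter> {0<..<1} \<in> sets lborel" using m by simp
    qed
    also have "\<dots> = emeasure (restrict_space lborel {0<..<1}) (I -` A \<inter> {0<..<1})"
      by (rule emeasure_restrict_space[symmetric]) auto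
    also have "\<dots> = emeasure (distr (restrict_space lborel {0<..<1}) borel I) A"
    proof (subst emeasure_distr)
      show "I \<in> borel_measurable (restrict_space lborel {0<..<1})"
        using measurable_CI by (subst measurable_cong_sets[OF sets_restrict_space_cong refl]) auto
    qed (use A in \<open>auto simp: space_restrict_space\<close>)
    finally show "emeasure (distr unif borel quant) A = emeasure (distr (restrict_space lborel {0<..<1}) borel I) A" .
  qed simp
  then show ?thesis unfolding distr_I_eq_M .
qed

lemma AE_quant: assumes "AE x in \<mu>. P x" shows "AE v in unif. P (quant v)"
proof (rule AE_distrD[of quant unif borel P])
  show "AE v in distr unif borel quant. P v" unfolding distr_quant by (rule assms)
qed simp

lemma integrable_quant: "integrable unif quant"
proof -
  have "integrable (distr unif borel quant) (\<lambda>x. x)" unfolding distr_quant by (rule integrable_id)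
  then show ?thesis by (subst (asm) integrable_distr_eq) auto
qed

lemma integral_quant: "(\<integral>v. quant v \<partial>unif) = 0"
proof -
  have "(\<integral>x. x \<partial>distr unif borel quant) = 0" unfolding distr_quant by (rule mean_zero)
  then show ?thesis by (subst (asm) integral_distr) auto
qed

text \<open>A flat piece of the quantile function would be an atom, so
  \<open>quant u = quant v\<close> for almost no \<open>u\<close>. Thus upper tails of the law
  correspond to intervals of quantiles.\<close>

lemma AE_quant_less: "0 < v \<Longrightarrow> v < 1 \<Longrightarrow> AE u in unif. quant v \<le> quant u \<longleftrightarrow> v < u"
proof -
  assume v: "0 < v" "v < 1"
  show ?thesis using AE_unif AE_unif_neq[of v] AE_quant[OF AE_neq[of "quant v"]]
  proof eventually_elim
    case (elim u)
    then show ?case using v quant_mono[of u v] quant_mono[of v u] by (cases u v rule: linorder_cases) auto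
  qed
qed

text \<open>The barycenter function in quantile coordinates. Unlike
  \<open>barycenter \<mu> (quant v)\<close> it also has the right value at \<open>v = 0\<close>,
  namely the mean 0, where \<open>quant\<close> is only a default.\<close>

definition qtail :: "real \<Rightarrow> real" where
  "qtail v = (\<integral>u. indicator {v<..} u * quant u \<partial>unif) / (1 - v)"

lemma quant_tail:
  assumes v: "0 < v" "v < 1"
  shows "measure \<mu> {quant v..} = 1 - v" "barycenter \<mu> (quant v) = qtail v" "quant v \<in> tail_pos"
proof -
  have "measure \<mu> {quant v..} = measure (distr unif borel quant) {quant v..}" by (simp add: distr_quant)
  also have "\<dots> = measure unif {u. quant v \<le> quant u}"
    by (subst measure_distr) (auto simp: vimage_def)
  also have "\<dots> = measure unif {v<..}"
    using AE_quant_less[OF v] by (intro unif.finite_measure_eq_AE) auto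
  finally show m: "measure \<mu> {quant v..} = 1 - v" using v by (simp add: measure_unif_tail)
  then show "quant v \<in> tail_pos" using v by (simp add: tail_pos_def)
  have "(LINT x:{quant v..}|\<mu>. x) = (\<integral>x. indicator {quant v..} x * x \<partial>distr unif borel quant)"
    by (simp add: distr_quant set_lebesgue_integral_def)
  also have "\<dots> = (\<integral>u. indicator {quant v..} (quant u) * quant u \<partial>unif)"
    by (subst integral_distr) auto
  also have "\<dots> = (\<integral>u. indicator {v<..} u * quant u \<partial>unif)"
    using AE_quant_less[OF v] by (intro integral_cong_AE) (auto simp: indicator_def elim!: eventually_mono)
  finally show "barycenter \<mu> (quant v) = qtail v" by (simp add: barycenter_def m qtail_def)
qed

lemma qtail_continuous: "continuous_on {0..<1} qtail"
  unfolding qtail_def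
proof (intro continuous_on_divide continuous_intros ballI)
  show "continuous_on {0..<1} (\<lambda>v. \<integral>u. indicator {v<..} u * quant u \<partial>unif)"
  proof (rule continuous_on_sequentiallyI)
    fix s and v :: real assume "\<forall>n. s n \<in> {0..<1}" "v \<in> {0..<1}" and s: "s \<longlonglongrightarrow> v"
    show "(\<lambda>n. \<integral>u. indicator {s n<..} u * quant u \<partial>unif) \<longlonglongrightarrow> (\<integral>u. indicator {v<..} u * quant u \<partial>unif)"
    proof (rule integral_dominated_convergence[where w = "\<lambda>u. \<bar>quant u\<bar>"])
      show "AE u in unif. (\<lambda>n. indicator {s n<..} u * quant u) \<longlonglongrightarrow> indicator {v<..} u * quant u"
        using AE_unif_neq[of v]
      proof eventually_elim
        case (elim u)
        have "\<forall>\<^sub>F n in sequentially. indicator {s n<..} u * quant u = indicator {v<..} u * quant u"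
        proof (cases "u < v")
          case True
          from order_tendstoD(1)[OF s True] show ?thesis by eventually_elim (use True in auto)
        next
          case False
          then have "v < u" using elim by simp
          from order_tendstoD(2)[OF s this] show ?thesis by eventually_elim (use \<open>v < u\<close> in auto)
        qed
        then show ?case by (rule tendsto_eventually)
      qed
      show "AE u in unif. norm (indicator {s n<..} u * quant u) \<le> \<bar>quant u\<bar>" for n by (auto simp: indicator_def)
    qed (use integrable_quant in auto)
  qed
qed auto

end

lemma mono_borel_measurable_ereal:
  fixes a :: "real \<Rightarrow> ereal" assumes "mono a" shows "a \<in> borel_measurable borel"
proof (rule borel_measurableI_less)
  fix c
  have "{x. a x < c} \<in> sets borel"
    by (rule real_interval_borel_measurable)
       (use assms in \<open>auto simp: is_interval_1 mono_def intro: le_less_trans\<close>)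
  then show "{x \<in> space borel. a x < c} \<in> sets borel" by simp
qed

section \<open>Existence of a process with joint law given by the ridge map\<close>

context centred_law begin

context
  fixes a :: "real \<Rightarrow> ereal"
  assumes a_mono: "mono a"
begin

lemma ridge_map_measurable [measurable]: "ridge_map \<mu> a \<in> borel_measurable borel"
proof -
  note [measurable] = mono_borel_measurable_ereal[OF a_mono]
  show ?thesis unfolding ridge_map_def[abs_def] by measurable
qed

lemma ridge_map_ereal:
  assumes "k \<in> tail_pos"
  shows "ereal (ridge_map \<mu> a k) = min (ereal (barycenter \<mu> k)) (max (a k) (max 0 (ereal k)))" (is "_ = ?m")
proof -
  have "ereal 0 \<le> ?m" "?m \<le> ereal (barycenter \<mu> k)"
    using barycenter_nonneg[OF assms] by (auto simp: min_le_iff_disj le_max_iff_disj zero_ereal_def[symmetric])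
  then have "\<bar>?m\<bar> \<noteq> \<infinity>" by (cases ?m) (simp_all only: abs_ereal.simps ereal_less_eq, simp_all)
  then show ?thesis by (simp add: ridge_map_def ereal_real)
qed

lemma ridge_map_bounds:
  assumes k: "k \<in> tail_pos"
  shows "max 0 k \<le> ridge_map \<mu> a k" "ridge_map \<mu> a k \<le> barycenter \<mu> k"
proof -
  have "ereal (max 0 k) \<le> ereal (ridge_map \<mu> a k)"
    unfolding ridge_map_ereal[OF k] using less_barycenter[OF k] barycenter_nonneg[OF k]
    by (auto simp: max_def zero_ereal_def min_def)
  then show "max 0 k \<le> ridge_map \<mu> a k" by simp
  have "ereal (ridge_map \<mu> a k) \<le> ereal (barycenter \<mu> k)" unfolding ridge_map_ereal[OF k] by simp
  then show "ridge_map \<mu> a k \<le> barycenter \<mu> k" by simp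
qed

lemma ridge_map_mono:
  assumes "k \<le> k'" "k' \<in> tail_pos" shows "ridge_map \<mu> a k \<le> ridge_map \<mu> a k'"
proof -
  have "ereal (ridge_map \<mu> a k) \<le> ereal (ridge_map \<mu> a k')"
    unfolding ridge_map_ereal[OF assms(2)] ridge_map_ereal[OF tail_pos_down[OF assms]]
    using barycenter_mono[OF assms] monoD[OF a_mono assms(1)] assms(1)
    by (intro min.mono max.mono) auto
  then show ?thesis by simp
qed

theorem ex_admissible_ridge_map:
  assumes T: "0 < T"
  shows "\<exists>(N :: (real \<times> real) measure) \<F> M. admissible T \<mu> N \<F> M \<and>
    terminal_max_law T N M = graph_pushforward \<mu> (ridge_map \<mu> a)"
proof -
  define G0 where "G0 v = ridge_map \<mu> a (quant v)" for v
  have G0_mono: "G0 u \<le> G0 v" if "0 < u" "u \<le> v" "v < 1" for u v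
    unfolding G0_def using that quant_mono quant_tail(3)[of v] by (intro ridge_map_mono) auto
  have G0_le: "G0 v \<le> qtail v" and G0_ge: "max 0 (quant v) \<le> G0 v" if "0 < v" "v < 1" for v
    using ridge_map_bounds[OF quant_tail(3)[OF that]] quant_tail(2)[OF that] by (auto simp: G0_def)
  \<comment> \<open>By monotonicity of \<open>G0\<close> this is its limit from the right, which
    also supplies a value at 0.\<close>
  define G where "G v = (if 0 \<le> v \<and> v < 1 then Inf (G0 ` {v<..<1}) else 0)" for v
  have bdd: "bdd_below (G0 ` {v<..<1})" if "0 \<le> v" for v
    using G0_ge that by (intro bdd_belowI[of _ 0]) (force simp: max_def split: if_splits)
  have ne: "G0 ` {v<..<1} \<noteq> {}" if "v < 1" for v using that by simp
  have G_le: "G v \<le> G0 u" if "0 \<le> v" "v < u" "u < 1" for u v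
    unfolding G_def using that by (auto intro!: cInf_lower bdd)
  have G_mono: "G u \<le> G v" if "0 \<le> u" "u \<le> v" "v < 1" for u v
  proof -
    have "Inf (G0 ` {u<..<1}) \<le> Inf (G0 ` {v<..<1})"
      using that by (intro cInf_superset_mono ne bdd image_mono) auto
    then show ?thesis using that by (simp add: G_def)
  qed
  have G_right: "(G \<longlongrightarrow> G v) (at_right v)" if v: "0 \<le> v" "v < 1" for v
  proof (rule order_tendstoI)
    have ev: "\<forall>\<^sub>F u in at_right v. v < u \<and> u < 1" by (rule eventually_at_right_Ioo[OF v(2)])
    fix c assume "c < G v"
    from ev show "\<forall>\<^sub>F u in at_right v. c < G u"
    proof eventually_elim
      case (elim u)
      then show ?case using \<open>c < G v\<close> G_mono[of v u] v by auto
    qed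
  next
    fix c assume "G v < c"
    then obtain u where u: "v < u" "u < 1" "G0 u < c"
      using cInf_less_iff[OF ne[OF v(2)] bdd[OF v(1)]] v by (auto simp: G_def)
    have "\<forall>\<^sub>F w in at_right v. v < w \<and> w < u" by (rule eventually_at_right_Ioo[OF u(1)])
    then show "\<forall>\<^sub>F w in at_right v. G w < c"
    proof eventually_elim
      case (elim w)
      then show ?case using G_le[of w u] u v by auto
    qed
  qed
  have G_ge: "G0 v \<le> G v" if "0 < v" "v < 1" for v
    unfolding G_def using that by (auto intro!: cInf_greatest ne G0_mono)
  have G_nonneg: "0 \<le> G v" if "0 \<le> v" "v < 1" for v
  proof -
    have "0 \<le> Inf (G0 ` {v<..<1})"
      by (rule cInf_greatest[OF ne[OF that(2)]]) (use G0_ge that in force)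
    then show ?thesis using that by (simp add: G_def)
  qed
  \<comment> \<open>To the right of \<open>v\<close> the bound is inherited from \<open>G0\<close>;
    continuity of \<open>qtail\<close> brings it to \<open>v\<close> itself.\<close>
  have G_qtail: "G v \<le> qtail v" if v: "0 \<le> v" "v < 1" for v
  proof -
    have "(qtail \<longlongrightarrow> qtail v) (at v within {0..<1})" using qtail_continuous v by (simp add: continuous_on_def)
    then have "(qtail \<longlongrightarrow> qtail v) (at v within {v..(v + 1) / 2})" by (rule tendsto_within_subset) (use v in auto)
    then have lim: "(qtail \<longlongrightarrow> qtail v) (at_right v)" using at_within_Icc_at_right[of v "(v + 1) / 2"] v by simp
    have "\<forall>\<^sub>F u in at_right v. v < u \<and> u < 1" by (rule eventually_at_right_Ioo[OF v(2)])
    then have "\<forall>\<^sub>F u in at_right v. G v \<le> qtail u"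
    proof eventually_elim
      case (elim u)
      then show ?case using G_le[of v u] G0_le[of u] v by auto
    qed
    then show ?thesis by (rule tendsto_lowerbound[OF lim]) simp
  qed
  have G_mono_on: "mono_on {0..<1} G" using G_mono by (auto simp: mono_on_def)
  have G_meas: "G \<in> borel_measurable borel"
  proof -
    have "(\<lambda>v. indicator {0..<1} v *\<^sub>R G v) \<in> borel_measurable borel"
      using borel_measurable_mono_on_fnc[OF G_mono_on] by (subst borel_measurable_restrict_space_iff[symmetric]) auto
    also have "(\<lambda>v. indicator {0..<1} v *\<^sub>R G v) = G" by (auto simp: G_def fun_eq_iff)
    finally show ?thesis .
  qed
  have good: "AE v in unif. (G \<longlongrightarrow> G v) (at_left v) \<and> G v = G0 v"
  proof -
    \<comment> \<open>Countable by monotonicity, hence null. At a point of continuity the inequality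
      \<open>G u \<le> G0 v\<close> for \<open>u < v\<close> passes to the limit, so that
      \<open>G\<close> and \<open>G0\<close> agree there.\<close>
    define Dis where "Dis = {v \<in> {0<..<1}. \<not> isCont G v}"
    have "countable Dis" unfolding Dis_def
      by (rule mono_on_ctble_discont_open) (use G_mono in \<open>auto simp: mono_on_def\<close>)
    then have "AE v in unif. \<forall>w\<in>Dis. v \<noteq> w" using AE_unif_neq by (subst AE_ball_countable) auto
    with AE_unif show ?thesis
    proof eventually_elim
      case (elim v)
      then have "isCont G v" by (auto simp: Dis_def)
      then have lim: "(G \<longlongrightarrow> G v) (at_left v)" by (simp add: isCont_def filterlim_at_split)
      have "\<forall>\<^sub>F u in at_left v. 0 < u \<and> u < v" using elim by (intro eventually_at_left_Ioo) simp
      then have "\<forall>\<^sub>F u in at_left v. G u \<le> G0 v"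
        by eventually_elim (use G_le elim in auto)
      then have "G v \<le> G0 v" by (rule tendsto_upperbound[OF lim]) simp
      then show ?case using lim G_ge[of v] elim by auto
    qed
  qed
  obtain L y where Ly: "cell_decomposition L y"
    "\<And>x v. x \<in> L \<Longrightarrow> x \<le> v \<Longrightarrow> v < y x \<Longrightarrow> G v \<le> qtail x"
    "\<And>v. 0 \<le> v \<Longrightarrow> v < 1 \<Longrightarrow> (\<forall>x\<in>L. \<not> (x \<le> v \<and> v < y x)) \<Longrightarrow> G v = qtail v"
    using ex_cell_decomposition[OF G_mono G_right qtail_continuous G_qtail] by blast
  interpret cell_decomposition L y by (rule Ly(1))
  interpret tail_bounded L y quant G
  proof
    show "quant v \<le> G v" if "0 < v" "v < 1" for v using G0_ge[OF that] G_ge[OF that] by simp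
  qed (use G_meas G_mono G_right G_nonneg Ly integrable_quant integral_quant in \<open>auto simp: free_def qtail_def\<close>)
  have "distr unif (borel \<Otimes>\<^sub>M borel) (\<lambda>v. (quant v, G v)) = distr unif (borel \<Otimes>\<^sub>M borel) ((\<lambda>w. (w, ridge_map \<mu> a w)) \<circ> quant)"
  proof (rule distr_cong_AE)
    show "AE v in unif. (quant v, G v) = ((\<lambda>w. (w, ridge_map \<mu> a w)) \<circ> quant) v"
      using good by eventually_elim (simp add: G0_def)
    show "(\<lambda>v. (quant v, G v)) \<in> unif \<rightarrow>\<^sub>M borel \<Otimes>\<^sub>M borel" using G_meas by measurable
    show "(\<lambda>w. (w, ridge_map \<mu> a w)) \<circ> quant \<in> unif \<rightarrow>\<^sub>M borel \<Otimes>\<^sub>M borel" by (simp add: comp_def)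
  qed auto
  also have "\<dots> = distr (distr unif borel quant) (borel \<Otimes>\<^sub>M borel) (\<lambda>w. (w, ridge_map \<mu> a w))"
    by (rule distr_distr[symmetric]) auto
  also have "\<dots> = graph_pushforward \<mu> (ridge_map \<mu> a)" by (simp add: distr_quant graph_pushforward_def)
  finally show ?thesis using ex_admissible[OF T distr_quant] good by (auto elim: eventually_mono)
qed

end

end

subsection \<open>The dual potential\<close>

text \<open>Lower Riemann sums of \<open>h (w\<^sub>s) (ds)\<close> along the curve \<open>s = \<beta> (w\<^sub>s)\<close>. Their supremum is a dual potential:
  it dominates the gain in \<open>h w\<close> when the level is moved away from \<open>\<beta> w\<close>.\<close>

inductive lower_sum :: "(real \<Rightarrow> real \<Rightarrow> real) \<Rightarrow> (real \<Rightarrow> real) \<Rightarrow> real set \<Rightarrow> real \<Rightarrow> real \<Rightarrow> bool"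
  for h :: "real \<Rightarrow> real \<Rightarrow> real" and \<beta> :: "real \<Rightarrow> real" and D :: "real set" where
  zero: "lower_sum h \<beta> D 0 0"
| wait: "lower_sum h \<beta> D s x \<Longrightarrow> s \<le> t \<Longrightarrow> lower_sum h \<beta> D t x"
| step: "lower_sum h \<beta> D s x \<Longrightarrow> s \<le> t \<Longrightarrow> w \<in> D \<Longrightarrow> \<beta> w \<le> s \<Longrightarrow> lower_sum h \<beta> D t (x + (h w t - h w s))"

locale monotone_payoff =
  fixes h :: "real \<Rightarrow> real \<Rightarrow> real" and \<beta> :: "real \<Rightarrow> real" and D :: "real set"
  assumes h_zero: "h w 0 = 0"
    and h_mono: "0 \<le> s \<Longrightarrow> s \<le> t \<Longrightarrow> h w s \<le> h w t"
    and h_incr: "w \<le> w' \<Longrightarrow> 0 \<le> s \<Longrightarrow> s \<le> t \<Longrightarrow> h w t - h w s \<le> h w' t - h w' s"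
    and \<beta>_mono: "w \<in> D \<Longrightarrow> w' \<in> D \<Longrightarrow> w \<le> w' \<Longrightarrow> \<beta> w \<le> \<beta> w'"
    and \<beta>_nonneg: "w \<in> D \<Longrightarrow> 0 \<le> \<beta> w"
begin

abbreviation "ls \<equiv> lower_sum h \<beta> D"

text \<open>The levels that do not exceed every barycenter. Only there is an upper bound for the
  lower sums available.\<close>

definition level :: "real set" where
  "level = {s. 0 \<le> s \<and> (\<exists>w\<in>D. s \<le> \<beta> w)}"

definition potential :: "real \<Rightarrow> real" where
  "potential s = Sup {x. ls s x}"

lemma levelI: "w \<in> D \<Longrightarrow> 0 \<le> s \<Longrightarrow> s \<le> \<beta> w \<Longrightarrow> s \<in> level"
  unfolding level_def by blast

lemma level_down: "0 \<le> s \<Longrightarrow> s \<le> t \<Longrightarrow> t \<in> level \<Longrightarrow> s \<in> level"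
  unfolding level_def using order_trans by blast

lemma ls_nonneg: "ls s x \<Longrightarrow> 0 \<le> s \<and> 0 \<le> x"
proof (induction rule: lower_sum.induct)
  case (step s x t w)
  then show ?case using h_mono[of s t w] by auto
qed auto

text \<open>If \<open>w'\<close> lies above \<open>w\<close>, monotonicity of \<open>\<beta>\<close>
  squeezes the interval from \<open>s\<close> to \<open>t\<close> to a point. In all other cases the
  increments of \<open>h\<close> are ordered by assumption.\<close>

lemma step_le:
  assumes "w \<in> D" "w' \<in> D" "\<beta> w' \<le> s" "0 \<le> s" "s \<le> t" "t \<le> \<beta> w"
  shows "h w' t - h w' s \<le> h w t - h w s"
proof (cases "w' \<le> w")
  case True then show ?thesis using assms by (intro h_incr) auto
next
  case False
  then have "\<beta> w \<le> \<beta> w'" using assms by (intro \<beta>_mono) auto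
  then have "s = t" using assms by auto
  then show ?thesis by simp
qed

text \<open>Along the sum each step is dominated by the increment of \<open>h w\<close> over the
  same interval, and these increments telescope. The bound makes the supremum in
  \<open>potential\<close> finite.\<close>

lemma ls_le: "ls t x \<Longrightarrow> w \<in> D \<Longrightarrow> t \<le> \<beta> w \<Longrightarrow> x \<le> h w t"
proof (induction rule: lower_sum.induct)
  case (wait s x t)
  then show ?case using h_mono[of s t w] ls_nonneg[of s x] by auto
next
  case (step s x t w')
  then show ?case using step_le[of w w' s t] ls_nonneg[of s x] by auto
qed (simp add: h_zero)

lemma ls_zero: "0 \<le> s \<Longrightarrow> ls s 0"
  using lower_sum.wait[OF lower_sum.zero] by simp

lemma bdd_ls: "s \<in> level \<Longrightarrow> bdd_above {x. ls s x}"
proof -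
  assume "s \<in> level"
  then obtain w where "w \<in> D" "s \<le> \<beta> w" by (auto simp: level_def)
  then show ?thesis using ls_le by (intro bdd_aboveI[of _ "h w s"]) auto
qed

lemma ls_potential: "s \<in> level \<Longrightarrow> ls s x \<Longrightarrow> x \<le> potential s"
  unfolding potential_def by (rule cSup_upper[OF _ bdd_ls]) auto

lemma potential_le: "0 \<le> s \<Longrightarrow> (\<And>x. ls s x \<Longrightarrow> x \<le> c) \<Longrightarrow> potential s \<le> c"
  unfolding potential_def using ls_zero by (intro cSup_least) auto

lemma potential_nonneg: "s \<in> level \<Longrightarrow> 0 \<le> potential s"
  using ls_potential[OF _ ls_zero] by (auto simp: level_def)

lemma potential_mono: "0 \<le> s \<Longrightarrow> s \<le> t \<Longrightarrow> t \<in> level \<Longrightarrow> potential s \<le> potential t"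
  by (rule potential_le) (auto intro: ls_potential lower_sum.wait)

text \<open>Above \<open>\<beta> w\<close> the value \<open>w\<close> itself may be used for one
  more step of the sum.\<close>

lemma potential_up:
  assumes "w \<in> D" "t \<in> level" "\<beta> w \<le> t"
  shows "h w t - h w (\<beta> w) \<le> potential t - potential (\<beta> w)"
proof -
  have "potential (\<beta> w) \<le> potential t - (h w t - h w (\<beta> w))"
  proof (rule potential_le)
    fix x assume "ls (\<beta> w) x"
    then have "ls t (x + (h w t - h w (\<beta> w)))" using assms by (intro lower_sum.step) auto
    then show "x \<le> potential t - (h w t - h w (\<beta> w))" using ls_potential[OF assms(2)] by fastforce
  qed (rule \<beta>_nonneg[OF assms(1)])
  then show ?thesis by simp
qed

text \<open>A step that crosses \<open>s\<close> is cut there: its first half still belongs to a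
  lower sum up to \<open>s\<close>, and its second half is dominated by the increment of
  \<open>h w\<close>.\<close>

lemma ls_split:
  "ls u x \<Longrightarrow> w \<in> D \<Longrightarrow> 0 \<le> s \<Longrightarrow> s \<le> u \<Longrightarrow> u \<le> \<beta> w \<Longrightarrow> x \<le> potential s + (h w u - h w s)"
proof (induction rule: lower_sum.induct)
  case zero
  then show ?case using potential_nonneg[of 0] by (auto simp: level_def)
next
  case (wait r x u)
  have sl: "s \<in> level" using wait by (intro levelI[of w]) auto
  show ?case
  proof (cases "s \<le> r")
    case True
    then show ?thesis using wait h_mono[of r u w] by auto
  next
    case False
    then have "ls s x" using wait by (intro lower_sum.wait[OF wait.hyps(1)]) auto
    then show ?thesis using ls_potential[OF sl] h_mono[of s u w] wait by fastforce
  qed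
next
  case (step r x u w')
  have sl: "s \<in> level" using step by (intro levelI[of w]) auto
  have r: "0 \<le> r" using ls_nonneg step by blast
  show ?case
  proof (cases "s \<le> r")
    case True
    then show ?thesis using step step_le[of w w' r u] r by auto
  next
    case False
    then have "ls s (x + (h w' s - h w' r))" using step by (intro lower_sum.step) auto
    moreover have "h w' u - h w' s \<le> h w u - h w s" using step False by (intro step_le) auto
    ultimately show ?thesis using ls_potential[OF sl] by fastforce
  qed
qed

lemma potential_down:
  assumes "w \<in> D" "0 \<le> s" "s \<le> \<beta> w"
  shows "h w s - h w (\<beta> w) \<le> potential s - potential (\<beta> w)"
proof -
  have "potential (\<beta> w) \<le> potential s + (h w (\<beta> w) - h w s)"
    using assms by (intro potential_le ls_split \<beta>_nonneg) auto
  then show ?thesis by simp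
qed

lemma potential_dual:
  assumes "w \<in> D" "s \<in> level"
  shows "h w s - h w (\<beta> w) \<le> potential s - potential (\<beta> w)"
  using assms potential_up[of w s] potential_down[of w s] by (cases "\<beta> w \<le> s") (auto simp: level_def)

text \<open>The potential may have infinite mean. This version is bounded and, with the value
  \<open>n\<close> above \<open>level\<close>, nondecreasing on the whole line, as stochastic
  domination requires.\<close>

definition trunc :: "nat \<Rightarrow> real \<Rightarrow> real" where
  "trunc n s = (if s < 0 then 0 else if s \<in> level then min (potential s) (real n) else real n)"

lemma trunc_mono: "mono (trunc n)"
proof (rule monoI)
  fix s t :: real assume st: "s \<le> t"
  have "s \<in> level" if "0 \<le> s" "t \<in> level" using that st level_down by blast
  then show "trunc n s \<le> trunc n t"
    using potential_mono[of s t] potential_nonneg[of t] potential_nonneg[of s] st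
    by (auto simp: trunc_def min_le_iff_disj min.bounded_iff)
qed

lemma trunc_bounds: "0 \<le> trunc n s" "trunc n s \<le> real n"
  using potential_nonneg[of s] by (auto simp: trunc_def)

end

text \<open>Layer-cake formula: only superlevel sets of \<open>\<psi>\<close> have to be compared,
  and these are half-lines. Whether such a half-line contains its infimum is irrelevant, as the
  assumption sets a closed tail of \<open>S\<close> against an open tail of
  \<open>Z\<close>.\<close>

lemma (in prob_space) expectation_mono_dominated:
  fixes \<psi> :: "real \<Rightarrow> real"
  assumes [measurable]: "S \<in> borel_measurable M" "Z \<in> borel_measurable M"
    and tail_pos: "\<And>z. prob {\<omega>\<in>space M. z \<le> S \<omega>} \<le> prob {\<omega>\<in>space M. z < Z \<omega>}"
    and mono: "mono \<psi>"
  shows "(\<integral>\<^sup>+\<omega>. ennreal (\<psi> (S \<omega>)) \<partial>M) \<le> (\<integral>\<^sup>+\<omega>. ennreal (\<psi> (Z \<omega>)) \<partial>M)"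
proof -
  have [measurable]: "\<psi> \<in> borel_measurable borel" by (rule borel_measurable_mono[OF mono])
  interpret P: pair_sigma_finite M lborel ..
  have cake: "(\<integral>\<^sup>+\<omega>. ennreal (\<psi> (Y \<omega>)) \<partial>M) = (\<integral>\<^sup>+t. (\<integral>\<^sup>+\<omega>. indicator {0..} t * indicator {\<omega>\<in>space M. t < \<psi> (Y \<omega>)} \<omega> \<partial>M) \<partial>lborel)"
    if [measurable]: "Y \<in> borel_measurable M" for Y
  proof -
    have "ennreal (\<psi> (Y \<omega>)) = (\<integral>\<^sup>+t. indicator {0..} t * indicator {\<omega>\<in>space M. t < \<psi> (Y \<omega>)} \<omega> \<partial>lborel)"
      if "\<omega> \<in> space M" for \<omega>
    proof -
      have "(\<integral>\<^sup>+t. indicator {0..} t * indicator {\<omega>\<in>space M. t < \<psi> (Y \<omega>)} \<omega> \<partial>lborel)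
          = (\<integral>\<^sup>+t. indicator {0..<\<psi> (Y \<omega>)} t \<partial>lborel)"
        using that by (intro nn_integral_cong) (auto simp: indicator_def)
      also have "\<dots> = ennreal (\<psi> (Y \<omega>))"
        by (cases "0 \<le> \<psi> (Y \<omega>)") (auto simp: ennreal_neg)
      finally show ?thesis ..
    qed
    then have "(\<integral>\<^sup>+\<omega>. ennreal (\<psi> (Y \<omega>)) \<partial>M) = (\<integral>\<^sup>+\<omega>. (\<integral>\<^sup>+t. indicator {0..} t * indicator {\<omega>\<in>space M. t < \<psi> (Y \<omega>)} \<omega> \<partial>lborel) \<partial>M)"
      by (rule nn_integral_cong)
    also have "\<dots> = (\<integral>\<^sup>+t. (\<integral>\<^sup>+\<omega>. indicator {0..} t * indicator {\<omega>\<in>space M. t < \<psi> (Y \<omega>)} \<omega> \<partial>M) \<partial>lborel)"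
    proof (rule P.Fubini'[symmetric])
      have "(\<lambda>(\<omega>, t). (if 0 \<le> t \<and> t < \<psi> (Y \<omega>) then 1 else 0) :: ennreal) \<in> borel_measurable (M \<Otimes>\<^sub>M lborel)"
        by measurable
      then show "(\<lambda>(\<omega>, t). indicator {0..} t * indicator {\<omega>\<in>space M. t < \<psi> (Y \<omega>)} \<omega> :: ennreal) \<in> borel_measurable (M \<Otimes>\<^sub>M lborel)"
        by (rule measurable_cong[THEN iffD1, rotated]) (auto simp: space_pair_measure indicator_def)
    qed
    finally show ?thesis .
  qed
  have level: "emeasure M {\<omega>\<in>space M. t < \<psi> (S \<omega>)} \<le> emeasure M {\<omega>\<in>space M. t < \<psi> (Z \<omega>)}" for t
  proof -
    define U where "U = {s. t < \<psi> s}"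
    have up: "s' \<in> U" if "s \<in> U" "s \<le> s'" for s s'
      using that monoD[OF mono that(2)] by (auto simp: U_def)
    show ?thesis
    proof (cases "bdd_below U")
      case bdd: True
      show ?thesis
      proof (cases "U = {}")
        case True then show ?thesis by (simp add: U_def)
      next
        case False
        note 2 = False bdd
      have "emeasure M {\<omega>\<in>space M. t < \<psi> (S \<omega>)} \<le> emeasure M {\<omega>\<in>space M. Inf U \<le> S \<omega>}"
        using 2 by (intro emeasure_mono) (auto simp: U_def intro: cInf_lower)
      also have "\<dots> \<le> emeasure M {\<omega>\<in>space M. Inf U < Z \<omega>}" using tail_pos by (simp add: emeasure_eq_measure)
      also have "\<dots> \<le> emeasure M {\<omega>\<in>space M. t < \<psi> (Z \<omega>)}"
      proof (intro emeasure_mono subsetI)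
        fix \<omega> assume "\<omega> \<in> {\<omega>\<in>space M. Inf U < Z \<omega>}"
        then obtain s where "s \<in> U" "s < Z \<omega>" "\<omega> \<in> space M" using cInf_less_iff[OF 2] by auto
        then show "\<omega> \<in> {\<omega>\<in>space M. t < \<psi> (Z \<omega>)}" using up[of s "Z \<omega>"] by (auto simp: U_def)
      qed measurable
      finally show ?thesis .
      qed
    next
      \<comment> \<open>An upward closed set that is unbounded below is the whole line.\<close>
      case 3: False
      have "Z \<omega> \<in> U" for \<omega>
      proof -
        obtain s where "s \<in> U" "s < Z \<omega>" using 3 unfolding bdd_below_def by (meson not_le)
        then show ?thesis using up[of s "Z \<omega>"] by simp
      qed
      then have "{\<omega>\<in>space M. t < \<psi> (Z \<omega>)} = space M" by (auto simp: U_def)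
      then show ?thesis using emeasure_space[of M "{\<omega>\<in>space M. t < \<psi> (S \<omega>)}"] by simp
    qed
  qed
  show ?thesis unfolding cake[OF assms(1)] cake[OF assms(2)]
  proof (rule nn_integral_mono)
    fix t :: real
    have "(\<integral>\<^sup>+\<omega>. indicator {0..} t * indicator {\<omega>\<in>space M. t < \<psi> (Y \<omega>)} \<omega> \<partial>M)
      = indicator {0..} t * emeasure M {\<omega>\<in>space M. t < \<psi> (Y \<omega>)}" if [measurable]: "Y \<in> borel_measurable M" for Y
      by (subst nn_integral_cmult) auto
    then show "(\<integral>\<^sup>+\<omega>. indicator {0..} t * indicator {\<omega>\<in>space M. t < \<psi> (S \<omega>)} \<omega> \<partial>M)
      \<le> (\<integral>\<^sup>+\<omega>. indicator {0..} t * indicator {\<omega>\<in>space M. t < \<psi> (Z \<omega>)} \<omega> \<partial>M)"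
      using level[of t] by (auto intro: mult_left_mono)
  qed
qed

subsection \<open>The maximal inequality\<close>

locale admissible_process =
  fixes T :: real and \<mu> :: "real measure" and N :: "'a measure"
    and \<F> :: "real \<Rightarrow> 'a measure" and X :: "real \<Rightarrow> 'a \<Rightarrow> real"
  assumes T: "0 < T" and adm: "admissible T \<mu> N \<F> X"

sublocale admissible_process \<subseteq> prob_space N
  using adm by (simp add: admissible_def)

context admissible_process begin

lemma subalgebra_filtration: "t \<in> {0..T} \<Longrightarrow> subalgebra N (\<F> t)"
  using adm unfolding admissible_def martingale_upto_def filtration_upto_def by blast

lemma subalgebra_filtration_mono: "s \<in> {0..T} \<Longrightarrow> t \<in> {0..T} \<Longrightarrow> s \<le> t \<Longrightarrow> subalgebra (\<F> t) (\<F> s)"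
  using adm unfolding admissible_def martingale_upto_def filtration_upto_def by blast

lemma adapted_X: "t \<in> {0..T} \<Longrightarrow> X t \<in> borel_measurable (\<F> t)"
  using adm unfolding admissible_def martingale_upto_def by blast

lemma integrable_X: "t \<in> {0..T} \<Longrightarrow> integrable N (X t)"
  using adm unfolding admissible_def martingale_upto_def by blast

lemma cadlag_X: "\<omega> \<in> space N \<Longrightarrow> cadlag_on T (\<lambda>t. X t \<omega>)"
  using adm unfolding admissible_def by blast

lemma law_X: "distr N borel (X T) = \<mu>"
  using adm unfolding admissible_def by blast

lemma T_mem: "T \<in> {0..T}" using T by simp

lemma measurable_X: "t \<in> {0..T} \<Longrightarrow> X t \<in> borel_measurable N"
  using integrable_X by blast

lemma measurable_max: "running_max T X \<in> borel_measurable N"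
  by (rule running_max_measurable[OF T cadlag_X measurable_X])

lemma X_le_max: "\<omega> \<in> space N \<Longrightarrow> t \<in> {0..T} \<Longrightarrow> X t \<omega> \<le> running_max T X \<omega>"
  unfolding running_max_def by (rule cSUP_upper[OF _ cadlag_on_bdd_above[OF cadlag_X]])

lemma max_ge: "AE \<omega> in N. 0 \<le> running_max T X \<omega> \<and> X T \<omega> \<le> running_max T X \<omega>"
proof -
  have "AE \<omega> in N. X 0 \<omega> = 0" using adm unfolding admissible_def by blast
  with AE_space show ?thesis
    by eventually_elim (use X_le_max[of _ 0] X_le_max[OF _ T_mem] T in force)
qed

lemma set_integral_terminal:
  assumes t: "t \<in> {0..T}" and A: "A \<in> sets (\<F> t)"
  shows "(\<integral>\<omega>\<in>A. X T \<omega> \<partial>N) = (\<integral>\<omega>\<in>A. X t \<omega> \<partial>N)"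
proof -
  interpret finite_measure_subalgebra N "\<F> t" by unfold_locales (rule subalgebra_filtration[OF t])
  have "AE \<omega> in N. real_cond_exp N (\<F> t) (X T) \<omega> = X t \<omega>"
    using adm t T_mem unfolding admissible_def martingale_upto_def by auto
  then have ae: "AE \<omega> in N. \<omega> \<in> A \<longrightarrow> real_cond_exp N (\<F> t) (X T) \<omega> = X t \<omega>" by eventually_elim simp
  have AN: "A \<in> sets N" using A subalgebra_filtration[OF t] by (auto simp: subalgebra_def)
  have "(\<integral>\<omega>\<in>A. X T \<omega> \<partial>N) = (\<integral>\<omega>\<in>A. real_cond_exp N (\<F> t) (X T) \<omega> \<partial>N)"
    by (rule real_cond_exp_intA[OF integrable_X[OF T_mem] A])
  also have "\<dots> = (\<integral>\<omega>\<in>A. X t \<omega> \<partial>N)"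
    unfolding set_lebesgue_integral_def
  proof (rule integral_cong_AE)
    show "AE \<omega> in N. indicator A \<omega> *\<^sub>R real_cond_exp N (\<F> t) (X T) \<omega> = indicator A \<omega> *\<^sub>R X t \<omega>"
      using ae by eventually_elim (auto simp: indicator_def)
  qed (use AN measurable_X[OF t] in simp_all)
  finally show ?thesis .
qed

lemma set_integrable_shift: "A \<in> sets N \<Longrightarrow> t \<in> {0..T} \<Longrightarrow> set_integrable N A (\<lambda>\<omega>. X t \<omega> - z)"
  unfolding set_integrable_def using integrable_X by (intro integrable_mult_indicator) auto

lemma set_integral_shift:
  assumes "A \<in> sets N" "t \<in> {0..T}"
  shows "(\<integral>\<omega>\<in>A. (X t \<omega> - z) \<partial>N) = (\<integral>\<omega>\<in>A. X t \<omega> \<partial>N) - z * prob A"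
proof -
  have "set_integrable N A (X t)" using set_integrable_shift[OF assms, of 0] by simp
  moreover have "set_integrable N A (\<lambda>_. z)"
    unfolding set_integrable_def using assms by (intro integrable_mult_indicator) auto
  ultimately have "(\<integral>\<omega>\<in>A. (X t \<omega> - z) \<partial>N) = (\<integral>\<omega>\<in>A. X t \<omega> \<partial>N) - (\<integral>\<omega>\<in>A. z \<partial>N)"
    by (rule set_integral_diff(2))
  then show ?thesis using assms by (simp add: set_lebesgue_integral_def mult.commute)
qed

text \<open>Induction on the largest time \<open>c\<close>. The event gains the part
  \<open>B\<close> on which \<open>z\<close> is exceeded at \<open>c\<close> for the first time;
  \<open>B\<close> is known at time \<open>c\<close>, so the terminal value may be replaced there by
  \<open>X c\<close>, which exceeds \<open>z\<close>.\<close>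

lemma doob_finite:
  assumes "finite K" "K \<subseteq> {0..T}"
  shows "0 \<le> (\<integral>\<omega>\<in>{\<omega>\<in>space N. \<exists>t\<in>K. z < X t \<omega>}. (X T \<omega> - z) \<partial>N)"
  using assms
proof (induction K rule: finite_linorder_max_induct)
  case empty then show ?case by (simp add: set_lebesgue_integral_def)
next
  case (insert c K)
  define A where "A = {\<omega>\<in>space N. \<exists>t\<in>K. z < X t \<omega>}"
  define B where "B = {\<omega>\<in>space N. z < X c \<omega>} - A"
  have c: "c \<in> {0..T}" and K: "K \<subseteq> {0..T}" using insert.prems by auto
  have sp: "space (\<F> c) = space N" using subalgebra_filtration[OF c] by (simp add: subalgebra_def)
  have meas: "X t \<in> borel_measurable (\<F> c)" if "t \<in> insert c K" for t
  proof -
    have "t \<le> c" "t \<in> {0..T}" using that insert.hyps K c by auto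
    then show ?thesis using measurable_from_subalg[OF subalgebra_filtration_mono adapted_X] c by blast
  qed
  have 1: "{\<omega>\<in>space N. z < X t \<omega>} \<in> sets (\<F> c)" if "t \<in> insert c K" for t
    using meas[OF that] unfolding sp[symmetric] by measurable
  have "A = (\<Union>t\<in>K. {\<omega>\<in>space N. z < X t \<omega>})" by (auto simp: A_def)
  then have AF: "A \<in> sets (\<F> c)" using 1 insert.hyps(1) by auto
  then have BF: "B \<in> sets (\<F> c)" using 1[of c] by (auto simp: B_def)
  have AN: "A \<in> sets N" and BN: "B \<in> sets N" using AF BF subalgebra_filtration[OF c] by (auto simp: subalgebra_def)
  have "(\<integral>\<omega>\<in>B. (X T \<omega> - z) \<partial>N) = (\<integral>\<omega>\<in>B. (X c \<omega> - z) \<partial>N)"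
    by (simp only: set_integral_shift[OF BN T_mem] set_integral_shift[OF BN c] set_integral_terminal[OF c BF])
  also have "\<dots> \<ge> 0"
    unfolding set_lebesgue_integral_def by (intro integral_nonneg_AE) (auto simp: B_def indicator_def)
  finally have B0: "0 \<le> (\<integral>\<omega>\<in>B. (X T \<omega> - z) \<partial>N)" .
  have "{\<omega>\<in>space N. \<exists>t\<in>insert c K. z < X t \<omega>} = A \<union> B" by (auto simp: A_def B_def)
  moreover have "(\<integral>\<omega>\<in>A \<union> B. (X T \<omega> - z) \<partial>N) = (\<integral>\<omega>\<in>A. (X T \<omega> - z) \<partial>N) + (\<integral>\<omega>\<in>B. (X T \<omega> - z) \<partial>N)"
    by (rule set_integral_Un) (auto simp: B_def intro!: set_integrable_shift AN BN[unfolded B_def] T_mem)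
  ultimately show ?case using insert.IH[OF K] B0 by (simp add: A_def)
qed

text \<open>With a strict inequality the event is the increasing union of the events for finite sets
  of times, since a supremum exceeds \<open>z\<close> iff some member does; dominated convergence
  applies.\<close>

lemma doob_less: "0 \<le> (\<integral>\<omega>\<in>{\<omega>\<in>space N. z < running_max T X \<omega>}. (X T \<omega> - z) \<partial>N)"
proof -
  note [measurable] = measurable_max measurable_X[OF T_mem]
  define K where "K n = (from_nat_into (dense_times T)) ` {..n::nat}" for n
  have ne: "dense_times T \<noteq> {}" by (simp add: dense_times_def)
  have K: "finite (K n)" "K n \<subseteq> {0..T}" for n
  proof -
    have "dense_times T \<subseteq> {0..T}" using T by (auto simp: dense_times_def)
    then show "finite (K n)" "K n \<subseteq> {0..T}" using from_nat_into[OF ne] by (auto simp: K_def)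
  qed
  have [measurable]: "{\<omega>\<in>space N. \<exists>t\<in>K n. z < X t \<omega>} \<in> sets N" for n
  proof -
    have "{\<omega>\<in>space N. \<exists>t\<in>K n. z < X t \<omega>} = (\<Union>t\<in>K n. {\<omega>\<in>space N. z < X t \<omega>})" by auto
    also have "\<dots> \<in> sets N"
    proof (intro sets.finite_UN K)
      fix t assume "t \<in> K n"
      then have [measurable]: "X t \<in> borel_measurable N" using K(2)[of n] by (intro measurable_X) auto
      show "{\<omega>\<in>space N. z < X t \<omega>} \<in> sets N" by measurable
    qed
    finally show ?thesis .
  qed
  have "(\<lambda>n. (\<integral>\<omega>\<in>{\<omega>\<in>space N. \<exists>t\<in>K n. z < X t \<omega>}. (X T \<omega> - z) \<partial>N))
    \<longlonglongrightarrow> (\<integral>\<omega>\<in>{\<omega>\<in>space N. z < running_max T X \<omega>}. (X T \<omega> - z) \<partial>N)"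
    unfolding set_lebesgue_integral_def
  proof (rule integral_dominated_convergence[where w = "\<lambda>\<omega>. \<bar>X T \<omega> - z\<bar>"])
    show "AE \<omega> in N. (\<lambda>n. indicator {\<omega>\<in>space N. \<exists>t\<in>K n. z < X t \<omega>} \<omega> *\<^sub>R (X T \<omega> - z))
      \<longlonglongrightarrow> indicator {\<omega>\<in>space N. z < running_max T X \<omega>} \<omega> *\<^sub>R (X T \<omega> - z)"
    proof (rule AE_I2)
      fix \<omega> assume \<omega>: "\<omega> \<in> space N"
      have bdd: "bdd_above ((\<lambda>t. X t \<omega>) ` dense_times T)"
        by (rule bdd_above_mono[OF cadlag_on_bdd_above[OF cadlag_X[OF \<omega>]]])
           (use T in \<open>auto simp: dense_times_def\<close>)
      have iff: "z < running_max T X \<omega> \<longleftrightarrow> (\<exists>t\<in>dense_times T. z < X t \<omega>)"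
        unfolding running_max_dense[where X = X and \<omega> = \<omega>, OF T cadlag_X[OF \<omega>]] by (rule less_cSUP_iff[OF ne bdd])
      have "\<forall>\<^sub>F n in sequentially. (\<exists>t\<in>K n. z < X t \<omega>) \<longleftrightarrow> z < running_max T X \<omega>"
      proof (cases "z < running_max T X \<omega>")
        case True
        then obtain t where t: "t \<in> dense_times T" "z < X t \<omega>" using iff by auto
        obtain m where m: "from_nat_into (dense_times T) m = t"
          using from_nat_into_surj[OF countable_dense_times t(1)] by auto
        show ?thesis
        proof (rule eventually_sequentiallyI)
          fix n assume "m \<le> n"
          then have "t \<in> K n" using m by (auto simp: K_def)
          then show "(\<exists>t\<in>K n. z < X t \<omega>) \<longleftrightarrow> z < running_max T X \<omega>" using t True by auto
        qed
      next
        case False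
        then show ?thesis using iff from_nat_into[OF ne] by (auto simp: K_def)
      qed
      then have "\<forall>\<^sub>F n in sequentially. indicator {\<omega>\<in>space N. \<exists>t\<in>K n. z < X t \<omega>} \<omega> *\<^sub>R (X T \<omega> - z)
        = indicator {\<omega>\<in>space N. z < running_max T X \<omega>} \<omega> *\<^sub>R (X T \<omega> - z)"
        by eventually_elim (simp add: indicator_def)
      then show "(\<lambda>n. indicator {\<omega>\<in>space N. \<exists>t\<in>K n. z < X t \<omega>} \<omega> *\<^sub>R (X T \<omega> - z))
        \<longlonglongrightarrow> indicator {\<omega>\<in>space N. z < running_max T X \<omega>} \<omega> *\<^sub>R (X T \<omega> - z)"
        by (rule tendsto_eventually)
    qed
    show "integrable N (\<lambda>\<omega>. \<bar>X T \<omega> - z\<bar>)" using integrable_X[OF T_mem] by simp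
    show "AE \<omega> in N. norm (indicator {\<omega>\<in>space N. \<exists>t\<in>K n. z < X t \<omega>} \<omega> *\<^sub>R (X T \<omega> - z)) \<le> \<bar>X T \<omega> - z\<bar>" for n
      by (auto simp: indicator_def)
  qed measurable
  then show ?thesis by (rule LIMSEQ_le_const) (use doob_finite[OF K] in auto)
qed

text \<open>Levels that increase strictly to \<open>z\<close> turn the strict inequality into the
  weak one, as needed for the closed tails in \<open>expectation_mono_dominated\<close>.\<close>

lemma doob: "0 \<le> (\<integral>\<omega>\<in>{\<omega>\<in>space N. z \<le> running_max T X \<omega>}. (X T \<omega> - z) \<partial>N)"
proof -
  note [measurable] = measurable_max measurable_X[OF T_mem]
  define \<zeta> where "\<zeta> n = z - 1 / real (Suc n)" for n
  have \<zeta>: "\<zeta> \<longlonglongrightarrow> z"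
    unfolding \<zeta>_def[abs_def] using tendsto_diff[OF tendsto_const LIMSEQ_Suc[OF lim_inverse_n'], of z] by simp
  have "(\<lambda>n. (\<integral>\<omega>\<in>{\<omega>\<in>space N. \<zeta> n < running_max T X \<omega>}. (X T \<omega> - \<zeta> n) \<partial>N))
    \<longlonglongrightarrow> (\<integral>\<omega>\<in>{\<omega>\<in>space N. z \<le> running_max T X \<omega>}. (X T \<omega> - z) \<partial>N)"
    unfolding set_lebesgue_integral_def
  proof (rule integral_dominated_convergence[where w = "\<lambda>\<omega>. \<bar>X T \<omega>\<bar> + \<bar>z\<bar> + 1"])
    show "AE \<omega> in N. (\<lambda>n. indicator {\<omega>\<in>space N. \<zeta> n < running_max T X \<omega>} \<omega> *\<^sub>R (X T \<omega> - \<zeta> n))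
      \<longlonglongrightarrow> indicator {\<omega>\<in>space N. z \<le> running_max T X \<omega>} \<omega> *\<^sub>R (X T \<omega> - z)"
    proof (rule AE_I2, intro tendsto_scaleR tendsto_diff tendsto_const \<zeta>)
      fix \<omega> assume "\<omega> \<in> space N"
      have "\<forall>\<^sub>F n in sequentially. \<zeta> n < running_max T X \<omega> \<longleftrightarrow> z \<le> running_max T X \<omega>"
      proof (cases "z \<le> running_max T X \<omega>")
        case True
        have "\<zeta> n < z" for n by (simp add: \<zeta>_def)
        then show ?thesis using True by (auto intro!: always_eventually intro: less_le_trans)
      next
        case False
        then have "running_max T X \<omega> < z" by simp
        from order_tendstoD(1)[OF \<zeta> this] show ?thesis by eventually_elim (use False in auto)
      qed
      then have "\<forall>\<^sub>F n in sequentially. indicator {\<omega>\<in>space N. \<zeta> n < running_max T X \<omega>} \<omega>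
        = (indicator {\<omega>\<in>space N. z \<le> running_max T X \<omega>} \<omega> :: real)"
        by eventually_elim (simp add: indicator_def)
      then show "(\<lambda>n. indicator {\<omega>\<in>space N. \<zeta> n < running_max T X \<omega>} \<omega> :: real)
        \<longlonglongrightarrow> indicator {\<omega>\<in>space N. z \<le> running_max T X \<omega>} \<omega>"
        by (rule tendsto_eventually)
    qed
    show "integrable N (\<lambda>\<omega>. \<bar>X T \<omega>\<bar> + \<bar>z\<bar> + 1)" using integrable_X[OF T_mem] by simp
    show "AE \<omega> in N. norm (indicator {\<omega>\<in>space N. \<zeta> n < running_max T X \<omega>} \<omega> *\<^sub>R (X T \<omega> - \<zeta> n)) \<le> \<bar>X T \<omega>\<bar> + \<bar>z\<bar> + 1" for n
    proof (rule AE_I2)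
      fix \<omega>
      have "\<bar>1 / real (Suc n)\<bar> \<le> 1" by simp
      then have "\<bar>\<zeta> n\<bar> \<le> \<bar>z\<bar> + 1" unfolding \<zeta>_def by linarith
      then show "norm (indicator {\<omega>\<in>space N. \<zeta> n < running_max T X \<omega>} \<omega> *\<^sub>R (X T \<omega> - \<zeta> n)) \<le> \<bar>X T \<omega>\<bar> + \<bar>z\<bar> + 1"
        by (auto simp: indicator_def)
    qed
  qed measurable
  then show ?thesis by (rule LIMSEQ_le_const) (use doob_less in auto)
qed

end

section \<open>Domination of the maximum by the barycenter of the terminal value\<close>

context centred_law begin

lemma AE_tail_pos: "AE x in \<mu>. x \<in> tail_pos"
proof -
  have [measurable]: "tail_pos \<in> sets borel"
    by (rule real_interval_borel_measurable) (auto simp: is_interval_1 intro: tail_pos_down)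
  have "AE v in unif. quant v \<in> tail_pos"
    using AE_unif by eventually_elim (simp add: quant_tail)
  then have "AE x in distr unif borel quant. x \<in> tail_pos" by (subst AE_distr_iff) auto
  then show ?thesis unfolding distr_quant .
qed

text \<open>The restriction to \<open>tail_pos\<close> removes the points where
  \<open>barycenter\<close> has only a default value. It costs no mass and makes the set an
  interval.\<close>

definition exceed :: "real \<Rightarrow> real set" where
  "exceed z = {w \<in> tail_pos. z < barycenter \<mu> w}"

lemma exceed_sets [measurable]: "exceed z \<in> sets borel"
proof (rule real_interval_borel_measurable)
  show "is_interval (exceed z)" unfolding is_interval_1
  proof (intro ballI allI impI)
    fix a b x assume "a \<in> exceed z" "b \<in> exceed z" "a \<le> x \<and> x \<le> b"
    then show "x \<in> exceed z"
      using tail_pos_down[of x b] barycenter_mono[of a x] by (auto simp: exceed_def)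
  qed
qed

text \<open>The worst case is an upper tail \<open>{k..}\<close> of the same mass as \<open>E\<close>; a slightly smaller tail that is not
  contained in \<open>exceed z\<close> yields the contradiction.\<close>

lemma prob_le_exceed:
  assumes "prob_space N" and [measurable]: "W \<in> borel_measurable N" and law: "distr N borel W = \<mu>"
    and E [measurable]: "E \<in> sets N" and pos: "0 \<le> (\<integral>\<omega>\<in>E. (W \<omega> - z) \<partial>N)"
  shows "measure N E \<le> measure \<mu> (exceed z)"
proof (rule ccontr)
  interpret N: prob_space N by fact
  assume "\<not> measure N E \<le> measure \<mu> (exceed z)"
  then have "measure \<mu> (exceed z) < measure N E" by simp
  from dense[OF this] obtain r where r: "measure \<mu> (exceed z) < r" "r < measure N E" by auto
  have r01: "0 < r" "r < 1"
    using r measure_nonneg[of \<mu> "exceed z"] N.prob_le_1[of E] by linarith+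
  define k where "k = quant (1 - r)"
  have k: "measure \<mu> {k..} = r" "k \<in> tail_pos" using quant_tail[of "1 - r"] r01 by (auto simp: k_def)
  have "k \<notin> exceed z"
  proof
    assume kz: "k \<in> exceed z"
    have "AE x in \<mu>. x \<in> {k..} \<longrightarrow> x \<in> exceed z"
      using AE_tail_pos
    proof eventually_elim
      case (elim x)
      then show ?case using kz barycenter_mono[of k x] by (auto simp: exceed_def)
    qed
    then have "measure \<mu> {k..} \<le> measure \<mu> (exceed z)" by (intro finite_measure_mono_AE) auto
    with k r show False by simp
  qed
  then have bz: "barycenter \<mu> k \<le> z" using k by (auto simp: exceed_def)
  then have kz: "k < z" using less_barycenter[OF k(2)] by simp
  have "integrable (distr N borel W) (\<lambda>x. x)" unfolding law by (rule integrable_id)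
  then have W_int: "integrable N W" by (subst (asm) integrable_distr_eq) auto
  have i1: "integrable N (\<lambda>\<omega>. indicator E \<omega> * (W \<omega> - k))"
    using integrable_mult_indicator[OF E, of "\<lambda>\<omega>. W \<omega> - k"] W_int by simp
  have i2: "integrable N (\<lambda>\<omega>. indicator E \<omega> * (k - z))"
    using integrable_mult_indicator[OF E, of "\<lambda>\<omega>. k - z"] by simp
  have i3: "integrable N (\<lambda>\<omega>. indicator {k..} (W \<omega>) * (W \<omega> - k))"
    by (rule Bochner_Integration.integrable_bound[of N "\<lambda>\<omega>. W \<omega> - k"])
       (use W_int in \<open>auto simp: indicator_def\<close>)
  have "(\<integral>\<omega>\<in>E. (W \<omega> - z) \<partial>N) = (\<integral>\<omega>. indicator E \<omega> * (W \<omega> - k) + indicator E \<omega> * (k - z) \<partial>N)"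
    unfolding set_lebesgue_integral_def by (intro Bochner_Integration.integral_cong) (auto simp: algebra_simps)
  also have "\<dots> = (\<integral>\<omega>. indicator E \<omega> * (W \<omega> - k) \<partial>N) + (k - z) * measure N E"
    by (subst Bochner_Integration.integral_add[OF i1 i2]) (simp add: mult.commute)
  also have "(\<integral>\<omega>. indicator E \<omega> * (W \<omega> - k) \<partial>N) \<le> (\<integral>\<omega>. indicator {k..} (W \<omega>) * (W \<omega> - k) \<partial>N)"
    by (rule integral_mono[OF i1 i3]) (auto simp: indicator_def)
  also have "\<dots> = (\<integral>x. indicator {k..} x * (x - k) \<partial>distr N borel W)"
    by (subst integral_distr) auto
  also have "\<dots> = (barycenter \<mu> k - k) * r"
    unfolding law barycenter_shift[OF k(2)] k(1) ..
  also have "\<dots> \<le> (z - k) * r" using bz r01 by (intro mult_right_mono) auto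
  finally have "(\<integral>\<omega>\<in>E. (W \<omega> - z) \<partial>N) \<le> (z - k) * (r - measure N E)" by (simp add: algebra_simps)
  also have "\<dots> < 0" using kz r by (simp add: mult_pos_neg)
  finally show False using pos by simp
qed

end

subsection \<open>Optimality\<close>

lemma ennreal_le_add:
  fixes x y z :: real
  assumes "x \<le> y + z"
  shows "ennreal x \<le> ennreal y + ennreal z"
proof -
  have "ennreal x \<le> ennreal (max 0 y + max 0 z)" using assms by (intro ennreal_leI) auto
  also have "\<dots> = ennreal (max 0 y) + ennreal (max 0 z)" by (rule ennreal_plus) auto
  finally show ?thesis by (simp only: ennreal_max_0)
qed

section \<open>The payoff capped at the ridge\<close>

locale serrated_payoff =
  fixes F :: "real \<Rightarrow> real \<Rightarrow> real" and a :: "real \<Rightarrow> ereal"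
  assumes cont: "continuous_on UNIV (\<lambda>(w, s). F w s)"
    and super: "strictly_supermodular F"
    and serr: "serrated_with_ridge F a"
begin

lemma cont_section: "isCont (F w) s"
proof -
  have "continuous_on UNIV (\<lambda>s. (\<lambda>(w, s). F w s) (w, s))"
    by (rule continuous_on_compose2[OF cont]) (auto intro!: continuous_intros)
  then show ?thesis by (simp add: continuous_on_eq_continuous_at)
qed

text \<open>The serrated shape is assumed strictly below the ridge only; continuity adds the ridge
  point itself.\<close>

lemma F_up:
  assumes "s \<le> t" "ereal t \<le> a w"
  shows "F w s \<le> F w t"
proof (cases "s = t")
  case False
  then have st: "s < t" using assms by simp
  have "\<forall>\<^sub>F u in at_left t. s < u \<and> u < t" by (rule eventually_at_left_Ioo[OF st])
  then have "\<forall>\<^sub>F u in at_left t. F w s \<le> F w u"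
  proof eventually_elim
    case (elim u)
    have "ereal u < ereal t" using elim by simp
    then have "ereal u < a w" using assms(2) by (rule less_le_trans)
    moreover have "ereal s < a w" using calculation elim by (auto intro: less_trans[of "ereal s" "ereal u"])
    ultimately show ?case using serr elim unfolding serrated_with_ridge_def mono_on_def by auto
  qed
  moreover have "(F w \<longlongrightarrow> F w t) (at_left t)"
    using cont_section[where w = w and s = t] by (simp add: isCont_def filterlim_at_split)
  ultimately show ?thesis by (intro tendsto_lowerbound) auto
qed simp

lemma F_down:
  assumes "s \<le> t" "a w \<le> ereal s"
  shows "F w t \<le> F w s"
proof (cases "s = t")
  case False
  then have st: "s < t" using assms by simp
  have "\<forall>\<^sub>F u in at_right s. s < u \<and> u < t" by (rule eventually_at_right_Ioo[OF st])
  then have "\<forall>\<^sub>F u in at_right s. F w t \<le> F w u"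
  proof eventually_elim
    case (elim u)
    have "ereal s < ereal u" using elim by simp
    with assms(2) have "a w < ereal u" by (rule le_less_trans)
    moreover have "a w < ereal t" using calculation elim by (auto intro: less_trans[of _ "ereal u"])
    ultimately show ?case using serr elim unfolding serrated_with_ridge_def monotone_on_def by auto
  qed
  moreover have "(F w \<longlongrightarrow> F w s) (at_right s)"
    using cont_section[where w = w and s = s] by (simp add: isCont_def filterlim_at_split)
  ultimately show ?thesis by (intro tendsto_lowerbound) auto
qed simp

lemma super_less: "w < w' \<Longrightarrow> s < t \<Longrightarrow> F w t - F w s < F w' t - F w' s"
  using super unfolding strictly_supermodular_def by (simp add: algebra_simps)

text \<open>If the ridge were lower at \<open>w'\<close> than at \<open>w\<close>, then between the
  two heights \<open>F w\<close> would rise and \<open>F w'\<close> would fall, against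
  supermodularity.\<close>

lemma a_mono: "mono a"
proof (rule monoI, rule ccontr)
  fix w w' :: real assume "w \<le> w'" "\<not> a w \<le> a w'"
  then have w: "w < w'" and lt: "a w' < a w" by (auto simp: less_le not_le)
  obtain s where s: "a w' < ereal s" "ereal s < a w" using ereal_dense2[OF lt] by auto
  obtain t where t: "ereal s < ereal t" "ereal t < a w" using ereal_dense2[OF s(2)] by auto
  have "F w s \<le> F w t" using s t by (intro F_up) auto
  moreover have "F w' t \<le> F w' s" using s t by (intro F_down) auto
  ultimately show False using super_less[OF w, of s t] t by simp
qed

text \<open>The cap is cut at 0 because the maximum of a process started in 0 is never smaller. This
  also keeps the value finite for an infinite ridge, provided that \<open>s \<ge> 0\<close>.\<close>

definition clip :: "real \<Rightarrow> real \<Rightarrow> real" where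
  "clip w s = real_of_ereal (min (ereal s) (max 0 (a w)))"

lemma clip_ereal: "0 \<le> s \<Longrightarrow> ereal (clip w s) = min (ereal s) (max 0 (a w))"
proof -
  assume "0 \<le> s"
  then have "0 \<le> min (ereal s) (max 0 (a w))" "min (ereal s) (max 0 (a w)) \<le> ereal s" by auto
  then have "\<bar>min (ereal s) (max 0 (a w))\<bar> \<noteq> \<infinity>"
    by (cases "min (ereal s) (max 0 (a w))") (simp_all only: abs_ereal.simps ereal_less_eq, simp_all)
  then show ?thesis by (simp add: clip_def ereal_real)
qed

lemma clip_mono: "0 \<le> s \<Longrightarrow> s \<le> t \<Longrightarrow> w \<le> w' \<Longrightarrow> clip w s \<le> clip w' t"
proof -
  assume *: "0 \<le> s" "s \<le> t" "w \<le> w'"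
  then have "ereal (clip w s) \<le> ereal (clip w' t)"
    using monoD[OF a_mono *(3)] by (simp only: clip_ereal) (intro min.mono max.mono, auto simp: clip_ereal)
  then show ?thesis by simp
qed

lemma clip_bounds: "0 \<le> s \<Longrightarrow> 0 \<le> clip w s \<and> clip w s \<le> s"
proof -
  assume s: "0 \<le> s"
  have "ereal 0 \<le> ereal (clip w s)" "ereal (clip w s) \<le> ereal s"
    using s by (auto simp: clip_ereal zero_ereal_def[symmetric])
  then show ?thesis by simp
qed

lemma clip_le_a: "0 \<le> s \<Longrightarrow> 0 < clip w s \<Longrightarrow> ereal (clip w s) \<le> a w"
proof -
  assume s: "0 \<le> s" "0 < clip w s"
  then have "0 < ereal (clip w s)" by simp
  then show ?thesis using s by (auto simp: clip_ereal min_def max_def split: if_splits)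
qed

lemma F_clip_mono: "0 \<le> s \<Longrightarrow> s \<le> t \<Longrightarrow> F w (clip w s) \<le> F w (clip w t)"
proof -
  assume st: "0 \<le> s" "s \<le> t"
  have le: "clip w s \<le> clip w t" by (rule clip_mono[OF st order_refl])
  show ?thesis
  proof (cases "0 < clip w t")
    case True then show ?thesis using le st by (intro F_up clip_le_a) auto
  next
    case False
    then have "clip w s = clip w t" using le clip_bounds[of s w] st by auto
    then show ?thesis by simp
  qed
qed

definition lift :: "real \<Rightarrow> real \<Rightarrow> real" where
  "lift w s = F w (clip w s) - F w 0"

lemma clip_zero: "clip w 0 = 0"
  using clip_bounds[of 0 w] by simp

lemma clip_eq: "0 \<le> s \<Longrightarrow> s \<le> t \<Longrightarrow> clip w s < clip w t \<Longrightarrow> w \<le> w' \<Longrightarrow> clip w' s = s"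
proof -
  assume st: "0 \<le> s" "s \<le> t" and lt: "clip w s < clip w t" and w: "w \<le> w'"
  have "ereal s < max 0 (a w)"
  proof (rule ccontr)
    assume "\<not> ereal s < max 0 (a w)"
    then have le: "max 0 (a w) \<le> ereal s" by (simp only: not_less)
    also have "ereal s \<le> ereal t" using st by simp
    finally have "ereal (clip w s) = ereal (clip w t)"
      using le st by (simp only: clip_ereal min_absorb2 order_trans[OF st])
    then show False using lt by simp
  qed
  also have "\<dots> \<le> max 0 (a w')" by (rule max.mono[OF order_refl monoD[OF a_mono w]])
  finally have "ereal (clip w' s) = ereal s" using st by (simp add: clip_ereal)
  then show ?thesis by simp
qed

text \<open>If the capped level still moves at \<open>w\<close>, then \<open>s\<close> is below the
  ridge at \<open>w\<close> and, the ridge being nondecreasing, at \<open>w'\<close>; both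
  increments start from \<open>s\<close>. Supermodularity compares them up to
  \<open>clip w t\<close>, and the rest of the way to \<open>clip w' t\<close> is uphill for
  \<open>F w'\<close>. If it does not move, the left side is 0.\<close>

lemma lift_incr:
  assumes "w \<le> w'" "0 \<le> s" "s \<le> t"
  shows "lift w t - lift w s \<le> lift w' t - lift w' s"
proof (cases "clip w s < clip w t \<and> w < w'")
  case True
  then have eq: "clip w s = s" "clip w' s = s" using clip_eq[of s t w w] clip_eq[of s t w w'] assms by simp_all
  have "F w (clip w t) - F w s < F w' (clip w t) - F w' s"
    using True eq by (intro super_less) auto
  also have "F w' (clip w t) \<le> F w' (clip w' t)"
  proof (rule F_up)
    show "clip w t \<le> clip w' t" using assms by (intro clip_mono) auto
    then show "ereal (clip w' t) \<le> a w'" using True eq assms by (intro clip_le_a) auto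
  qed
  finally show ?thesis by (simp add: lift_def eq)
next
  case False
  then have "w = w' \<or> lift w t = lift w s"
    using assms clip_mono[of s t w w] by (auto simp: lift_def)
  then show ?thesis using F_clip_mono[of s t w'] assms by (auto simp: lift_def)
qed

lemma F_measurable [measurable]: "(\<lambda>x. F (fst x) (snd x)) \<in> borel_measurable (borel \<Otimes>\<^sub>M borel)"
  using borel_measurable_continuous_onI[OF cont] by (simp add: borel_prod split_beta')

lemma a_measurable [measurable]: "a \<in> borel_measurable borel"
  by (rule mono_borel_measurable_ereal[OF a_mono])

lemma F_compose [measurable (raw)]:
  assumes [measurable]: "f \<in> borel_measurable M" "g \<in> borel_measurable M"
  shows "(\<lambda>x. F (f x) (g x)) \<in> borel_measurable M"
  using measurable_compose[OF measurable_Pair[OF assms] F_measurable] by simp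

lemma clip_compose [measurable (raw)]:
  assumes [measurable]: "f \<in> borel_measurable M" "g \<in> borel_measurable M"
  shows "(\<lambda>x. clip (f x) (g x)) \<in> borel_measurable M"
  unfolding clip_def by measurable

lemma lift_compose [measurable (raw)]:
  assumes [measurable]: "f \<in> borel_measurable M" "g \<in> borel_measurable M"
  shows "(\<lambda>x. lift (f x) (g x)) \<in> borel_measurable M"
  unfolding lift_def by measurable

text \<open>Above the ridge \<open>F w\<close> descends, so nothing is lost by lowering
  \<open>s\<close> to the ridge, or to the larger of 0 and \<open>w\<close> if the ridge is below
  that.\<close>

lemma F_le_clip:
  assumes s: "0 \<le> s" "w \<le> s"
  shows "F w s \<le> F w (max w (clip w s))"
proof (cases "ereal s \<le> max 0 (a w)")
  case True
  then have "ereal (clip w s) = ereal s" using s by (simp add: clip_ereal)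
  then show ?thesis using s by (simp add: max_def)
next
  case False
  then have "ereal (clip w s) = max 0 (a w)" using s by (simp add: clip_ereal min_def)
  then have "a w \<le> ereal (max w (clip w s))"
    by (metis ereal_less_eq(3) max.cobounded2 order_trans)
  moreover have "max w (clip w s) \<le> s" using s clip_bounds[of s w] by auto
  ultimately show ?thesis by (intro F_down)
qed

end

section \<open>Comparison of expectations\<close>

locale optimality = centred_law + serrated_payoff
begin

sublocale payoff: monotone_payoff lift "barycenter \<mu>" tail_pos
proof
  show "lift w 0 = 0" for w by (simp add: lift_def clip_zero)
  show "lift w s \<le> lift w t" if "0 \<le> s" "s \<le> t" for w s t using F_clip_mono[OF that] by (simp add: lift_def)
  show "lift w t - lift w s \<le> lift w' t - lift w' s" if "w \<le> w'" "0 \<le> s" "s \<le> t" for w w' s t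
    by (rule lift_incr[OF that])
  show "barycenter \<mu> w \<le> barycenter \<mu> w'" if "w \<in> tail_pos" "w' \<in> tail_pos" "w \<le> w'" for w w'
    by (rule barycenter_mono[OF that(3,2)])
  show "0 \<le> barycenter \<mu> w" if "w \<in> tail_pos" for w by (rule barycenter_nonneg[OF that])
qed

lemma ridge_clip:
  assumes w: "w \<in> tail_pos"
  shows "ridge_map \<mu> a w = max w (clip w (barycenter \<mu> w))"
proof -
  have b: "0 \<le> barycenter \<mu> w" "w \<le> barycenter \<mu> w"
    using barycenter_nonneg[OF w] less_barycenter[OF w] by auto
  have "ereal (ridge_map \<mu> a w) = ereal (max w (clip w (barycenter \<mu> w)))"
  proof -
    have wb: "ereal w \<le> ereal (barycenter \<mu> w)" using b by simp
    \<comment> \<open>With \<open>w\<close> outermost, distributivity and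
      \<open>w \<le> \<beta> w\<close> pull it out of the minimum.\<close>
    have "max (a w) (max 0 (ereal w)) = max (ereal w) (max 0 (a w))" by (simp only: ac_simps)
    then have "min (ereal (barycenter \<mu> w)) (max (a w) (max 0 (ereal w)))
      = max (ereal w) (min (ereal (barycenter \<mu> w)) (max 0 (a w)))"
      using wb by (simp only: min_max_distrib2 min_absorb2)
    then show ?thesis unfolding ridge_map_ereal[OF a_mono w] ereal_max clip_ereal[OF b(1)] .
  qed
  then show ?thesis by (simp only: ereal.inject)
qed

text \<open>By \<open>F_le_clip\<close> only the maximum with \<open>w\<close> separates the two
  sides. If \<open>w\<close> is at most 0 or at most the ridge, this maximum has no effect on the
  levels concerned. Otherwise the cap binds at every level from \<open>w\<close> upwards, and both
  differences are 0.\<close>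

lemma payoff_le:
  assumes w: "w \<in> tail_pos" and s: "0 \<le> s" "w \<le> s"
  shows "F w s - F w (ridge_map \<mu> a w) \<le> lift w s - lift w (barycenter \<mu> w)"
proof -
  have b: "0 \<le> barycenter \<mu> w" "w \<le> barycenter \<mu> w"
    using barycenter_nonneg[OF w] less_barycenter[OF w] by auto
  have eq: "F w (max w (clip w s)) - F w (max w (clip w (barycenter \<mu> w))) = F w (clip w s) - F w (clip w (barycenter \<mu> w))"
  proof (cases "w \<le> 0 \<or> ereal w \<le> a w")
    case True
    have "w \<le> clip w u" if "0 \<le> u" "w \<le> u" for u
    proof -
      have "ereal w \<le> max 0 (a w)" using True by (auto simp: le_max_iff_disj)
      then have "ereal w \<le> ereal (clip w u)" using that by (simp add: clip_ereal)
      then show ?thesis by simp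
    qed
    then show ?thesis using s b by (simp add: max_def)
  next
    case False
    have "clip w u = clip w w" if "w \<le> u" for u
    proof -
      have "max 0 (a w) \<le> ereal w" using False by auto
      moreover have "ereal w \<le> ereal u" using that by simp
      ultimately have "max 0 (a w) \<le> ereal u" by (rule order_trans)
      moreover have "0 \<le> w" "0 \<le> u" using False that by auto
      ultimately have "ereal (clip w u) = ereal (clip w w)"
        using \<open>max 0 (a w) \<le> ereal w\<close> by (simp only: clip_ereal min_absorb2)
      then show ?thesis by simp
    qed
    from this[OF s(2)] this[OF b(2)] show ?thesis by simp
  qed
  show ?thesis using F_le_clip[OF s] eq unfolding ridge_clip[OF w] lift_def by simp
qed

context
  fixes N :: "'a measure" and W S :: "'a \<Rightarrow> real"
  assumes N: "prob_space N" and W [measurable]: "W \<in> borel_measurable N" and S [measurable]: "S \<in> borel_measurable N"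
    and law: "distr N borel W = \<mu>" and SW: "AE \<omega> in N. 0 \<le> S \<omega> \<and> W \<omega> \<le> S \<omega>"
    and dominated: "\<And>z. measure N {\<omega>\<in>space N. z \<le> S \<omega>} \<le> measure \<mu> (exceed z)"
begin

lemma AE_law: "AE x in \<mu>. P x \<Longrightarrow> AE \<omega> in N. P (W \<omega>)"
proof (rule AE_distrD[of W N borel P])
  assume "AE x in \<mu>. P x"
  then show "AE x in distr N borel W. P x" unfolding law .
qed simp

lemma AE_W: "AE \<omega> in N. W \<omega> \<in> tail_pos" by (rule AE_law[OF AE_tail_pos])

text \<open>The Azema-Yor maximum for the terminal value \<open>W\<close>; it serves as reference
  level on the competitor's own probability space.\<close>

definition Z :: "'a \<Rightarrow> real" where "Z \<omega> = barycenter \<mu> (W \<omega>)"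

lemma Z_measurable [measurable]: "Z \<in> borel_measurable N"
  unfolding Z_def[abs_def] by measurable

lemma prob_exceed: "measure \<mu> (exceed z) = measure N {\<omega>\<in>space N. z < Z \<omega>}"
proof -
  interpret N: prob_space N by (rule N)
  have "measure \<mu> (exceed z) = measure (distr N borel W) (exceed z)" by (simp add: law)
  also have "\<dots> = measure N (W -` exceed z \<inter> space N)" by (rule measure_distr) measurable
  also have "\<dots> = measure N {\<omega>\<in>space N. z < Z \<omega>}"
  proof (rule N.finite_measure_eq_AE)
    show "AE \<omega> in N. \<omega> \<in> W -` exceed z \<inter> space N \<longleftrightarrow> \<omega> \<in> {\<omega>\<in>space N. z < Z \<omega>}"
      using AE_W by eventually_elim (auto simp: exceed_def Z_def)
  qed (use measurable_sets[OF W exceed_sets] in auto)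
  finally show ?thesis .
qed

text \<open>If the barycenters are bounded with supremum \<open>c\<close>, then
  \<open>exceed c\<close> is empty and domination excludes \<open>S \<ge> c\<close>; below
  \<open>c\<close> some barycenter lies above \<open>S\<close>. If they are unbounded, every level
  is exceeded.\<close>

lemma AE_level: "AE \<omega> in N. S \<omega> \<in> payoff.level"
proof -
  interpret N: prob_space N by (rule N)
  have "AE \<omega> in N. \<exists>w\<in>tail_pos. S \<omega> \<le> barycenter \<mu> w"
  proof (cases "bdd_above (barycenter \<mu> ` tail_pos)")
    case True
    define c where "c = (SUP w\<in>tail_pos. barycenter \<mu> w)"
    have "exceed c = {}"
      using cSUP_upper[OF _ True] by (force simp: exceed_def c_def)
    then have "measure N {\<omega>\<in>space N. c \<le> S \<omega>} = 0"
      using dominated[of c] measure_nonneg[of N "{\<omega>\<in>space N. c \<le> S \<omega>}"] by simp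
    then have "AE \<omega> in N. \<not> c \<le> S \<omega>" by (subst (asm) N.prob_eq_0) auto
    then show ?thesis
    proof eventually_elim
      case (elim \<omega>)
      have "tail_pos \<noteq> {}" using quant_tail(3)[of "1/2"] by auto
      then obtain w where "w \<in> tail_pos" "S \<omega> < barycenter \<mu> w"
        using elim less_cSUP_iff[OF _ True, of "S \<omega>"] by (auto simp: c_def not_le)
      then show ?case by (auto intro: less_imp_le)
    qed
  next
    case False
    then have "\<exists>w\<in>tail_pos. s \<le> barycenter \<mu> w" for s
      unfolding bdd_above_def by (auto simp: not_le intro: less_imp_le)
    then show ?thesis by simp
  qed
  with SW show ?thesis by eventually_elim (auto simp: payoff.level_def)
qed

definition gain :: "'a \<Rightarrow> real" where
  "gain \<omega> = lift (W \<omega>) (S \<omega>) - lift (W \<omega>) (Z \<omega>)"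

lemma gain_measurable [measurable]: "gain \<in> borel_measurable N"
  unfolding gain_def[abs_def] by measurable

lemma AE_gain: "AE \<omega> in N. S \<omega> \<in> payoff.level \<and> Z \<omega> \<in> payoff.level
    \<and> gain \<omega> \<le> payoff.potential (S \<omega>) - payoff.potential (Z \<omega>)"
  using AE_level AE_W
proof eventually_elim
  case (elim \<omega>)
  then show ?case unfolding gain_def Z_def
    using payoff.potential_dual[of "W \<omega>" "S \<omega>"] payoff.levelI[of "W \<omega>"] barycenter_nonneg[of "W \<omega>"] by auto
qed

lemma trunc_measurable [measurable]: "payoff.trunc n \<in> borel_measurable borel"
  by (rule borel_measurable_mono[OF payoff.trunc_mono])

text \<open>The potential difference bounds the gain, but its mean may be undefined. Its truncations
  have mean at most 0, so their positive parts have at most the mean of their negative parts, which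
  are dominated by the negative part of the gain. Fatou's lemma removes the truncation.\<close>

lemma gain_balance: "(\<integral>\<^sup>+\<omega>. ennreal (gain \<omega>) \<partial>N) \<le> (\<integral>\<^sup>+\<omega>. ennreal (- gain \<omega>) \<partial>N)"
proof -
  interpret N: prob_space N by (rule N)
  let ?d = "\<lambda>n \<omega>. payoff.trunc n (S \<omega>) - payoff.trunc n (Z \<omega>)"
  have trunc_int: "integrable N (\<lambda>\<omega>. payoff.trunc n (Y \<omega>))" if [measurable]: "Y \<in> borel_measurable N" for n Y
    by (rule N.integrable_const_bound[of _ "real n"]) (auto simp: payoff.trunc_bounds abs_le_iff intro: order_trans[OF _ payoff.trunc_bounds(1)])
  have step: "(\<integral>\<^sup>+\<omega>. ennreal (?d n \<omega>) \<partial>N) \<le> (\<integral>\<^sup>+\<omega>. ennreal (- gain \<omega>) \<partial>N)" for n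
  proof -
    have "(\<integral>\<^sup>+\<omega>. ennreal (payoff.trunc n (S \<omega>)) \<partial>N) \<le> (\<integral>\<^sup>+\<omega>. ennreal (payoff.trunc n (Z \<omega>)) \<partial>N)"
      using dominated payoff.trunc_mono unfolding prob_exceed by (intro N.expectation_mono_dominated) auto
    then have E: "(\<integral>\<omega>. payoff.trunc n (S \<omega>) \<partial>N) \<le> (\<integral>\<omega>. payoff.trunc n (Z \<omega>) \<partial>N)"
      using trunc_int payoff.trunc_bounds(1)
      by (simp add: nn_integral_eq_integral ennreal_le_iff integral_nonneg_AE)
    have di: "integrable N (?d n)" using trunc_int by auto
    have dp: "integrable N (\<lambda>\<omega>. max 0 (?d n \<omega>))" by (rule integrable_max[OF integrable_zero di])
    have dm: "integrable N (\<lambda>\<omega>. max 0 (- ?d n \<omega>))"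
      by (rule integrable_max[OF integrable_zero Bochner_Integration.integrable_minus[OF di]])
    have "(\<integral>\<omega>. max 0 (?d n \<omega>) \<partial>N) - (\<integral>\<omega>. max 0 (- ?d n \<omega>) \<partial>N) = (\<integral>\<omega>. max 0 (?d n \<omega>) - max 0 (- ?d n \<omega>) \<partial>N)"
      by (rule Bochner_Integration.integral_diff[OF dp dm, symmetric])
    also have "\<dots> = (\<integral>\<omega>. ?d n \<omega> \<partial>N)" by (intro Bochner_Integration.integral_cong) auto
    also have "\<dots> \<le> 0" using E trunc_int by simp
    finally have "(\<integral>\<omega>. max 0 (?d n \<omega>) \<partial>N) \<le> (\<integral>\<omega>. max 0 (- ?d n \<omega>) \<partial>N)" by simp
    then have "(\<integral>\<^sup>+\<omega>. ennreal (max 0 (?d n \<omega>)) \<partial>N) \<le> (\<integral>\<^sup>+\<omega>. ennreal (max 0 (- ?d n \<omega>)) \<partial>N)"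
      by (subst nn_integral_eq_integral[OF dp], simp, subst nn_integral_eq_integral[OF dm], simp, rule ennreal_leI)
    also have "\<dots> \<le> (\<integral>\<^sup>+\<omega>. ennreal (- gain \<omega>) \<partial>N)"
    proof (rule nn_integral_mono_AE)
      show "AE \<omega> in N. ennreal (max 0 (- ?d n \<omega>)) \<le> ennreal (- gain \<omega>)"
        using AE_gain
      proof eventually_elim
        case (elim \<omega>)
        \<comment> \<open>Truncation at \<open>n\<close> is nondecreasing and does not enlarge
          differences.\<close>
        have "- ?d n \<omega> \<le> max 0 (payoff.potential (Z \<omega>) - payoff.potential (S \<omega>))"
          using elim by (auto simp: payoff.trunc_def payoff.level_def min_def max_def)
        then show ?case using elim by (auto simp: max_def ennreal_neg split: if_splits intro!: ennreal_leI)
      qed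
    qed
    finally show ?thesis by (simp add: max.commute ennreal_max_0)
  qed
  \<comment> \<open>For almost every outcome both potentials are finite, so the truncation is
    inactive from some \<open>n\<close> on.\<close>
  have "(\<integral>\<^sup>+\<omega>. ennreal (gain \<omega>) \<partial>N) \<le> (\<integral>\<^sup>+\<omega>. liminf (\<lambda>n. ennreal (?d n \<omega>)) \<partial>N)"
  proof (rule nn_integral_mono_AE)
    show "AE \<omega> in N. ennreal (gain \<omega>) \<le> liminf (\<lambda>n. ennreal (?d n \<omega>))"
      using AE_gain
    proof eventually_elim
      case (elim \<omega>)
      obtain m :: nat where m: "payoff.potential (S \<omega>) \<le> real m" "payoff.potential (Z \<omega>) \<le> real m"
        using real_arch_simple[of "max (payoff.potential (S \<omega>)) (payoff.potential (Z \<omega>))"] by auto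
      have "\<forall>\<^sub>F n in sequentially. ennreal (gain \<omega>) \<le> ennreal (?d n \<omega>)"
      proof (rule eventually_sequentiallyI)
        fix n assume "m \<le> n"
        then have "?d n \<omega> = payoff.potential (S \<omega>) - payoff.potential (Z \<omega>)"
          using m elim by (auto simp: payoff.trunc_def payoff.level_def)
        then show "ennreal (gain \<omega>) \<le> ennreal (?d n \<omega>)" using elim by (intro ennreal_leI) simp
      qed
      then show ?case by (rule Liminf_bounded)
    qed
  qed
  also have "\<dots> \<le> liminf (\<lambda>n. \<integral>\<^sup>+\<omega>. ennreal (?d n \<omega>) \<partial>N)"
    by (rule nn_integral_liminf) measurable
  also have "\<dots> \<le> (\<integral>\<^sup>+\<omega>. ennreal (- gain \<omega>) \<partial>N)"
    by (rule Liminf_le) (use step in auto)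
  finally show ?thesis .
qed

text \<open>If the positive part of \<open>Y\<close> or the negative part of \<open>Z'\<close> has
  infinite integral, then \<open>v = \<infinity>\<close> or \<open>v' = - \<infinity>\<close>.
  Otherwise these two parts bound the negative part of the gain, \<open>gain_balance\<close> bounds
  its positive part, and then \<open>Y\<close>, \<open>Z'\<close> and the gain are all
  integrable.\<close>

lemma expectation_le:
  assumes v: "has_expectation N (\<lambda>\<omega>. F (W \<omega>) (ridge_map \<mu> a (W \<omega>))) v"
    and v': "has_expectation N (\<lambda>\<omega>. F (W \<omega>) (S \<omega>)) v'"
  shows "v' \<le> v"
proof -
  interpret N: prob_space N by (rule N)
  define Y where "Y \<omega> = F (W \<omega>) (ridge_map \<mu> a (W \<omega>))" for \<omega>
  define Z' where "Z' \<omega> = F (W \<omega>) (S \<omega>)" for \<omega>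
  have [measurable]: "ridge_map \<mu> a \<in> borel_measurable borel" by (rule ridge_map_measurable[OF a_mono])
  have Y [measurable]: "Y \<in> borel_measurable N" unfolding Y_def[abs_def] by measurable
  have Z' [measurable]: "Z' \<in> borel_measurable N" unfolding Z'_def[abs_def] by measurable
  have le: "AE \<omega> in N. Z' \<omega> - Y \<omega> \<le> gain \<omega>"
    using AE_W SW
  proof eventually_elim
    case (elim \<omega>)
    then show ?case unfolding Y_def Z'_def gain_def Z_def by (intro payoff_le) auto
  qed
  let ?Yp = "\<integral>\<^sup>+\<omega>. ennreal (Y \<omega>) \<partial>N" and ?Ym = "\<integral>\<^sup>+\<omega>. ennreal (- Y \<omega>) \<partial>N"
  let ?Zp = "\<integral>\<^sup>+\<omega>. ennreal (Z' \<omega>) \<partial>N" and ?Zm = "\<integral>\<^sup>+\<omega>. ennreal (- Z' \<omega>) \<partial>N"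
  have v_eq: "v = enn2ereal ?Yp - enn2ereal ?Ym" and vq: "?Yp < \<infinity> \<or> ?Ym < \<infinity>"
    using v by (auto simp: has_expectation_def Y_def)
  have v'_eq: "v' = enn2ereal ?Zp - enn2ereal ?Zm" and vq': "?Zp < \<infinity> \<or> ?Zm < \<infinity>"
    using v' by (auto simp: has_expectation_def Z'_def)
  show ?thesis
  proof (cases "?Yp < \<infinity> \<and> ?Zm < \<infinity>")
    case False
    then have "v = \<infinity> \<or> v' = - \<infinity>"
      using vq vq' unfolding v_eq v'_eq
      by (cases ?Yp; cases ?Ym; cases ?Zp; cases ?Zm) (auto simp: top_ennreal.rep_eq enn2ereal_ennreal)
    then show ?thesis by auto
  next
    case True
    have mono: "(\<integral>\<^sup>+\<omega>. ennreal (f \<omega>) \<partial>N) < \<infinity>"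
      if "AE \<omega> in N. f \<omega> \<le> g \<omega> + h \<omega>" and [measurable]: "g \<in> borel_measurable N" "h \<in> borel_measurable N"
        and "(\<integral>\<^sup>+\<omega>. ennreal (g \<omega>) \<partial>N) < \<infinity>" "(\<integral>\<^sup>+\<omega>. ennreal (h \<omega>) \<partial>N) < \<infinity>"
      for f g h :: "'a \<Rightarrow> real"
    proof -
      have "(\<integral>\<^sup>+\<omega>. ennreal (f \<omega>) \<partial>N) \<le> (\<integral>\<^sup>+\<omega>. ennreal (g \<omega>) + ennreal (h \<omega>) \<partial>N)"
        using that(1) by (intro nn_integral_mono_AE) (auto elim!: eventually_mono intro: ennreal_le_add)
      also have "\<dots> = (\<integral>\<^sup>+\<omega>. ennreal (g \<omega>) \<partial>N) + (\<integral>\<^sup>+\<omega>. ennreal (h \<omega>) \<partial>N)"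
        by (rule nn_integral_add) measurable
      also have "\<dots> < \<infinity>" using that(4,5) by simp
      finally show ?thesis .
    qed
    have gm: "(\<integral>\<^sup>+\<omega>. ennreal (- gain \<omega>) \<partial>N) < \<infinity>"
      by (rule mono[of _ Y "\<lambda>\<omega>. - Z' \<omega>"]) (use True le in \<open>auto elim: eventually_mono\<close>)
    then have gp: "(\<integral>\<^sup>+\<omega>. ennreal (gain \<omega>) \<partial>N) < \<infinity>" using gain_balance by (rule le_less_trans[rotated])
    have gain_int: "integrable N gain" using gm gp by (auto simp: real_integrable_def)
    have "(\<integral>\<omega>. gain \<omega> \<partial>N) \<le> 0"
      using gain_balance gm unfolding real_lebesgue_integral_def[OF gain_int] by (simp add: enn2real_mono)
    have Zp: "?Zp < \<infinity>"
      by (rule mono[of _ Y gain]) (use True gp le in \<open>auto elim: eventually_mono\<close>)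
    have Ym: "?Ym < \<infinity>"
      by (rule mono[of _ "\<lambda>\<omega>. - Z' \<omega>" gain]) (use True gp le in \<open>auto elim: eventually_mono\<close>)
    have Z_int: "integrable N Z'" and Y_int: "integrable N Y"
      using True Zp Ym by (auto simp: real_integrable_def)
    have real_val: "enn2ereal (\<integral>\<^sup>+\<omega>. ennreal (f \<omega>) \<partial>N) - enn2ereal (\<integral>\<^sup>+\<omega>. ennreal (- f \<omega>) \<partial>N) = ereal (\<integral>\<omega>. f \<omega> \<partial>N)"
      if "integrable N f" for f
      using that unfolding real_lebesgue_integral_def[OF that]
      by (cases "\<integral>\<^sup>+\<omega>. ennreal (f \<omega>) \<partial>N"; cases "\<integral>\<^sup>+\<omega>. ennreal (- f \<omega>) \<partial>N")
         (auto simp: real_integrable_def enn2ereal_ennreal)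
    have "(\<integral>\<omega>. Z' \<omega> \<partial>N) \<le> (\<integral>\<omega>. Y \<omega> + gain \<omega> \<partial>N)"
      using le Z_int Y_int gain_int by (intro integral_mono_AE) (auto elim: eventually_mono)
    also have "\<dots> \<le> (\<integral>\<omega>. Y \<omega> \<partial>N)" using Y_int gain_int \<open>(\<integral>\<omega>. gain \<omega> \<partial>N) \<le> 0\<close> by simp
    finally show ?thesis unfolding v_eq v'_eq real_val[OF Z_int] real_val[OF Y_int] by simp
  qed
qed

end

end

theorem theorem4:
  fixes T :: real and \<mu> :: "real measure"
    and F :: "real \<Rightarrow> real \<Rightarrow> real" and a :: "real \<Rightarrow> ereal" and g :: "real \<Rightarrow> real"
  assumes "T > 0"
    and "prob_space \<mu>" and "sets \<mu> = sets borel"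
    and "centred \<mu>"
    and no_atoms: "\<And>x. measure \<mu> {x} = 0"
    and "continuous_on UNIV (\<lambda>(w, s). F w s)"
    and "strictly_supermodular F"
    and "serrated_with_ridge F a"
    and g_def: "g = ridge_map \<mu> a"
  shows "(\<exists>(N :: (real \<times> real) measure) \<F> M.
            admissible T \<mu> N \<F> M \<and> terminal_max_law T N M = graph_pushforward \<mu> g) \<and>
         (\<forall>(N :: 'a measure) \<F> M (N' :: 'b measure) \<F>' M' v v'.
            admissible T \<mu> N \<F> M \<longrightarrow> terminal_max_law T N M = graph_pushforward \<mu> g \<longrightarrow>
            admissible T \<mu> N' \<F>' M' \<longrightarrow>
            functional_value F T N M v \<longrightarrow> functional_value F T N' M' v' \<longrightarrow>
            v' \<le> v)"
proof -
  interpret optimality \<mu> F a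
    using assms by (intro optimality.intro centred_law.intro real_distribution.intro
      real_distribution_axioms.intro centred_law_axioms.intro serrated_payoff.intro)
  have g_meas [measurable]: "g \<in> borel_measurable borel"
    unfolding g_def by (rule ridge_map_measurable[OF a_mono])
  have "v' \<le> v"
    if adm: "admissible T \<mu> N \<F> M" and law: "terminal_max_law T N M = graph_pushforward \<mu> g"
      and adm': "admissible T \<mu> N' \<F>' M'"
      and v: "functional_value F T N M v" and v': "functional_value F T N' M' v'"
    for N :: "'a measure" and \<F> M and N' :: "'b measure" and \<F>' M' v v'
  proof -
    interpret P: admissible_process T \<mu> N \<F> M
      using adm \<open>T > 0\<close> by (rule admissible_process.intro[rotated])
    interpret P': admissible_process T \<mu> N' \<F>' M'
      using adm' \<open>T > 0\<close> by (rule admissible_process.intro[rotated])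
    note [measurable] = P.measurable_max P.measurable_X[OF P.T_mem] P'.measurable_max P'.measurable_X[OF P'.T_mem]
    \<comment> \<open>The value at the candidate depends only on its joint law and can be rewritten
      on the competitor's space, where both payoffs share one terminal value. The factor
      \<open>c\<close> is 1 for the positive and -1 for the negative part.\<close>
    have "(\<integral>\<^sup>+\<omega>. ennreal (c * F (M T \<omega>) (running_max T M \<omega>)) \<partial>N)
        = (\<integral>\<^sup>+\<omega>. ennreal (c * F (M' T \<omega>) (g (M' T \<omega>))) \<partial>N')" for c
    proof -
      have "(\<integral>\<^sup>+\<omega>. ennreal (c * F (M T \<omega>) (running_max T M \<omega>)) \<partial>N)
          = (\<integral>\<^sup>+x. ennreal (c * F (fst x) (snd x)) \<partial>terminal_max_law T N M)"
        unfolding terminal_max_law_def by (subst nn_integral_distr) auto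
      also have "\<dots> = (\<integral>\<^sup>+w. ennreal (c * F w (g w)) \<partial>\<mu>)"
        unfolding law graph_pushforward_def by (subst nn_integral_distr) auto
      also have "\<dots> = (\<integral>\<^sup>+\<omega>. ennreal (c * F (M' T \<omega>) (g (M' T \<omega>))) \<partial>N')"
        unfolding P'.law_X[symmetric] by (subst nn_integral_distr) auto
      finally show ?thesis .
    qed
    from this[of 1] this[of "-1"]
    have "has_expectation N' (\<lambda>\<omega>. F (M' T \<omega>) (g (M' T \<omega>))) v"
      using v unfolding functional_value_def has_expectation_def by simp
    moreover have "measure N' {\<omega>\<in>space N'. z \<le> running_max T M' \<omega>} \<le> measure \<mu> (exceed z)" for z
      by (rule prob_le_exceed[OF P'.prob_space_axioms _ P'.law_X _ P'.doob]) measurable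
    ultimately show "v' \<le> v"
      using expectation_le[OF P'.prob_space_axioms _ _ P'.law_X P'.max_ge, of v v'] v'
      unfolding functional_value_def g_def by simp
  qed
  then show ?thesis using ex_admissible_ridge_map[OF a_mono \<open>T > 0\<close>] unfolding g_def by blast
qed

end
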